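(* Let $M$ be a (connected) Riemann surface and $f:M\to S^3$ a conformal immersion, whose image is not contained in a (round) $2$-sphere and whose Schwarzian derivative $S_z(f)$ is holomorphic. Then $f$ is a cyclide of Dupin.
   Context: Let $\mathbb R^{4,1}$ carry the Lorentzian form $\langle v,v\rangle=-v_0^2+\sum_{k=1}^{4}v_k^2$ (extended complex bilinearly), with forward light cone $\mathcal L_+$. Identify $S^3$ with the projectivized light cone via $x\leftrightarrow[1:x]$; the Möbius group is the group of conformal diffeomorphisms of $S^3$, induced by Lorentz transformations. For a conformal immersion $f:M\to S^3$ and a local holomorphic coordinate $z$ there is a unique normalized lift $\psi$ with values in $\mathcal L_+$ such that $\psi(p)$ spans the null line $f(p)$ and $|d\psi|^2=|dz|^2$. Let $V=\mathrm{span}\{\psi,d\psi,\psi_{z\bar z}\}$, a rank $4$ subbundle of $M\times\mathbb R^{4,1}$ of signature $(3,1)$. The equation $\psi_{zz}+\frac c2\psi=\kappa$ with $\kappa\in\Gamma(V^\perp\otimes\mathbb C)$ defines the complex valued function $c=S_z(f)$, the Schwarzian derivative of $f$ in the coordinate $z$. Under a change of holomorphic coordinate, $S_w(f)dw^2=(S_z(f)-S_z(w))dz^2$ with $S_z(w)$ the (holomorphic) classical Schwarzian of $w$, so the condition that $S_z(f)$ be holomorphic is independent of the choice of holomorphic coordinate $z$; the hypothesis is that it holds in every local holomorphic coordinate. A cyclide of Dupin is a homogeneous surface in Möbius geometry, i.e. a surface in $S^3$ which is a $2$-parameter orbit of the Möbius group: (an open piece of) a $2$-dimensional orbit of a $2$-parameter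 group (a $2$-dimensional connected abelian Lie subgroup, whose two parameters give coordinates on the surface) of Möbius transformations. The statement is understood locally: that $f$ is a cyclide of Dupin means that $f(M)$ is contained in such an orbit. *)

theory Defs
  imports "HOL-Complex_Analysis.Complex_Analysis"
begin

section \<open>Smooth maps\<close>

fun Ck_on :: "nat \<Rightarrow> ('a::real_normed_vector \<Rightarrow> 'b::real_normed_vector) \<Rightarrow> 'a set \<Rightarrow> bool" where
  "Ck_on 0 g S \<longleftrightarrow> continuous_on S g"
| "Ck_on (Suc k) g S \<longleftrightarrow>
     g differentiable_on S \<and> (\<forall>v. Ck_on k (\<lambda>x. frechet_derivative g (at x) v) S)"

text \<open>Intended for finite-dimensional domains, where testing each direction v separately is enough.\<close>

definition smooth_on :: "('a::real_normed_vector \<Rightarrow> 'b::real_normed_vector) \<Rightarrow> 'a set \<Rightarrow> bool" where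
  "smooth_on g S \<longleftrightarrow> open S \<and> (\<forall>k. Ck_on k g S)"


section \<open>Riemann surfaces\<close>

text \<open>A chart is a pair of a domain U and a function z, of which only the values on U matter.\<close>

definition complex_chart :: "'m topology \<Rightarrow> 'm set \<times> ('m \<Rightarrow> complex) \<Rightarrow> bool" where
  "complex_chart X = (\<lambda>(U, z). openin X U \<and> open (z ` U) \<and>
     homeomorphic_map (subtopology X U) (top_of_set (z ` U)) z)"

definition holomorphic_transition ::
    "'m set \<times> ('m \<Rightarrow> complex) \<Rightarrow> 'm set \<times> ('m \<Rightarrow> complex) \<Rightarrow> bool" where
  "holomorphic_transition = (\<lambda>(U, z) (V, w). (w \<circ> inv_into U z) holomorphic_on z ` (U \<inter> V))"

text \<open>Second countability is not required; for connected surfaces it is automatic (Rado).\<close>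

definition riemann_surface :: "'m topology \<Rightarrow> ('m set \<times> ('m \<Rightarrow> complex)) set \<Rightarrow> bool" where
  "riemann_surface X A \<longleftrightarrow>
     connected_space X \<and> Hausdorff_space X \<and>
     (\<forall>a\<in>A. complex_chart X a) \<and> \<Union> (fst ` A) = topspace X \<and>
     (\<forall>a\<in>A. \<forall>b\<in>A. holomorphic_transition a b)"

definition holomorphic_coordinate ::
    "'m topology \<Rightarrow> ('m set \<times> ('m \<Rightarrow> complex)) set \<Rightarrow> 'm set \<Rightarrow> ('m \<Rightarrow> complex) \<Rightarrow> bool" where
  "holomorphic_coordinate X A U z \<longleftrightarrow> complex_chart X (U, z) \<and>
     (\<forall>a\<in>A. holomorphic_transition a (U, z) \<and> holomorphic_transition (U, z) a)"


section \<open>Lorentz space and the conformal 3-sphere\<close>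

text \<open>
  The vector with time component t and space component x is the pair (t, x), with real entries
  or, for the complexification, complex entries.  The 3-sphere is the unit sphere of
  \<^typ>\<open>real^4\<close>, and its point x corresponds to the null line spanned by (1, x).
\<close>

type_synonym 'k minkowski = "'k \<times> ('k^4)"

definition lorentz_form :: "'k::comm_ring_1 minkowski \<Rightarrow> 'k minkowski \<Rightarrow> 'k" where
  "lorentz_form v w = - (fst v * fst w) + (\<Sum>k\<in>UNIV. snd v $ k * snd w $ k)"

definition forward_light_cone :: "real minkowski set" where
  "forward_light_cone = {v. lorentz_form v v = 0 \<and> fst v > 0}"

definition cvec :: "real minkowski \<Rightarrow> complex minkowski" where
  "cvec v = (of_real (fst v), \<chi> k. of_real (snd v $ k))"

definition Re_vec :: "complex minkowski \<Rightarrow> real minkowski" where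
  "Re_vec v = (Re (fst v), \<chi> k. Re (snd v $ k))"

definition Im_vec :: "complex minkowski \<Rightarrow> real minkowski" where
  "Im_vec v = (Im (fst v), \<chi> k. Im (snd v $ k))"

definition cscale :: "complex \<Rightarrow> complex minkowski \<Rightarrow> complex minkowski" where
  "cscale c v = (c * fst v, c *s snd v)"

definition lorentz_perp :: "real minkowski set \<Rightarrow> real minkowski set" where
  "lorentz_perp W = {u. \<forall>w\<in>W. lorentz_form u w = 0}"

definition complexify :: "real minkowski set \<Rightarrow> complex minkowski set" where
  "complexify W = {u. Re_vec u \<in> W \<and> Im_vec u \<in> W}"

definition round_2_sphere :: "(real^4) set \<Rightarrow> bool" where
  "round_2_sphere S \<longleftrightarrow>
     (\<exists>n d. norm n = 1 \<and> \<bar>d\<bar> < 1 \<and> S = {x \<in> sphere 0 1. n \<bullet> x = d})"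


section \<open>Conformal immersions and the Schwarzian derivative\<close>

definition conformal_immersion ::
    "'m topology \<Rightarrow> ('m set \<times> ('m \<Rightarrow> complex)) set \<Rightarrow> ('m \<Rightarrow> real^4) \<Rightarrow> bool" where
  "conformal_immersion X A f \<longleftrightarrow> f ` topspace X \<subseteq> sphere 0 1 \<and>
     (\<forall>U z. holomorphic_coordinate X A U z \<longrightarrow>
        smooth_on (f \<circ> inv_into U z) (z ` U) \<and>
        (\<forall>\<zeta>\<in>z ` U. \<exists>r>0. \<forall>v w.
           frechet_derivative (f \<circ> inv_into U z) (at \<zeta>) v \<bullet>
           frechet_derivative (f \<circ> inv_into U z) (at \<zeta>) w = r * (v \<bullet> w)))"

definition d_z :: "(complex \<Rightarrow> complex minkowski) \<Rightarrow> complex \<Rightarrow> complex minkowski" where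
  "d_z g \<zeta> = cscale (1/2)
     (frechet_derivative g (at \<zeta>) 1 - cscale \<i> (frechet_derivative g (at \<zeta>) \<i>))"

definition d_zbar :: "(complex \<Rightarrow> complex minkowski) \<Rightarrow> complex \<Rightarrow> complex minkowski" where
  "d_zbar g \<zeta> = cscale (1/2)
     (frechet_derivative g (at \<zeta>) 1 + cscale \<i> (frechet_derivative g (at \<zeta>) \<i>))"

text \<open>
  Below, D is the image of a holomorphic coordinate and F, \<psi>, c are the immersion, the lift
  and the Schwarzian expressed in that coordinate, that is, as functions on D.
\<close>

definition normalized_lift ::
    "complex set \<Rightarrow> (complex \<Rightarrow> real^4) \<Rightarrow> (complex \<Rightarrow> real minkowski) \<Rightarrow> bool" where
  "normalized_lift D F \<psi> \<longleftrightarrow> smooth_on \<psi> D \<and>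
     (\<forall>\<zeta>\<in>D. \<psi> \<zeta> \<in> forward_light_cone \<and> span {\<psi> \<zeta>} = span {(1, F \<zeta>)} \<and>
        (\<forall>v. lorentz_form (frechet_derivative \<psi> (at \<zeta>) v) (frechet_derivative \<psi> (at \<zeta>) v)
             = (norm v)\<^sup>2))"

text \<open>
  The fibre of V.  The mixed derivative of the real map \<psi> is itself real, so taking its real
  part only changes its type.
\<close>

definition V_fibre :: "(complex \<Rightarrow> real minkowski) \<Rightarrow> complex \<Rightarrow> real minkowski set" where
  "V_fibre \<psi> \<zeta> = span ({\<psi> \<zeta>} \<union> range (frechet_derivative \<psi> (at \<zeta>)) \<union>
     {Re_vec (d_z (d_zbar (cvec \<circ> \<psi>)) \<zeta>)})"

definition is_schwarzian ::
    "complex set \<Rightarrow> (complex \<Rightarrow> real^4) \<Rightarrow> (complex \<Rightarrow> complex) \<Rightarrow> bool" where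
  "is_schwarzian D F c \<longleftrightarrow> (\<exists>\<psi>. normalized_lift D F \<psi> \<and>
     (\<forall>\<zeta>\<in>D. d_z (d_z (cvec \<circ> \<psi>)) \<zeta> + cscale (c \<zeta> / 2) (cvec (\<psi> \<zeta>))
             \<in> complexify (lorentz_perp (V_fibre \<psi> \<zeta>))))"

text \<open>The function c is unique on D, because the lift \<psi> is.\<close>

definition holomorphic_schwarzian ::
    "'m topology \<Rightarrow> ('m set \<times> ('m \<Rightarrow> complex)) set \<Rightarrow> ('m \<Rightarrow> real^4) \<Rightarrow> bool" where
  "holomorphic_schwarzian X A f \<longleftrightarrow>
     (\<forall>U z. holomorphic_coordinate X A U z \<longrightarrow>
        (\<exists>c. is_schwarzian (z ` U) (f \<circ> inv_into U z) c \<and> c holomorphic_on z ` U))"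


section \<open>Moebius transformations and cyclides of Dupin\<close>

definition lorentz_transformation :: "(real minkowski \<Rightarrow>\<^sub>L real minkowski) \<Rightarrow> bool" where
  "lorentz_transformation L \<longleftrightarrow>
     (\<forall>v w. lorentz_form (blinfun_apply L v) (blinfun_apply L w) = lorentz_form v w) \<and>
     blinfun_apply L ` forward_light_cone \<subseteq> forward_light_cone"

text \<open>
  The conformal diffeomorphism of the 3-sphere induced by L: the image y of x is determined by
  the requirement that (1, y) and L (1, x) span the same line.  This makes the Moebius group
  isomorphic to the group of Lorentz transformations as above.
\<close>

definition moebius :: "(real minkowski \<Rightarrow>\<^sub>L real minkowski) \<Rightarrow> real^4 \<Rightarrow> real^4" where
  "moebius L x = snd (blinfun_apply L (1, x)) /\<^sub>R fst (blinfun_apply L (1, x))"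

text \<open>
  A 2-parameter group is a smooth homomorphism from the plane to the Moebius group whose
  differential is injective.  Its range is a 2-dimensional connected abelian Lie subgroup (not
  necessarily closed), and every such subgroup arises in this way, its universal cover being
  the additive group of the plane.
\<close>

definition two_parameter_group :: "(real \<times> real \<Rightarrow> (real minkowski \<Rightarrow>\<^sub>L real minkowski)) \<Rightarrow> bool"
  where "two_parameter_group \<Phi> \<longleftrightarrow>
     smooth_on \<Phi> UNIV \<and> (\<forall>t. lorentz_transformation (\<Phi> t)) \<and>
     (\<forall>s t. \<Phi> (s + t) = \<Phi> s o\<^sub>L \<Phi> t) \<and>
     inj (frechet_derivative \<Phi> (at 0))"

text \<open>
  The last condition says that the orbit is 2-dimensional, with the two parameters of the group
  as local coordinates.
\<close>

definition dupin_orbit :: "(real^4) set \<Rightarrow> bool" where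
  "dupin_orbit S \<longleftrightarrow> (\<exists>\<Phi> x. two_parameter_group \<Phi> \<and> x \<in> sphere 0 1 \<and>
     S = range (\<lambda>t. moebius (\<Phi> t) x) \<and>
     (\<forall>t. inj (frechet_derivative (\<lambda>s. moebius (\<Phi> s) x) (at t))))"

definition cyclide_of_Dupin :: "'m topology \<Rightarrow> ('m \<Rightarrow> real^4) \<Rightarrow> bool" where
  "cyclide_of_Dupin X f \<longleftrightarrow> (\<exists>S. dupin_orbit S \<and> f ` topspace X \<subseteq> S)"

end

theory Submission
  imports Defs
begin

text \<open>
  Write the normalised lift as \<psi> and \<kappa> = k N with a unit normal N of V. Repeated
  differentiation of \<open>\<langle>\<psi>,\<psi>\<rangle> = 0\<close>,
  \<open>\<langle>\<psi>_z,\<psi>_z\<rangle> = 0\<close> and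
  \<open>\<langle>\<psi>_z,\<psi>_zbar\<rangle> = 1/2\<close>, together with \<kappa> being
  orthogonal to V, gives \<open>c = 4 \<langle>\<psi>_zz,\<psi>_zzbar\<rangle>\<close> and the
  Gauss equation. If c is holomorphic, the Gauss equation says that h = k^3 conj(k) is
  holomorphic (lemmas gauss, quartic_derivs). The expression h dz^4 does not depend on the
  coordinate (coordinate_change), so it is a holomorphic quartic differential on the surface.

  An isolated zero of h is impossible: near it k^2 is, up to a holomorphic factor, a
  fractional power of conj(h), whose antiholomorphic derivatives of high order are unbounded,
  while k^2 is smooth (quartic_no_finite_order_zero). So h vanishes everywhere or nowhere on
  the connected surface (quartic_dichotomy).

  If h = 0, then \<kappa> = 0, the derivatives of a frame of V are again sections of V, and V
  is constant. A unit vector orthogonal to V cuts out a round 2-sphere that contains the image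
  (umbilic_in_round_sphere).

  If h has no zeros, a primitive of a fourth root of h is a coordinate z = x + i y in which h
  = 1. Then \<kappa> is a real unit normal and its z-derivative is -2
  \<open>\<psi>_zbar\<close>. Equality of mixed derivatives makes c real and
  \<open>\<psi>_zz\<close> real, that is \<open>\<psi>_xy = 0\<close>, and
  \<open>\<psi>_xxx\<close> and \<open>\<psi>_yyy\<close> become multiples of
  \<open>\<psi>_x\<close> and \<open>\<psi>_y\<close> (curvature_line_equations). Therefore
  the infinitesimal Lorentz transformations \<open>v \<mapsto> \<langle>v,\<psi>_x\<rangle>
  \<psi>_xx - \<langle>v,\<psi>_xx\<rangle> \<psi>_x\<close> and \<open>v \<mapsto>
  \<langle>v,\<psi>_y\<rangle> \<psi>_yy - \<langle>v,\<psi>_yy\<rangle> \<psi>_y\<close> do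
  not depend on the point. They commute, since they act in orthogonal planes, and they map
  \<psi> to \<open>\<psi>_x\<close> and \<open>\<psi>_y\<close>. So the group that they
  generate moves \<psi> along the surface (lift_flow). Two coordinates with h = 1 differ by a
  translation and a rotation through a multiple of a right angle, so the groups and the orbits
  found locally agree along the whole surface (normalised_match, nowhere_umbilic_imp_dupin).
\<close>

section \<open>Calculus of smooth maps\<close>

abbreviation fderiv where "fderiv g x \<equiv> frechet_derivative g (at x)"

lemma Ck_on_Suc_imp: "Ck_on (Suc k) g S \<Longrightarrow> Ck_on k g S"
proof (induction k arbitrary: g)
  case 0
  then show ?case by (simp add: differentiable_imp_continuous_on)
next
  case (Suc k)
  have "g differentiable_on S" "\<And>v. Ck_on (Suc k) (\<lambda>x. fderiv g x v) S"
    using Suc.prems by (metis Ck_on.simps(2))+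
  then show ?case using Suc.IH by (metis Ck_on.simps(2))
qed

lemma frechet_derivative_cong_open:
  assumes "open S" "x \<in> S" "\<And>y. y \<in> S \<Longrightarrow> f y = g y"
  shows "fderiv f x = fderiv g x"
proof -
  have "(f has_derivative D) (at x) \<longleftrightarrow> (g has_derivative D) (at x)" for D
    using assms has_derivative_transform_within_open[of f D x UNIV S g]
      has_derivative_transform_within_open[of g D x UNIV S f] by auto
  then show ?thesis unfolding frechet_derivative_def by simp
qed

lemma Ck_on_cong:
  assumes "open S" "\<And>y. y \<in> S \<Longrightarrow> f y = g y" "Ck_on k f S"
  shows "Ck_on k g S"
  using assms
proof (induction k arbitrary: f g)
  case 0
  then show ?case using continuous_on_cong[of S S f g] by simp
next
  case (Suc k)
  have "g differentiable (at x)" if "x \<in> S" for x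
  proof -
    have "f differentiable (at x)" 
      using Suc.prems(3) that by (simp add: differentiable_on_eq_differentiable_at[OF Suc.prems(1)])
    then show ?thesis unfolding differentiable_def
      using has_derivative_transform_within_open[OF _ Suc.prems(1) that] Suc.prems(2) by blast
  qed
  then have "g differentiable_on S" by (simp add: differentiable_on_eq_differentiable_at[OF Suc.prems(1)])
  moreover have "Ck_on k (\<lambda>x. fderiv g x v) S" for v
  proof (rule Suc.IH[OF Suc.prems(1)])
    show "Ck_on k (\<lambda>x. fderiv f x v) S" using Suc.prems by auto
    show "fderiv f y v = fderiv g y v" if "y \<in> S" for y
      using frechet_derivative_cong_open[OF Suc.prems(1) that Suc.prems(2)] by simp
  qed
  ultimately show ?case by simp
qed

lemma smooth_on_cong:
  "smooth_on f S \<Longrightarrow> (\<And>y. y \<in> S \<Longrightarrow> f y = g y) \<Longrightarrow> smooth_on g S"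
  unfolding smooth_on_def using Ck_on_cong by blast

lemma smooth_deriv:
  assumes "smooth_on g S" "x \<in> S"
  shows "(g has_derivative fderiv g x) (at x)"
proof -
  have "Ck_on (Suc 0) g S" "open S" using assms unfolding smooth_on_def by blast+
  then have "g differentiable (at x)"
    using assms(2) by (auto simp: differentiable_on_eq_differentiable_at)
  then show ?thesis by (simp add: frechet_derivative_works)
qed

lemma smooth_on_frechet: "smooth_on g S \<Longrightarrow> smooth_on (\<lambda>x. fderiv g x v) S"
  unfolding smooth_on_def by (metis Ck_on.simps(2))

lemma smooth_on_continuous: "smooth_on g S \<Longrightarrow> continuous_on S g"
  unfolding smooth_on_def by (metis Ck_on.simps(1))

lemma smooth_on_open: "smooth_on g S \<Longrightarrow> open S"
  by (simp add: smooth_on_def)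

lemma Ck_on_SucI:
  assumes "open S" "\<And>x. x \<in> S \<Longrightarrow> (g has_derivative g' x) (at x)" "\<And>v. Ck_on k (\<lambda>x. g' x v) S"
  shows "Ck_on (Suc k) g S"
proof -
  have "g differentiable_on S" 
    using assms(1,2) by (auto simp: differentiable_on_eq_differentiable_at differentiable_def)
  moreover have "Ck_on k (\<lambda>x. fderiv g x v) S" for v
    by (rule Ck_on_cong[OF assms(1) _ assms(3)[of v]])
      (simp add: frechet_derivative_at[OF assms(2), symmetric])
  ultimately show ?thesis by simp
qed

lemma Ck_on_has_derivative:
  assumes "Ck_on (Suc k) g S" "open S" "x \<in> S"
  shows "(g has_derivative fderiv g x) (at x)"
proof -
  have "g differentiable (at x)"
    using assms by (auto simp: differentiable_on_eq_differentiable_at)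
  then show ?thesis by (simp add: frechet_derivative_works)
qed

lemma Ck_on_const: "open S \<Longrightarrow> Ck_on k (\<lambda>x. c) S"
proof (induction k arbitrary: c)
  case (Suc k)
  show ?case by (rule Ck_on_SucI[OF Suc.prems, where g' = "\<lambda>_ _. 0"]) (simp_all add: Suc.IH[OF Suc.prems])
qed simp

lemma Ck_on_add:
  assumes "open S" "Ck_on k f S" "Ck_on k g S"
  shows "Ck_on k (\<lambda>x. f x + g x) S"
  using assms
proof (induction k arbitrary: f g)
  case 0
  then show ?case by (simp add: continuous_on_add)
next
  case (Suc k)
  show ?case
    by (rule Ck_on_SucI[OF Suc.prems(1)
        has_derivative_add[OF Ck_on_has_derivative[of k] Ck_on_has_derivative[of k]]])
      (use Suc.prems Suc.IH in \<open>simp_all\<close>)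
qed

lemma (in bounded_linear) Ck_on:
  assumes "open S" "Ck_on k g S"
  shows "Ck_on k (\<lambda>x. f (g x)) S"
  using assms
proof (induction k arbitrary: g)
  case 0
  then show ?case by (simp add: continuous_on)
next
  case (Suc k)
  show ?case
    by (rule Ck_on_SucI[OF Suc.prems(1) has_derivative[OF Ck_on_has_derivative[of k]]])
      (use Suc.prems Suc.IH in simp_all)
qed

lemma (in bounded_bilinear) Ck_on:
  assumes "open S" "Ck_on k f S" "Ck_on k g S"
  shows "Ck_on k (\<lambda>x. prod (f x) (g x)) S"
  using assms
proof (induction k arbitrary: f g)
  case 0
  then show ?case by (simp add: continuous_on)
next
  case (Suc k)
  have k: "Ck_on k f S" "Ck_on k g S" using Suc.prems Ck_on_Suc_imp by blast+
  show ?case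
    by (rule Ck_on_SucI[OF Suc.prems(1) FDERIV[OF Ck_on_has_derivative[of k] Ck_on_has_derivative[of k]]])
      (use Suc.prems Suc.IH k in \<open>simp_all add: Ck_on_add\<close>)
qed

lemma smooth_on_const: "open S \<Longrightarrow> smooth_on (\<lambda>x. c) S"
  by (simp add: smooth_on_def Ck_on_const)

lemma smooth_on_add: "smooth_on f S \<Longrightarrow> smooth_on g S \<Longrightarrow> smooth_on (\<lambda>x. f x + g x) S"
  by (simp add: smooth_on_def Ck_on_add)

lemma (in bounded_linear) smooth_on: "smooth_on g S \<Longrightarrow> smooth_on (\<lambda>x. f (g x)) S"
  by (simp add: smooth_on_def Ck_on)

lemma (in bounded_bilinear) smooth_on:
  "smooth_on f S \<Longrightarrow> smooth_on g S \<Longrightarrow> smooth_on (\<lambda>x. prod (f x) (g x)) S"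
  by (simp add: smooth_on_def Ck_on)

lemmas smooth_on_uminus = bounded_linear.smooth_on[OF bounded_linear_minus[OF bounded_linear_ident]]

lemma smooth_on_diff: "smooth_on f S \<Longrightarrow> smooth_on g S \<Longrightarrow> smooth_on (\<lambda>x. f x - g x) S"
  using smooth_on_add[OF _ smooth_on_uminus, of f S g] by simp

lemma frechet_Re_Im:
  assumes "smooth_on u D" "z \<in> D"
  shows "fderiv u z h = Re h *\<^sub>R fderiv u z 1 + Im h *\<^sub>R fderiv u z \<i>"
proof -
  have l: "linear (fderiv u z)"
    using smooth_deriv[OF assms] has_derivative_linear by blast
  have "fderiv u z h = fderiv u z (Re h *\<^sub>R 1 + Im h *\<^sub>R \<i>)"
    by (rule arg_cong[where f = "fderiv u z"]) (auto simp: complex_eq_iff)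
  then show ?thesis using l by (simp add: linear_add linear_scale)
qed

text \<open>
  Schwarz's theorem. The second difference of g over a small square is, by two applications of
  the mean value theorem in either order, a value of either mixed derivative near the corner.
\<close>

lemma mixed_partials_real:
  fixes g :: "complex \<Rightarrow> real"
  assumes g: "smooth_on g D" and z: "z \<in> D"
  shows "fderiv (\<lambda>x. fderiv g x 1) z \<i>
       = fderiv (\<lambda>x. fderiv g x \<i>) z 1"
proof -
  define gx where "gx = (\<lambda>x. fderiv g x 1)"
  define gy where "gy = (\<lambda>x. fderiv g x \<i>)"
  define gxy where "gxy = (\<lambda>x. fderiv gx x \<i>)"
  define gyx where "gyx = (\<lambda>x. fderiv gy x 1)"
  have sm: "smooth_on gx D" "smooth_on gy D"
    using g by (auto simp: gx_def gy_def intro: smooth_on_frechet)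
  then have ct: "continuous_on D gxy" "continuous_on D gyx"
    by (auto simp: gxy_def gyx_def intro!: smooth_on_continuous smooth_on_frechet)
  have oD: "open D" using g by (rule smooth_on_open)
  obtain e where e: "e > 0" "ball z e \<subseteq> D" using oD z open_contains_ball by blast
  have der: "((\<lambda>t. u (p + of_real t * d)) has_real_derivative fderiv u (p + of_real t * d) d) (at t)"
    if "smooth_on u D" "p + of_real t * d \<in> D" for u :: "complex \<Rightarrow> real" and p d t
  proof -
    have 1: "((\<lambda>t. p + of_real t * d) has_derivative (\<lambda>h. of_real h * d)) (at t)"
      by (auto intro!: derivative_eq_intros)
    have lin: "linear (fderiv u (p + of_real t * d))"
      using smooth_deriv[OF that] has_derivative_linear by blast
    have "((\<lambda>t. u (p + of_real t * d)) has_derivative (\<lambda>h. fderiv u (p + of_real t * d) (of_real h * d))) (at t)"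
      using has_derivative_compose[OF 1, of u "fderiv u (p + of_real t * d)"]
      smooth_deriv[OF that] by simp
    moreover have "fderiv u (p + of_real t * d) (of_real h * d) = h * fderiv u (p + of_real t * d) d" for h
      using linear_scale[OF lin, of h d] by (simp add: scaleR_conv_of_real)
    ultimately show ?thesis by (simp add: has_field_derivative_def mult.commute[of _ "frechet_derivative u _ d"])
  qed
  have mv: "\<exists>p\<in>ball z (2*h). g (z + of_real h * a + of_real h * b) - g (z + of_real h * a) - g (z + of_real h * b) + g z
      = h * h * fderiv (\<lambda>x. fderiv g x a) p b"
    if h: "0 < h" "2 * h < e" and ab: "norm a = 1" "norm b = 1" for h a b
  proof -
    have near: "dist z (z + of_real s * a + of_real t * b) \<le> s + t" if "0 \<le> s" "0 \<le> t" for s t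
      using norm_triangle_ineq[of "of_real s * a" "of_real t * b"] that ab
      by (metis (no_types, opaque_lifting) abs_of_nonneg add.assoc add_diff_cancel_left' dist_commute dist_norm mult.right_neutral norm_mult norm_of_real)
    have inD: "z + of_real s * a + of_real t * b \<in> D" if "0 \<le> s" "s \<le> h" "0 \<le> t" "t \<le> h" for s t
    proof -
      have "dist z (z + of_real s * a + of_real t * b) < e" using near[of s t] that h by linarith
      then show ?thesis using e by auto
    qed
    define w where "w s = g (z + of_real h * b + of_real s * a) - g (z + of_real s * a)" for s
    have dw: "(w has_real_derivative fderiv g (z + of_real h * b + of_real s * a) a
          - fderiv g (z + of_real s * a) a) (at s)" if "0 \<le> s" "s \<le> h" for s
      unfolding w_def
      using inD[of s h] inD[of s 0] that h by (intro DERIV_diff der[OF g]) (auto simp: algebra_simps)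
    obtain s where s: "0 < s" "s < h" "w h - w 0 = (h - 0) * (fderiv g (z + of_real h * b + of_real s * a) a
          - fderiv g (z + of_real s * a) a)"
      using MVT2[of 0 h w, OF _ dw] h by auto
    define ga where "ga = (\<lambda>x. fderiv g x a)"
    have sga: "smooth_on ga D" unfolding ga_def by (rule smooth_on_frechet[OF g])
    have dv: "((\<lambda>t. ga (z + of_real s * a + of_real t * b)) has_real_derivative
        fderiv ga (z + of_real s * a + of_real t * b) b) (at t)" if "0 \<le> t" "t \<le> h" for t
      using inD[of s t] that s by (intro der[OF sga]) auto
    obtain t where t: "0 < t" "t < h" "ga (z + of_real s * a + of_real h * b) - ga (z + of_real s * a + of_real 0 * b)
       = (h - 0) * fderiv ga (z + of_real s * a + of_real t * b) b"
      using MVT2[of 0 h "\<lambda>t. ga (z + of_real s * a + of_real t * b)", OF _ dv] h by auto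
    have "w h - w 0 = h * h * fderiv ga (z + of_real s * a + of_real t * b) b"
      using s(3) t(3) by (simp add: ga_def algebra_simps)
    then show ?thesis using near[of s t] s t unfolding w_def ga_def[symmetric]
      by (intro bexI[of _ "z + of_real s * a + of_real t * b"]) (auto simp: algebra_simps)
  qed
  have "gxy z = gyx z"
  proof (rule ccontr)
    assume ne: "gxy z \<noteq> gyx z"
    define \<epsilon> where "\<epsilon> = \<bar>gxy z - gyx z\<bar> / 2"
    have ep: "\<epsilon> > 0" using ne by (simp add: \<epsilon>_def)
    have "isCont gxy z" "isCont gyx z"
      using ct oD z continuous_on_eq_continuous_at by blast+
    then obtain d1 d2 where d: "d1 > 0" "\<And>p. dist p z < d1 \<Longrightarrow> dist (gxy p) (gxy z) < \<epsilon>"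
       "d2 > 0" "\<And>p. dist p z < d2 \<Longrightarrow> dist (gyx p) (gyx z) < \<epsilon>"
      using ep unfolding continuous_at_eps_delta by metis
    define h where "h = min e (min d1 d2) / 4"
    have h: "0 < h" "2 * h < e" "2 * h < d1" "2 * h < d2" using d(1,3) e(1) by (auto simp: h_def min_def)
    obtain p where p: "p \<in> ball z (2*h)" "g (z + of_real h * 1 + of_real h * \<i>) - g (z + of_real h * 1) - g (z + of_real h * \<i>) + g z = h * h * gxy p"
      using mv[OF h(1,2), of 1 \<i>] unfolding gxy_def gx_def by auto
    obtain q where q: "q \<in> ball z (2*h)" "g (z + of_real h * \<i> + of_real h * 1) - g (z + of_real h * \<i>) - g (z + of_real h * 1) + g z = h * h * gyx q"
      using mv[OF h(1,2), of \<i> 1] unfolding gyx_def gy_def by auto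
    have "h * h * gxy p = h * h * gyx q" using p(2) q(2) by (simp add: algebra_simps)
    then have "gxy p = gyx q" using h by simp
    moreover have "dist (gxy p) (gxy z) < \<epsilon>" "dist (gyx q) (gyx z) < \<epsilon>"
      using d(2)[of p] d(4)[of q] p(1) q(1) h by (auto simp: dist_commute)
    moreover have "\<bar>gxy z - gyx z\<bar> = 2 * \<epsilon>" by (simp add: \<epsilon>_def)
    ultimately show False unfolding dist_real_def by linarith
  qed
  then show ?thesis unfolding gxy_def gyx_def gx_def gy_def .
qed

lemma mixed_partials:
  fixes g :: "complex \<Rightarrow> 'a::euclidean_space"
  assumes g: "smooth_on g D" and z: "z \<in> D"
  shows "fderiv (\<lambda>x. fderiv g x 1) z \<i>
       = fderiv (\<lambda>x. fderiv g x \<i>) z 1"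
proof (rule euclidean_eqI)
  fix b :: 'a assume "b \<in> Basis"
  have oD: "open D" using g by (rule smooth_on_open)
  have sg: "smooth_on (\<lambda>x. g x \<bullet> b) D"
    by (rule bounded_linear.smooth_on[OF bounded_linear_inner_left g])
  have comp: "fderiv (\<lambda>x. u x \<bullet> b) x v = fderiv u x v \<bullet> b"
    if "smooth_on u D" "x \<in> D" for u :: "complex \<Rightarrow> 'a" and x v
    using frechet_derivative_at[OF bounded_linear.has_derivative[OF bounded_linear_inner_left smooth_deriv[OF that], of b]]
    by metis
  have "fderiv (\<lambda>x. fderiv (\<lambda>x. g x \<bullet> b) x v) z w
      = fderiv (\<lambda>x. fderiv g x v) z w \<bullet> b" for v w
  proof -
    have "fderiv (\<lambda>x. fderiv (\<lambda>x. g x \<bullet> b) x v) z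
       = fderiv (\<lambda>x. fderiv g x v \<bullet> b) z"
      by (rule frechet_derivative_cong_open[OF oD z]) (simp add: comp[OF g])
    then show ?thesis using comp[OF smooth_on_frechet[OF g] z] by simp
  qed
  then show "fderiv (\<lambda>x. fderiv g x 1) z \<i> \<bullet> b
       = fderiv (\<lambda>x. fderiv g x \<i>) z 1 \<bullet> b"
    using mixed_partials_real[OF sg z] by metis
qed

section \<open>Wirtinger calculus for maps into complexified Lorentz space\<close>

text \<open>
  The type of complex vectors carries no complex scalar multiplication of its own, so the
  complex linear structure is handled through \<^const>\<open>cscale\<close>. The operators
  below are the derivatives with respect to z and zbar for scalar functions, as
  \<^const>\<open>d_z\<close> and \<^const>\<open>d_zbar\<close> are for vector valued ones.
\<close>

definition cnj_vec :: "complex minkowski \<Rightarrow> complex minkowski" where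
  "cnj_vec v = (cnj (fst v), \<chi> k. cnj (snd v $ k))"

definition wirt :: "(complex \<Rightarrow> complex) \<Rightarrow> complex \<Rightarrow> complex" where
  "wirt a z = (fderiv a z 1 - \<i> * fderiv a z \<i>) / 2"

definition wirt_bar :: "(complex \<Rightarrow> complex) \<Rightarrow> complex \<Rightarrow> complex" where
  "wirt_bar a z = (fderiv a z 1 + \<i> * fderiv a z \<i>) / 2"

lemma minkowski_eqI:
  fixes v w :: "'k minkowski"
  shows "fst v = fst w \<Longrightarrow> (\<And>k. snd v $ k = snd w $ k) \<Longrightarrow> v = w"
  by (simp add: prod_eq_iff vec_eq_iff)

lemma cscale_nth [simp]: "fst (cscale c v) = c * fst v" "snd (cscale c v) $ k = c * snd v $ k"
  by (simp_all add: cscale_def)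

lemma cvec_nth [simp]: "fst (cvec w) = of_real (fst w)" "snd (cvec w) $ k = of_real (snd w $ k)"
  by (simp_all add: cvec_def)

lemma cnj_vec_nth [simp]: "fst (cnj_vec v) = cnj (fst v)" "snd (cnj_vec v) $ k = cnj (snd v $ k)"
  by (simp_all add: cnj_vec_def)

lemma Re_vec_nth [simp]: "fst (Re_vec v) = Re (fst v)" "snd (Re_vec v) $ k = Re (snd v $ k)"
  by (simp_all add: Re_vec_def)

lemma Im_vec_nth [simp]: "fst (Im_vec v) = Im (fst v)" "snd (Im_vec v) $ k = Im (snd v $ k)"
  by (simp_all add: Im_vec_def)

lemma bilinear_lorentz_form_real: "bilinear (lorentz_form :: real minkowski \<Rightarrow> _)"
  by (auto simp: bilinear_def linear_iff lorentz_form_def algebra_simps sum.distrib sum_distrib_left)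

lemma bilinear_lorentz_form_complex: "bilinear (lorentz_form :: complex minkowski \<Rightarrow> _)"
  by (auto simp: bilinear_def linear_iff lorentz_form_def algebra_simps sum.distrib scaleR_sum_right)

lemma bilinear_cscale: "bilinear cscale"
  by (auto simp: bilinear_def linear_iff algebra_simps intro!: minkowski_eqI)

abbreviation form where "form \<equiv> lorentz_form"

interpretation form: bounded_bilinear "form :: real minkowski \<Rightarrow> _"
  using bilinear_lorentz_form_real by (simp add: bilinear_conv_bounded_bilinear)

interpretation cform: bounded_bilinear "form :: complex minkowski \<Rightarrow> _"
  using bilinear_lorentz_form_complex by (simp add: bilinear_conv_bounded_bilinear)

interpretation cscale: bounded_bilinear cscale
  using bilinear_cscale by (simp add: bilinear_conv_bounded_bilinear)

lemma bounded_linear_cvec: "bounded_linear cvec"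
  by (auto simp: linear_conv_bounded_linear[symmetric] linear_iff intro!: minkowski_eqI)
    (auto simp: scaleR_conv_of_real)

lemma bounded_linear_cnj_vec: "bounded_linear cnj_vec"
  by (auto simp: linear_conv_bounded_linear[symmetric] linear_iff intro!: minkowski_eqI)

lemma form_commute: "form v w = form w v"
  by (simp add: lorentz_form_def mult.commute)

lemma cform_scale [simp]:
  "form (cscale a v) w = a * form v w"
  "form v (cscale a w) = a * form v w"
  by (simp_all add: lorentz_form_def algebra_simps sum_distrib_left)

lemma cform_cnj [simp]: "form (cnj_vec v) (cnj_vec w) = cnj (form v w)"
  by (simp add: lorentz_form_def)

lemma cform_cvec [simp]: "form (cvec v) (cvec w) = of_real (form v w)"
  by (simp add: lorentz_form_def)

lemma cnj_cvec [simp]: "cnj_vec (cvec v) = cvec v"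
  by (simp add: minkowski_eqI)

lemma cnj_cnj_vec [simp]: "cnj_vec (cnj_vec v) = v"
  by (simp add: minkowski_eqI)

lemma cnj_cscale [simp]: "cnj_vec (cscale a v) = cscale (cnj a) (cnj_vec v)"
  by (simp add: minkowski_eqI)

lemma cscale_cscale [simp]: "cscale a (cscale b v) = cscale (a * b) v"
  by (simp add: minkowski_eqI)

lemma cscale_1 [simp]: "cscale 1 v = v"
  by (simp add: minkowski_eqI)

lemma cvec_Re_Im: "v = cvec (Re_vec v) + cscale \<i> (cvec (Im_vec v))"
  by (rule minkowski_eqI) (auto simp: complex_eq_iff)

lemma Re_vec_cvec [simp]: "Re_vec (cvec v) = v" "Im_vec (cvec v) = 0"
  by (auto intro!: minkowski_eqI)

lemma cvec_eq_iff [simp]: "cvec v = cvec w \<longleftrightarrow> v = w"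
  by (metis Re_vec_cvec(1))

lemma cvec_Re_eq: "Im_vec v = 0 \<Longrightarrow> cvec (Re_vec v) = v"
  by (metis add.right_neutral cscale.zero_right linear_0[OF bounded_linear.linear[OF bounded_linear_cvec]] cvec_Re_Im)

lemma cvec_Re_vec_cnj: "cnj_vec v = v \<Longrightarrow> cvec (Re_vec v) = v"
  by (rule minkowski_eqI) (auto simp: complex_eq_iff prod_eq_iff vec_eq_iff)

lemma Re_Im_form_cvec:
  "Re (form v (cvec w)) = form (Re_vec v) w"
  "Im (form v (cvec w)) = form (Im_vec v) w"
  by (simp_all add: lorentz_form_def)

context
  fixes D :: "complex set" and u v :: "complex \<Rightarrow> complex minkowski" and z :: complex
  assumes u: "smooth_on u D" and v: "smooth_on v D" and z: "z \<in> D"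
begin

lemma wirt_form:
  "wirt (\<lambda>x. form (u x) (v x)) z = form (d_z u z) (v z) + form (u z) (d_z v z)"
  "wirt_bar (\<lambda>x. form (u x) (v x)) z = form (d_zbar u z) (v z) + form (u z) (d_zbar v z)"
  unfolding wirt_def wirt_bar_def d_z_def d_zbar_def
    frechet_derivative_at[OF cform.FDERIV[OF smooth_deriv[OF u z] smooth_deriv[OF v z]], symmetric]
  by (simp_all add: cform.add_left cform.add_right cform.diff_left cform.diff_right field_simps)

lemma d_z_add:
  "d_z (\<lambda>x. u x + v x) z = d_z u z + d_z v z"
  "d_zbar (\<lambda>x. u x + v x) z = d_zbar u z + d_zbar v z"
  unfolding d_z_def d_zbar_def
    frechet_derivative_at[OF has_derivative_add[OF smooth_deriv[OF u z] smooth_deriv[OF v z]], symmetric]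
  by (simp_all add: cscale.add_right cscale.diff_right)

end

lemma smooth_on_d_z:
  assumes "smooth_on u D"
  shows "smooth_on (d_z u) D" "smooth_on (d_zbar u) D"
proof -
  have sc: "smooth_on (\<lambda>z. cscale a (w z)) D" if "smooth_on w D" for a w
    by (rule bounded_linear.smooth_on[OF cscale.bounded_linear_right that])
  note fr = smooth_on_frechet[OF assms]
  show "smooth_on (d_z u) D" "smooth_on (d_zbar u) D"
    unfolding d_z_def[abs_def] d_zbar_def[abs_def]
    by (rule sc, rule smooth_on_diff smooth_on_add, rule fr, rule sc, rule fr)+
qed

lemma smooth_on_wirt:
  assumes "smooth_on a D"
  shows "smooth_on (wirt a) D" "smooth_on (wirt_bar a) D"
proof -
  have sc: "smooth_on (\<lambda>z. w z / b) D" "smooth_on (\<lambda>z. b * w z) D" if "smooth_on w D" for b :: complex and w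
    by (rule bounded_linear.smooth_on[OF bounded_linear_divide that]
        bounded_linear.smooth_on[OF bounded_linear_mult_right that])+
  note fr = smooth_on_frechet[OF assms]
  show "smooth_on (wirt a) D" "smooth_on (wirt_bar a) D"
    unfolding wirt_def[abs_def] wirt_bar_def[abs_def]
    by (rule sc, rule smooth_on_diff smooth_on_add, rule fr, rule sc, rule fr)+
qed

lemma d_z_cong_open:
  assumes "open D" "z \<in> D" "\<And>x. x \<in> D \<Longrightarrow> u x = v x"
  shows "d_z u z = d_z v z" "d_zbar u z = d_zbar v z"
  using frechet_derivative_cong_open[OF assms] by (simp_all add: d_z_def d_zbar_def)

lemma wirt_cong_open:
  assumes "open D" "z \<in> D" "\<And>x. x \<in> D \<Longrightarrow> a x = b x"
  shows "wirt a z = wirt b z" "wirt_bar a z = wirt_bar b z"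
  using frechet_derivative_cong_open[OF assms] by (simp_all add: wirt_def wirt_bar_def)

lemma wirt_const [simp]: "wirt (\<lambda>x. a) z = 0" "wirt_bar (\<lambda>x. a) z = 0"
  by (simp_all add: wirt_def wirt_bar_def)

lemma pair_const_deriv:
  assumes "smooth_on u D" "smooth_on v D" 
    "\<And>x. x \<in> D \<Longrightarrow> form (u x) (v x) = k" "z \<in> D"
  shows "form (d_z u z) (v z) + form (u z) (d_z v z) = 0"
    "form (d_zbar u z) (v z) + form (u z) (d_zbar v z) = 0"
  using wirt_form[OF assms(1,2,4)] wirt_cong_open[OF smooth_on_open[OF assms(1)] assms(4,3)] by auto

lemma d_z_cnj:
  assumes "smooth_on u D" "z \<in> D"
  shows "d_z (\<lambda>x. cnj_vec (u x)) z = cnj_vec (d_zbar u z)"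
    "d_zbar (\<lambda>x. cnj_vec (u x)) z = cnj_vec (d_z u z)"
  unfolding d_z_def d_zbar_def
    frechet_derivative_at[OF bounded_linear.has_derivative[OF bounded_linear_cnj_vec, OF smooth_deriv[OF assms]], symmetric]
  by (simp_all add: minkowski_eqI)

text \<open>
  Both sides are a quarter of the Laplacian, by the symmetry of second derivatives.
\<close>

lemma d_z_d_zbar_commute:
  assumes u: "smooth_on u D" and z: "z \<in> D"
  shows "d_z (d_zbar u) z = d_zbar (d_z u) z"
proof -
  define ux where "ux = (\<lambda>x. fderiv u x 1)"
  define uy where "uy = (\<lambda>x. fderiv u x \<i>)"
  have s: "smooth_on ux D" "smooth_on uy D"
    using u by (auto simp: ux_def uy_def intro: smooth_on_frechet)
  have m: "fderiv ux z \<i> = fderiv uy z 1"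
    unfolding ux_def uy_def by (rule mixed_partials[OF u z])
  have zb: "d_zbar u = (\<lambda>x. cscale (1/2) (ux x + cscale \<i> (uy x)))"
    and zz: "d_z u = (\<lambda>x. cscale (1/2) (ux x - cscale \<i> (uy x)))"
    by (auto simp: d_zbar_def d_z_def ux_def uy_def)
  have 1: "frechet_derivative (\<lambda>x. cscale (1/2) (ux x + cscale \<i> (uy x))) (at z)
    = (\<lambda>h. cscale (1/2) (fderiv ux z h + cscale \<i> (fderiv uy z h)))"
    using frechet_derivative_at[OF bounded_linear.has_derivative[OF cscale.bounded_linear_right
      has_derivative_add[OF smooth_deriv[OF s(1) z]
       bounded_linear.has_derivative[OF cscale.bounded_linear_right smooth_deriv[OF s(2) z]]]]]
    by metis
  have 2: "frechet_derivative (\<lambda>x. cscale (1/2) (ux x - cscale \<i> (uy x))) (at z)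
    = (\<lambda>h. cscale (1/2) (fderiv ux z h - cscale \<i> (fderiv uy z h)))"
    using frechet_derivative_at[OF bounded_linear.has_derivative[OF cscale.bounded_linear_right
      has_derivative_diff[OF smooth_deriv[OF s(1) z]
       bounded_linear.has_derivative[OF cscale.bounded_linear_right smooth_deriv[OF s(2) z]]]]]
    by metis
  show ?thesis
    unfolding zb zz d_z_def[of "\<lambda>x. cscale (1/2) (ux x + cscale \<i> (uy x))"] 
      d_zbar_def[of "\<lambda>x. cscale (1/2) (ux x - cscale \<i> (uy x))"] 1 2
    by (simp add: m cscale.add_right cscale.diff_right algebra_simps)
qed

lemma frechet_holomorphic:
  assumes "a holomorphic_on D" "open D" "z \<in> D"
  shows "(a has_derivative (\<lambda>h. deriv a z * h)) (at z)"
  using holomorphic_derivI[OF assms] by (simp add: has_field_derivative_def)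

lemma wirt_holomorphic:
  assumes "a holomorphic_on D" "open D" "z \<in> D"
  shows "wirt a z = deriv a z" "wirt_bar a z = 0"
  unfolding wirt_def wirt_bar_def frechet_derivative_at[OF frechet_holomorphic[OF assms], symmetric]
  by (simp_all add: field_simps)

lemma frechet_eq_wirt:
  fixes a :: "complex \<Rightarrow> complex"
  assumes "smooth_on a D" "z \<in> D"
  shows "fderiv a z h = wirt a z * h + wirt_bar a z * cnj h"
  unfolding frechet_Re_Im[OF assms, of h]
  by (simp add: wirt_def wirt_bar_def complex_eq_iff field_simps)

lemma smooth_holomorphicI:
  assumes "smooth_on a D" "\<And>z. z \<in> D \<Longrightarrow> wirt_bar a z = 0"
  shows "a holomorphic_on D"
proof (rule holomorphic_onI)
  fix x assume x: "x \<in> D"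
  have "fderiv a x = (\<lambda>h. wirt a x * h)"
    using frechet_eq_wirt[OF assms(1) x] assms(2)[OF x] by auto
  then have "(a has_field_derivative wirt a x) (at x)"
    using smooth_deriv[OF assms(1) x] by (simp add: has_field_derivative_def)
  then show "a field_differentiable at x within D"
    using field_differentiable_at_within field_differentiable_def by blast
qed

lemma wirt_mult:
  assumes "(a has_derivative a') (at z)" "(b has_derivative b') (at z)"
  shows "wirt (\<lambda>x. a x * b x) z = wirt a z * b z + a z * wirt b z"
    "wirt_bar (\<lambda>x. a x * b x) z = wirt_bar a z * b z + a z * wirt_bar b z"
  unfolding wirt_def wirt_bar_def frechet_derivative_at[OF assms(1), symmetric]
    frechet_derivative_at[OF assms(2), symmetric]
    frechet_derivative_at[OF has_derivative_mult[OF assms], symmetric]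
  by (simp_all add: field_simps)

lemma d_z_cscale:
  assumes "(a has_derivative a') (at z)" "(u has_derivative u') (at z)"
  shows "d_z (\<lambda>x. cscale (a x) (u x)) z = cscale (wirt a z) (u z) + cscale (a z) (d_z u z)"
    "d_zbar (\<lambda>x. cscale (a x) (u x)) z = cscale (wirt_bar a z) (u z) + cscale (a z) (d_zbar u z)"
  unfolding wirt_def wirt_bar_def d_z_def d_zbar_def frechet_derivative_at[OF assms(1), symmetric]
    frechet_derivative_at[OF assms(2), symmetric]
    frechet_derivative_at[OF cscale.FDERIV[OF assms], symmetric]
  by (auto intro!: minkowski_eqI simp: field_simps)

lemma frechet_d_z:
  "fderiv u z 1 = d_z u z + d_zbar u z"
  "fderiv u z \<i> = cscale \<i> (d_z u z - d_zbar u z)"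
  unfolding d_z_def d_zbar_def by (auto intro!: minkowski_eqI simp: field_simps)

lemma d_z_cscale_const:
  assumes "smooth_on u D" "z \<in> D"
  shows "d_z (\<lambda>x. cscale a (u x)) z = cscale a (d_z u z)" "d_zbar (\<lambda>x. cscale a (u x)) z = cscale a (d_zbar u z)"
  using d_z_cscale[OF has_derivative_const smooth_deriv[OF assms], of a] by (simp_all add: cscale.zero_left)

lemma d_z_diff:
  assumes "smooth_on u D" "smooth_on v D" "z \<in> D"
  shows "d_z (\<lambda>x. u x - v x) z = d_z u z - d_z v z" "d_zbar (\<lambda>x. u x - v x) z = d_zbar u z - d_zbar v z"
  unfolding d_z_def d_zbar_def
    frechet_derivative_at[OF has_derivative_diff[OF smooth_deriv[OF assms(1,3)] smooth_deriv[OF assms(2,3)]], symmetric]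
  by (simp_all add: cscale.add_right cscale.diff_right)

lemma frechet_cvec:
  assumes "smooth_on u D" "z \<in> D"
  shows "cvec (fderiv u z h) = fderiv (\<lambda>x. cvec (u x)) z h"
  using frechet_derivative_at[OF bounded_linear.has_derivative[OF bounded_linear_cvec smooth_deriv[OF assms]]] by metis

lemma wirt_bar_cnj:
  assumes "(u has_derivative u') (at z)"
  shows "wirt_bar (\<lambda>x. cnj (u x)) z = cnj (wirt u z)"
  unfolding wirt_def wirt_bar_def frechet_derivative_at[OF assms, symmetric]
    frechet_derivative_at[OF bounded_linear.has_derivative[OF bounded_linear_cnj assms], symmetric]
  by simp

lemma real_pair_const_deriv:
  assumes "smooth_on u D" "smooth_on v D" "\<And>x. x \<in> D \<Longrightarrow> form (u x) (v x) = (k :: real)" "z \<in> D"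
  shows "form (fderiv u z h) (v z) + form (u z) (fderiv v z h) = 0"
proof -
  have "((\<lambda>x. form (u x) (v x)) has_derivative
     (\<lambda>h. form (u z) (fderiv v z h) + form (fderiv u z h) (v z))) (at z)"
    by (rule form.FDERIV[OF smooth_deriv[OF assms(1,4)] smooth_deriv[OF assms(2,4)]])
  then have "((\<lambda>x. k) has_derivative
     (\<lambda>h. form (u z) (fderiv v z h) + form (fderiv u z h) (v z))) (at z)"
    by (rule has_derivative_transform_within_open[OF _ smooth_on_open[OF assms(1)] assms(4) assms(3)])
  then have "(\<lambda>h. form (u z) (fderiv v z h) + form (fderiv u z h) (v z)) = (\<lambda>h. 0)"
    by (rule has_derivative_unique[OF _ has_derivative_const])
  then show ?thesis by (metis add.commute)
qed

section \<open>Adapted frames of Lorentz space\<close>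

text \<open>
  Subtracting from n the multiple of the null vector a with the same time component does not
  change the square of n, because n is orthogonal to a, and it leaves a purely spatial vector.
\<close>

lemma perp_null_positive:
  fixes a b n :: "real minkowski"
  assumes a: "form a a = 0" "fst a \<noteq> 0" and n: "form n a = 0" "form n b = 0"
    and ab: "form a b \<noteq> 0" and "n \<noteq> 0"
  shows "form n n > 0"
proof -
  define t where "t = fst n / fst a"
  define m where "m = n - t *\<^sub>R a"
  have m0: "fst m = 0" using a(2) by (simp add: m_def t_def)
  have "form m m = form n n - t * form n a - t * form a n + t * t * form a a"
    by (simp add: m_def form.diff_left form.diff_right form.scaleR_left form.scaleR_right algebra_simps)
  then have "form n n = form m m"
    using a n form_commute[of a n] by simp
  also have "\<dots> = snd m \<bullet> snd m" using m0 by (simp add: lorentz_form_def inner_vec_def)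
  finally have eq: "form n n = snd m \<bullet> snd m" .
  have "snd m \<noteq> 0"
  proof
    assume "snd m = 0"
    then have "m = 0" using m0 by (simp add: prod_eq_iff)
    then have "n = t *\<^sub>R a" by (simp add: m_def)
    then have "t * form a b = 0" using n(2) by (simp add: form.scaleR_left)
    then have "t = 0" using ab by simp
    then show False using \<open>n = t *\<^sub>R a\<close> \<open>n \<noteq> 0\<close> by simp
  qed
  then show ?thesis using eq by simp
qed

definition null_frame :: "real minkowski \<Rightarrow> real minkowski \<Rightarrow> real minkowski \<Rightarrow> real minkowski \<Rightarrow> bool" where
  "null_frame a b x y \<longleftrightarrow> fst a \<noteq> 0 \<and> form a a = 0 \<and> form b b = 0 \<and> form a b = -1 \<and>
     form x x = 1 \<and> form y y = 1 \<and> form x y = 0 \<and>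
     form x a = 0 \<and> form x b = 0 \<and> form y a = 0 \<and> form y b = 0"

text \<open>
  The four pairings with the frame are linear functionals on a five-dimensional space, so they
  have a common zero. Orthogonality to the null vectors a and b makes it spacelike.
\<close>

lemma null_frame_normal:
  assumes "null_frame a b x y"
  obtains n where "form n n = 1" "form n a = 0" "form n b = 0"
    "form n x = 0" "form n y = 0"
proof -
  define T :: "real minkowski \<Rightarrow> real minkowski" where
    "T v = (form v a, form v b *\<^sub>R axis 1 1 + form v x *\<^sub>R axis 2 1 + form v y *\<^sub>R axis 3 1)" for v
  have lin: "linear T"
    by (auto simp: linear_iff T_def form.add_left form.scaleR_left algebra_simps)
  have T4: "snd (T v) $ 4 = 0" for v
    by (simp add: T_def axis_def)
  have "\<not> surj T"
  proof
    assume "surj T"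
    then obtain v where "T v = (0, axis 4 1)" by (metis surjD)
    then show False using T4[of v] by (simp add: axis_def)
  qed
  then have "\<not> inj T" using linear_injective_imp_surjective[OF lin] by blast
  then obtain v where v: "T v = 0" "v \<noteq> 0"
    using lin linear_injective_0 by blast
  have T_fst: "fst (T v) = form v a" by (simp add: T_def)
  have c: "snd (T v) $ 1 = form v b" "snd (T v) $ 2 = form v x" "snd (T v) $ 3 = form v y"
    by (simp_all add: T_def axis_def)
  have vp: "form v a = 0" "form v b = 0" "form v x = 0" "form v y = 0"
    using v(1) c fst_zero snd_zero by (auto simp: T_fst[symmetric])
  have pos: "form v v > 0"
    using perp_null_positive[of a v b] assms vp v(2) by (auto simp: null_frame_def)
  show ?thesis
    by (rule that[of "v /\<^sub>R sqrt (form v v)"])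
      (use vp pos in \<open>simp_all add: form.scaleR_left form.scaleR_right field_simps\<close>)
qed

text \<open>
  The five vectors are independent because their pairings with one another are those of a
  basis; as the space has dimension five, they span it, and the coefficients are again read
  off from the pairings.
\<close>

lemma null_frame_expand:
  assumes f: "null_frame a b x y" and n: "form n n = 1" "form n a = 0" "form n b = 0"
    "form n x = 0" "form n y = 0"
  shows "v = - form v b *\<^sub>R a - form v a *\<^sub>R b + form v x *\<^sub>R x + form v y *\<^sub>R y + form v n *\<^sub>R n"
proof -
  define T :: "real minkowski \<Rightarrow> real minkowski" where
    "T u = fst u *\<^sub>R a + (snd u $ 1) *\<^sub>R b + (snd u $ 2) *\<^sub>R x + (snd u $ 3) *\<^sub>R y + (snd u $ 4) *\<^sub>R n" for u
  have lin: "linear T"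
    by (auto simp: linear_iff T_def algebra_simps)
  note ff = f[unfolded null_frame_def]
  have co: "form a x = 0" "form a y = 0" "form b x = 0" "form b y = 0" "form y x = 0"
    "form b a = -1" "form a n = 0" "form b n = 0" "form x n = 0" "form y n = 0"
    using ff n form_commute by metis+
  have pair: "form (T u) b = - fst u" "form (T u) a = - snd u $ 1" "form (T u) x = snd u $ 2"
    "form (T u) y = snd u $ 3" "form (T u) n = snd u $ 4" for u
    using ff n co by (simp_all add: T_def form.add_left form.scaleR_left)
  have "u = 0" if "T u = 0" for u
  proof (rule minkowski_eqI)
    show "fst u = fst 0" using pair(1)[of u] that by (simp add: form.zero_left)
    show "snd u $ k = snd 0 $ k" for k
      using pair(2-5)[of u] that exhaust_4[of k] by (auto simp: form.zero_left)
  qed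
  then have "inj T" using lin linear_injective_0 by blast
  then have "surj T" using linear_injective_imp_surjective[OF lin] by blast
  then obtain u where u: "v = T u" by (metis surjD)
  show ?thesis unfolding u pair by (simp add: T_def)
qed

section \<open>The structure equations\<close>

text \<open>
  Here Z, B, ZZ, ZB, BB stand for \<open>\<psi>_z\<close>, \<open>\<psi>_zbar\<close>,
  \<open>\<psi>_zz\<close>, \<open>\<psi>_zzbar\<close>, \<open>\<psi>_zbarzbar\<close>. With
  \<kappa> = k N for a unit normal N of V, the functions hopf_sq, hopf_abs2 and quartic are
  k^2, |k|^2 and k^3 conj(k): \<open>\<psi>_zz\<close> differs from \<kappa> by a multiple of
  \<psi>, which is null and orthogonal to \<open>\<psi>_zz\<close> and
  \<open>\<psi>_zbarzbar\<close>. Unlike N, these three functions are defined without a choice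
  of sign.
\<close>

locale schwarzian_lift =
  fixes D :: "complex set" and F :: "complex \<Rightarrow> real^4" and \<psi> :: "complex \<Rightarrow> real minkowski" and c :: "complex \<Rightarrow> complex"
  assumes lift: "normalized_lift D F \<psi>"
    and schw: "\<And>z. z \<in> D \<Longrightarrow> d_z (d_z (cvec \<circ> \<psi>)) z + cscale (c z / 2) (cvec (\<psi> z))
                 \<in> complexify (lorentz_perp (V_fibre \<psi> z))"
    and hol: "c holomorphic_on D"
begin

definition \<Psi> :: "complex \<Rightarrow> complex minkowski" where "\<Psi> z = cvec (\<psi> z)"
abbreviation "Z \<equiv> d_z \<Psi>"
abbreviation "B \<equiv> d_zbar \<Psi>"
abbreviation "ZZ \<equiv> d_z Z"
abbreviation "ZB \<equiv> d_zbar Z"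
abbreviation "BB \<equiv> d_zbar B"
abbreviation "\<kappa> z \<equiv> ZZ z + cscale (c z / 2) (\<Psi> z)"
definition hopf_sq :: "complex \<Rightarrow> complex" where "hopf_sq z = form (ZZ z) (ZZ z)"
definition hopf_abs2 :: "complex \<Rightarrow> complex" where "hopf_abs2 z = form (ZZ z) (BB z)"
definition quartic :: "complex \<Rightarrow> complex" where "quartic z = hopf_sq z * hopf_abs2 z"
abbreviation "X z \<equiv> fderiv \<psi> z 1"
abbreviation "Y z \<equiv> fderiv \<psi> z \<i>"

lemma smooth_\<psi>: "smooth_on \<psi> D" using lift by (simp add: normalized_lift_def)
lemma open_D: "open D" using smooth_\<psi> by (rule smooth_on_open)
lemma \<Psi>_comp: "cvec \<circ> \<psi> = \<Psi>" by (simp add: \<Psi>_def fun_eq_iff)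
lemma cnj_\<Psi> [simp]: "cnj_vec (\<Psi> z) = \<Psi> z" by (simp add: \<Psi>_def)
lemma smooth_\<Psi>: "smooth_on \<Psi> D" unfolding \<Psi>_def[abs_def] by (rule bounded_linear.smooth_on[OF bounded_linear_cvec, OF smooth_\<psi>])

\<comment> \<open>in this order: \<Psi>, Z, B, ZZ, ZB, d_z B, BB, and the two derivatives of each of ZZ, ZB, BB\<close>
lemmas smooth_frame = smooth_\<Psi> smooth_on_d_z[OF smooth_\<Psi>] smooth_on_d_z[OF smooth_on_d_z(1)[OF smooth_\<Psi>]]
  smooth_on_d_z[OF smooth_on_d_z(2)[OF smooth_\<Psi>]]
  smooth_on_d_z[OF smooth_on_d_z(1)[OF smooth_on_d_z(1)[OF smooth_\<Psi>]]]
  smooth_on_d_z[OF smooth_on_d_z(2)[OF smooth_on_d_z(1)[OF smooth_\<Psi>]]]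
  smooth_on_d_z[OF smooth_on_d_z(2)[OF smooth_on_d_z(2)[OF smooth_\<Psi>]]]

lemma pair_deriv:
  assumes "smooth_on u D" "smooth_on v D" "smooth_on u' D" "smooth_on v' D"
    "\<And>x. x \<in> D \<Longrightarrow> form (u x) (v x) = form (u' x) (v' x)" "z \<in> D"
  shows "form (d_z u z) (v z) + form (u z) (d_z v z) = form (d_z u' z) (v' z) + form (u' z) (d_z v' z)"
    "form (d_zbar u z) (v z) + form (u z) (d_zbar v z) = form (d_zbar u' z) (v' z) + form (u' z) (d_zbar v' z)"
  using wirt_form[OF assms(1,2,6)] wirt_form[OF assms(3,4,6)] wirt_cong_open[OF open_D assms(6,5)] by auto

lemma real_frame:
  assumes "z \<in> D"
  shows "form (\<psi> z) (\<psi> z) = 0" "fst (\<psi> z) > 0" "form (X z) (X z) = 1"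
    "form (Y z) (Y z) = 1" "form (X z) (Y z) = 0"
proof -
  show 1: "form (\<psi> z) (\<psi> z) = 0" "fst (\<psi> z) > 0"
    using lift assms by (auto simp: normalized_lift_def forward_light_cone_def)
  have m: "form (fderiv \<psi> z v) (fderiv \<psi> z v) = (norm v)\<^sup>2" for v
    using lift assms by (auto simp: normalized_lift_def)
  show XX: "form (X z) (X z) = 1" and YY: "form (Y z) (Y z) = 1" using m[of 1] m[of \<i>] by simp_all
  have l: "linear (fderiv \<psi> z)"
    using smooth_deriv[OF smooth_\<psi> assms] has_derivative_linear by blast
  have "form (X z + Y z) (X z + Y z) = 2"
    using m[of "1 + \<i>"] linear_add[OF l, of 1 \<i>] by (simp add: cmod_power2)
  then show "form (X z) (Y z) = 0"
    using XX YY form_commute[of "Y z" "X z"] by (simp add: form.add_left form.add_right)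
qed

lemma lift_eq:
  assumes "z \<in> D"
  shows "\<psi> z = fst (\<psi> z) *\<^sub>R (1, F z)"
proof -
  have "\<psi> z \<in> span {(1, F z)}" using lift assms span_base[of "\<psi> z" "{\<psi> z}"] by (auto simp: normalized_lift_def)
  then obtain k where "\<psi> z = k *\<^sub>R (1, F z)" by (auto simp: span_singleton)
  then show ?thesis by (metis fst_conv fst_scaleR mult.right_neutral real_scaleR_def)
qed

lemma frechet_\<Psi>: "z \<in> D \<Longrightarrow> frechet_derivative \<Psi> (at z) v = cvec (fderiv \<psi> z v)"
  using frechet_derivative_at[OF bounded_linear.has_derivative[OF bounded_linear_cvec, OF smooth_deriv[OF smooth_\<psi>]]]
  unfolding \<Psi>_def[abs_def] by metis

lemma Z_eq: "z \<in> D \<Longrightarrow> Z z = cscale (1/2) (cvec (X z) - cscale \<i> (cvec (Y z)))"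
  and B_eq: "z \<in> D \<Longrightarrow> B z = cscale (1/2) (cvec (X z) + cscale \<i> (cvec (Y z)))"
  by (simp_all add: d_z_def d_zbar_def frechet_\<Psi>)

lemma XY_eq:
  assumes "z \<in> D"
  shows "cvec (X z) = Z z + B z" "cvec (Y z) = cscale \<i> (Z z - B z)"
  unfolding Z_eq[OF assms] B_eq[OF assms] by (auto intro!: minkowski_eqI simp: field_simps)

lemma cnj_frame:
  assumes "z \<in> D"
  shows "cnj_vec (Z z) = B z" "cnj_vec (B z) = Z z" "cnj_vec (ZZ z) = BB z" "cnj_vec (ZB z) = ZB z"
    "cnj_vec (BB z) = ZZ z" "d_z B z = ZB z" "cnj_vec (d_z ZB z) = d_zbar ZB z"
    "cnj_vec (d_zbar ZB z) = d_z ZB z" "cnj_vec (d_z ZZ z) = d_zbar BB z"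
    "cnj_vec (d_zbar BB z) = d_z ZZ z" "d_zbar ZZ z = d_z ZB z" "d_z BB z = d_zbar ZB z"
proof -
  have Z: "cnj_vec (Z x) = B x" if "x \<in> D" for x
    using d_z_cnj(2)[OF smooth_\<Psi> that] by (simp add: \<Psi>_def[abs_def])
  then have B: "cnj_vec (B x) = Z x" if "x \<in> D" for x using that by (metis cnj_cnj_vec)
  have ZB: "d_z B x = ZB x" if "x \<in> D" for x by (rule d_z_d_zbar_commute[OF smooth_\<Psi> that])
  have ZZ: "cnj_vec (ZZ x) = BB x" if x: "x \<in> D" for x
    using d_z_cnj(2)[OF smooth_frame(2) x] d_z_cong_open(2)[OF open_D x, of "\<lambda>x. cnj_vec (Z x)" B] Z by auto
  have ZBr: "cnj_vec (ZB x) = ZB x" if x: "x \<in> D" for x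
    using d_z_cnj(1)[OF smooth_frame(2) x] d_z_cong_open(1)[OF open_D x, of "\<lambda>x. cnj_vec (Z x)" B] Z ZB[OF x]
     by (metis cnj_cnj_vec)
  have ZZB: "d_zbar ZZ x = d_z ZB x" if x: "x \<in> D" for x
    by (rule d_z_d_zbar_commute[OF smooth_frame(2) x, symmetric])
  have ZBB: "d_z BB x = d_zbar ZB x" if x: "x \<in> D" for x
    using d_z_d_zbar_commute[OF smooth_frame(3) x] d_z_cong_open(2)[OF open_D x ZB] by simp
  show "cnj_vec (d_z ZB z) = d_zbar ZB z"
    using d_z_cnj(2)[OF smooth_frame(5) assms] d_z_cong_open(2)[OF open_D assms, of "\<lambda>x. cnj_vec (ZB x)" ZB] ZBr by auto
  then show "cnj_vec (d_zbar ZB z) = d_z ZB z" by (metis cnj_cnj_vec)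
  show "cnj_vec (d_z ZZ z) = d_zbar BB z"
    using d_z_cnj(2)[OF smooth_frame(4) assms] d_z_cong_open(2)[OF open_D assms, of "\<lambda>x. cnj_vec (ZZ x)" BB] ZZ by auto
  then show "cnj_vec (d_zbar BB z) = d_z ZZ z" by (metis cnj_cnj_vec)
  show "cnj_vec (Z z) = B z" "cnj_vec (B z) = Z z" "cnj_vec (ZZ z) = BB z" "cnj_vec (ZB z) = ZB z"
    "cnj_vec (BB z) = ZZ z" "d_z B z = ZB z" "d_zbar ZZ z = d_z ZB z" "d_z BB z = d_zbar ZB z"
    using Z B ZZ ZBr ZB ZZB ZBB assms by (simp_all) (metis cnj_cnj_vec)
qed

text \<open>
  Everything follows from \<open>\<langle>\<psi>,\<psi>\<rangle> = 0\<close>,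
  \<open>\<langle>\<psi>_z,\<psi>_z\<rangle> = 0\<close>,
  \<open>\<langle>\<psi>_z,\<psi>_zbar\<rangle> = 1/2\<close> by differentiation and
  conjugation. For the last equation, differentiate
  \<open>\<langle>\<psi>_zz,\<psi>_zbar\<rangle> = 0\<close> by zbar and
  \<open>\<langle>\<psi>_zzbar,\<psi>_zbar\<rangle> = 0\<close> by z and compare.
\<close>

lemma pairings:
  assumes "z \<in> D"
  shows "form (\<Psi> z) (\<Psi> z) = 0" "form (Z z) (Z z) = 0" "form (Z z) (B z) = 1/2"
    "form (B z) (B z) = 0" "form (Z z) (\<Psi> z) = 0" "form (B z) (\<Psi> z) = 0"
    "form (ZZ z) (\<Psi> z) = 0" "form (ZB z) (\<Psi> z) = -1/2" "form (BB z) (\<Psi> z) = 0"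
    "form (ZZ z) (Z z) = 0" "form (ZB z) (Z z) = 0" "form (ZB z) (B z) = 0"
    "form (BB z) (B z) = 0" "form (ZZ z) (B z) = 0" "form (BB z) (Z z) = 0"
    "form (d_z ZB z) (\<Psi> z) = 0" "form (d_zbar ZB z) (\<Psi> z) = 0" 
    "form (d_zbar BB z) (\<Psi> z) = 0" "form (ZB z) (ZB z) = hopf_abs2 z"
proof -
  note sm = smooth_frame
  have p1: "form (\<Psi> x) (\<Psi> x) = 0" if "x \<in> D" for x
    using real_frame[OF that] by (simp add: \<Psi>_def)
  have p2: "form (Z x) (Z x) = 0" "form (Z x) (B x) = 1/2" if "x \<in> D" for x
    using real_frame[OF that] form_commute[of "Y x" "X x"]
    by (simp_all add: Z_eq[OF that] B_eq[OF that] cform.add_right cform.add_left cform.diff_left cform.diff_right)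
  have p3: "form (B x) (B x) = 0" if "x \<in> D" for x
    using p2(1)[OF that] cform_cnj[of "Z x" "Z x"] cnj_frame[OF that] by simp
  have p4: "form (Z x) (\<Psi> x) = 0" "form (B x) (\<Psi> x) = 0" if "x \<in> D" for x
    using pair_const_deriv[OF sm(1) sm(1) p1 that] form_commute[of "\<Psi> x"] by auto
  have p5: "form (ZZ x) (\<Psi> x) = 0" "form (ZB x) (\<Psi> x) = -1/2" if "x \<in> D" for x
    using pair_const_deriv[OF sm(2) sm(1) p4(1) that] p2[OF that] by (auto simp: add_eq_0_iff2)
  have p6: "form (ZZ x) (Z x) = 0" "form (ZB x) (Z x) = 0" if "x \<in> D" for x
    using pair_const_deriv[OF sm(2) sm(2) p2(1) that] form_commute[of "Z x"] by auto
  have p7: "form (BB x) (B x) = 0" "form (ZB x) (B x) = 0" if "x \<in> D" for x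
    using p6[OF that] cform_cnj[of "ZZ x" "Z x"] cform_cnj[of "ZB x" "Z x"] cnj_frame[OF that] by auto
  have p8: "form (BB x) (\<Psi> x) = 0" if "x \<in> D" for x
    using p5[OF that] cform_cnj[of "ZZ x" "\<Psi> x"] cnj_frame[OF that] by (simp add: \<Psi>_def)
  have p9: "form (ZZ x) (B x) = 0" if "x \<in> D" for x
    using pair_const_deriv(1)[OF sm(2) sm(3) p2(2) that] cnj_frame(6)[OF that] p6(2)[OF that] form_commute[of "Z x"] by auto
  have p10: "form (BB x) (Z x) = 0" if "x \<in> D" for x
    using p9[OF that] cform_cnj[of "ZZ x" "B x"] cnj_frame[OF that] by simp
  have p11: "form (d_z ZB x) (\<Psi> x) = 0" if "x \<in> D" for x
    using pair_const_deriv(2)[OF sm(4) sm(1) p5(1) that] p9[OF that] cnj_frame(11)[OF that] by simp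
  have p12: "form (d_zbar ZB x) (\<Psi> x) = 0" if "x \<in> D" for x
    using p11[OF that] cform_cnj[of "d_z ZB x" "\<Psi> x"] cnj_frame[OF that] by (simp add: \<Psi>_def)
  have p13: "form (d_zbar BB x) (\<Psi> x) = 0" if "x \<in> D" for x
    using pair_const_deriv(2)[OF sm(7) sm(1) p8 that] p7[OF that] by simp
  have "form (d_z ZB x) (B x) + hopf_abs2 x = 0" if "x \<in> D" for x
    using pair_const_deriv(2)[OF sm(4) sm(3) p9 that] cnj_frame(11)[OF that] by (simp add: hopf_abs2_def)
  moreover have "form (d_z ZB x) (B x) + form (ZB x) (ZB x) = 0" if "x \<in> D" for x
    using pair_const_deriv(1)[OF sm(5) sm(3) p7(2) that] cnj_frame(6)[OF that] by simp
  ultimately have p14: "form (ZB x) (ZB x) = hopf_abs2 x" if "x \<in> D" for x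
    using that by (metis add_left_cancel)
  show "form (\<Psi> z) (\<Psi> z) = 0" "form (Z z) (Z z) = 0" "form (Z z) (B z) = 1/2"
    "form (B z) (B z) = 0" "form (Z z) (\<Psi> z) = 0" "form (B z) (\<Psi> z) = 0"
    "form (ZZ z) (\<Psi> z) = 0" "form (ZB z) (\<Psi> z) = -1/2" "form (BB z) (\<Psi> z) = 0"
    "form (ZZ z) (Z z) = 0" "form (ZB z) (Z z) = 0" "form (ZB z) (B z) = 0"
    "form (BB z) (B z) = 0" "form (ZZ z) (B z) = 0" "form (BB z) (Z z) = 0"
    "form (d_z ZB z) (\<Psi> z) = 0" "form (d_zbar ZB z) (\<Psi> z) = 0" 
    "form (d_zbar BB z) (\<Psi> z) = 0" "form (ZB z) (ZB z) = hopf_abs2 z"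
    by (rule p1[OF assms] p2[OF assms] p3[OF assms] p4[OF assms] p5[OF assms] p6[OF assms] p7[OF assms] p8[OF assms] p9[OF assms] p10[OF assms] p11[OF assms] p12[OF assms] p13[OF assms] p14[OF assms])+
qed

abbreviation "M z \<equiv> Re_vec (ZB z)"

lemma cvec_M: "z \<in> D \<Longrightarrow> cvec (M z) = ZB z"
  by (rule cvec_Re_vec_cnj[OF cnj_frame(4)])

lemma perp_V:
  assumes "z \<in> D"
  shows "n \<in> lorentz_perp (V_fibre \<psi> z) \<longleftrightarrow>
    form n (\<psi> z) = 0 \<and> form n (X z) = 0 \<and> form n (Y z) = 0 \<and> form n (M z) = 0"
    (is "_ \<longleftrightarrow> ?R")
proof -
  have fr: "fderiv \<psi> z v = Re v *\<^sub>R X z + Im v *\<^sub>R Y z" for v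
    by (rule frechet_Re_Im[OF smooth_\<psi> assms])
  have V: "V_fibre \<psi> z = span ({\<psi> z} \<union> range (fderiv \<psi> z) \<union> {M z})" (is "_ = span ?G")
    using cnj_frame(6)[OF assms] by (simp add: V_fibre_def \<Psi>_comp)
  have "n \<in> lorentz_perp (V_fibre \<psi> z) \<longleftrightarrow> (\<forall>w\<in>?G. form n w = 0)"
  proof
    assume "n \<in> lorentz_perp (V_fibre \<psi> z)"
    then show "\<forall>w\<in>?G. form n w = 0" unfolding V lorentz_perp_def using span_base[of _ ?G] by simp
  next
    assume *: "\<forall>w\<in>?G. form n w = 0"
    have "form n w = 0" if "w \<in> span ?G" for w
      using that by (induction rule: span_induct_alt) (use * in \<open>auto simp: form.add_right form.scaleR_right form.zero_right\<close>)
    then show "n \<in> lorentz_perp (V_fibre \<psi> z)" unfolding V lorentz_perp_def by simp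
  qed
  also have "\<dots> \<longleftrightarrow> ?R"
  proof
    assume *: "\<forall>w\<in>?G. form n w = 0"
    have "\<psi> z \<in> ?G" "X z \<in> ?G" "Y z \<in> ?G" "M z \<in> ?G" by simp_all
    then show ?R by (intro conjI bspec[OF *])
  next
    assume R: ?R
    show "\<forall>w\<in>?G. form n w = 0"
    proof
      have frn: "form n (fderiv \<psi> z v) = 0" for v
        by (subst fr) (use R in \<open>simp add: form.add_right form.scaleR_right\<close>)
      fix w assume "w \<in> ?G"
      then show "form n w = 0"
        by (elim UnE rangeE singletonE; hypsubst)
          (use R frn in simp_all)
    qed
  qed
  finally show ?thesis .
qed

lemma kappa_perp:
  assumes "z \<in> D"
  shows "form (\<kappa> z) (\<Psi> z) = 0" "form (\<kappa> z) (Z z) = 0" "form (\<kappa> z) (B z) = 0"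
    "form (\<kappa> z) (ZB z) = 0" "Re_vec (\<kappa> z) \<in> lorentz_perp (V_fibre \<psi> z)" "Im_vec (\<kappa> z) \<in> lorentz_perp (V_fibre \<psi> z)"
proof -
  show k: "Re_vec (\<kappa> z) \<in> lorentz_perp (V_fibre \<psi> z)" "Im_vec (\<kappa> z) \<in> lorentz_perp (V_fibre \<psi> z)"
    using schw[OF assms] by (auto simp: complexify_def \<Psi>_comp \<Psi>_def[symmetric])
  show "form (\<kappa> z) (\<Psi> z) = 0" "form (\<kappa> z) (Z z) = 0" "form (\<kappa> z) (B z) = 0"
    unfolding cform.add_left cform_scale form_commute[of "\<Psi> z" "Z z"]
      form_commute[of "\<Psi> z" "B z"] pairings[OF assms] by simp_all
  have "form (\<kappa> z) (cvec (M z)) = 0"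
    using k[unfolded perp_V[OF assms]] unfolding complex_eq_iff Re_Im_form_cvec by simp
  then show "form (\<kappa> z) (ZB z) = 0" using cvec_M[OF assms] by simp
qed

text \<open>
  The null vector in the fibre of V that is orthogonal to the derivatives of \<psi> and pairs
  to -1 with \<psi>.
\<close>

definition dual_null :: "complex \<Rightarrow> real minkowski" where
  "dual_null z = 2 *\<^sub>R M z + (2 * Re (hopf_abs2 z)) *\<^sub>R \<psi> z"

lemma real_pairings:
  assumes "z \<in> D"
  shows "form (X z) (\<psi> z) = 0" "form (Y z) (\<psi> z) = 0" "form (M z) (\<psi> z) = -1/2"
    "form (X z) (M z) = 0" "form (Y z) (M z) = 0" "form (M z) (M z) = Re (hopf_abs2 z)"
proof -
  have c: "form u v = Re (form (cvec u) (cvec v))" for u v by simp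
  show "form (X z) (\<psi> z) = 0" "form (Y z) (\<psi> z) = 0" "form (M z) (\<psi> z) = -1/2"
    "form (X z) (M z) = 0" "form (Y z) (M z) = 0" "form (M z) (M z) = Re (hopf_abs2 z)"
    unfolding c XY_eq[OF assms] cvec_M[OF assms] \<Psi>_def[symmetric]
      cform.add_left cform.diff_left cform_scale
      form_commute[of "Z z" "ZB z"] form_commute[of "B z" "ZB z"] pairings[OF assms]
    by simp_all
qed

lemma null_frame_lift:
  assumes "z \<in> D"
  shows "null_frame (\<psi> z) (dual_null z) (X z) (Y z)"
  using real_frame[OF assms] real_pairings[OF assms] form_commute[of "\<psi> z" "M z"]
  by (simp add: null_frame_def dual_null_def form.add_left form.add_right form.scaleR_left form.scaleR_right)

lemma perp_V_null_frame:
  assumes "z \<in> D"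
  shows "n \<in> lorentz_perp (V_fibre \<psi> z) \<longleftrightarrow>
    form n (\<psi> z) = 0 \<and> form n (dual_null z) = 0 \<and> form n (X z) = 0 \<and> form n (Y z) = 0"
  unfolding perp_V[OF assms] by (auto simp: dual_null_def form.add_right form.scaleR_right)

text \<open>
  V has rank four and signature (3,1), so its orthogonal complement is a positive definite
  line.
\<close>

lemma unit_normal:
  assumes "z \<in> D"
  obtains n where "form n n = 1" "n \<in> lorentz_perp (V_fibre \<psi> z)"
    "\<And>v. v \<in> lorentz_perp (V_fibre \<psi> z) \<Longrightarrow> v = form v n *\<^sub>R n"
proof -
  obtain n where n: "form n n = 1" "form n (\<psi> z) = 0" "form n (dual_null z) = 0"
    "form n (X z) = 0" "form n (Y z) = 0"
    using null_frame_normal[OF null_frame_lift[OF assms]] by blast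
  have "v = form v n *\<^sub>R n" if "v \<in> lorentz_perp (V_fibre \<psi> z)" for v
    using null_frame_expand[OF null_frame_lift[OF assms] n, of v] that[unfolded perp_V_null_frame[OF assms]] by simp
  then show ?thesis using that n perp_V_null_frame[OF assms] by blast
qed

lemma kappa_multiple:
  assumes "z \<in> D"
  obtains n k where "form n n = 1" "n \<in> lorentz_perp (V_fibre \<psi> z)" "\<kappa> z = cscale k (cvec n)"
    "cnj_vec (\<kappa> z) = cscale (cnj k) (cvec n)" "hopf_sq z = k * k" "hopf_abs2 z = k * cnj k"
proof -
  obtain n where n: "form n n = 1" "n \<in> lorentz_perp (V_fibre \<psi> z)"
    "\<And>v. v \<in> lorentz_perp (V_fibre \<psi> z) \<Longrightarrow> v = form v n *\<^sub>R n"
    using unit_normal[OF assms] by blast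
  define k where "k = Complex (form (Re_vec (\<kappa> z)) n) (form (Im_vec (\<kappa> z)) n)"
  have "\<kappa> z = cvec (Re_vec (\<kappa> z)) + cscale \<i> (cvec (Im_vec (\<kappa> z)))" by (rule cvec_Re_Im)
  also have "\<dots> = cvec (form (Re_vec (\<kappa> z)) n *\<^sub>R n) + cscale \<i> (cvec (form (Im_vec (\<kappa> z)) n *\<^sub>R n))"
    using n(3)[OF kappa_perp(5)[OF assms]] n(3)[OF kappa_perp(6)[OF assms]] by simp
  also have "\<dots> = cscale k (cvec n)"
    by (rule minkowski_eqI) (auto simp: k_def complex_eq_iff)
  finally have k: "\<kappa> z = cscale k (cvec n)" .
  have ZZ: "ZZ z = cscale k (cvec n) - cscale (c z / 2) (\<Psi> z)" using k by (simp add: algebra_simps)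
  have BB: "BB z = cscale (cnj k) (cvec n) - cscale (cnj (c z) / 2) (\<Psi> z)"
    using ZZ cnj_frame(3)[OF assms] by (simp add: linear_diff[OF bounded_linear.linear[OF bounded_linear_cnj_vec]])
  have nP: "form (cvec n) (\<Psi> z) = 0"
    using n(2) perp_V[OF assms] by (simp add: \<Psi>_def)
  have PP: "form (\<Psi> z) (\<Psi> z) = 0" by (rule pairings(1)[OF assms])
  have nn: "form (cvec n) (cvec n) = 1" using n(1) by simp
  have Pn: "form (\<Psi> z) (cvec n) = 0" using nP form_commute by metis
  have h: "hopf_sq z = k * k" "hopf_abs2 z = k * cnj k"
    unfolding hopf_sq_def hopf_abs2_def ZZ BB
    using nP PP nn Pn by (simp_all add: cform.diff_left cform.diff_right del: cform_cvec)
  show ?thesis by (rule that[OF n(1,2) k _ h]) (simp add: k)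
qed

text \<open>
  This is the component along \<open>\<psi>_zzbar\<close>, whose pairing with \<psi> is -1/2,
  of the equation that defines c.
\<close>

lemma schwarzian_eq: "z \<in> D \<Longrightarrow> form (ZZ z) (ZB z) = c z / 4"
  using kappa_perp(4)[of z] pairings(8)[of z] form_commute[of "\<Psi> z" "ZB z"] by (simp add: cform.add_left mult.commute)

text \<open>
  As c is holomorphic, the zbar-derivative of
  \<open>\<langle>\<psi>_zz,\<psi>_zzbar\<rangle>\<close> vanishes. Differentiating
  \<open>\<langle>\<psi>_zzbar,\<psi>_zzbar\<rangle> =
  \<langle>\<psi>_zz,\<psi>_zbarzbar\<rangle>\<close> by z eliminates the terms that contain
  \<open>\<psi>_zzbar\<close> undifferentiated.
\<close>

lemma gauss:
  assumes "z \<in> D"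
  shows "form (d_zbar BB z) (ZZ z) = -3 * form (BB z) (d_z ZB z)"
proof -
  note sm = smooth_frame
  have "wirt_bar (\<lambda>x. form (ZZ x) (ZB x)) z = wirt_bar (\<lambda>x. c x / 4) z"
    by (rule wirt_cong_open(2)[OF open_D assms schwarzian_eq])
  also have "\<dots> = 0"
    by (rule wirt_holomorphic(2)[OF _ open_D assms]) (intro holomorphic_intros hol; simp)
  finally have 1: "form (d_z ZB z) (ZB z) + form (ZZ z) (d_zbar ZB z) = 0"
    using wirt_form(2)[OF sm(4) sm(5) assms] cnj_frame(11)[OF assms] by simp
  have 2: "2 * form (d_z ZB z) (ZB z) = form (d_z ZZ z) (BB z) + form (ZZ z) (d_zbar ZB z)"
    using pair_deriv(1)[OF sm(5) sm(5) sm(4) sm(7) _ assms] pairings(19) cnj_frame(12)[OF assms]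
      form_commute[of "ZB z"] by (simp add: hopf_abs2_def)
  have "form (d_z ZZ z) (BB z) = -3 * form (ZZ z) (d_zbar ZB z)"
    using 1 2 by (simp add: add_eq_0_iff2)
  then have "cnj (form (d_z ZZ z) (BB z)) = -3 * cnj (form (ZZ z) (d_zbar ZB z))" by simp
  then show ?thesis unfolding cform_cnj[symmetric] cnj_frame[OF assms] .
qed

lemma smooth_quartic: "smooth_on hopf_sq D" "smooth_on hopf_abs2 D" "smooth_on quartic D"
proof -
  show s: "smooth_on hopf_sq D" "smooth_on hopf_abs2 D"
    unfolding hopf_sq_def[abs_def] hopf_abs2_def[abs_def] using smooth_frame by (auto intro: cform.smooth_on)
  show "smooth_on quartic D"
    unfolding quartic_def[abs_def] by (rule bounded_bilinear.smooth_on[OF bounded_bilinear_mult s])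
qed

text \<open>
  Let \<alpha> and \<beta> be the normal components of \<open>\<psi>_zzzbar\<close> and
  \<open>\<psi>_zbarzbarzbar\<close>. The Gauss equation reads k \<beta> = -3 conj(k)
  \<alpha>, so the first derivatives of h and the zbar-derivative of k^2 can be expressed by k
  and \<alpha>. The third equation is a differential equation for k^2: away from the zeros of
  h = k^3 conj(k) it says that (log k^2)_zbar = - conj((log h)_z) / 4.
\<close>

lemma quartic_derivs:
  assumes "z \<in> D"
  shows "hopf_abs2 z = of_real (cmod (hopf_sq z))" "wirt_bar quartic z = 0"
    "4 * wirt_bar hopf_sq z * cnj (quartic z) = - cnj (wirt quartic z) * hopf_sq z"
    "hopf_sq z = 0 \<Longrightarrow> \<kappa> z = 0" 
proof -
  note sm = smooth_frame
  obtain n k where n: "form n n = 1" "n \<in> lorentz_perp (V_fibre \<psi> z)" and k: "\<kappa> z = cscale k (cvec n)"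
    and h: "hopf_sq z = k * k" "hopf_abs2 z = k * cnj k"
    using kappa_multiple[OF assms] by metis
  have ZZ: "ZZ z = cscale k (cvec n) - cscale (c z / 2) (\<Psi> z)" using k by (simp add: algebra_simps)
  have BB: "BB z = cscale (cnj k) (cvec n) - cscale (cnj (c z) / 2) (\<Psi> z)"
    using ZZ cnj_frame(3)[OF assms] by (simp add: linear_diff[OF bounded_linear.linear[OF bounded_linear_cnj_vec]])
  show "hopf_abs2 z = of_real (cmod (hopf_sq z))"
    using complex_norm_square[of k] by (simp add: h norm_mult power2_eq_square)
  show "hopf_sq z = 0 \<Longrightarrow> \<kappa> z = 0" using h k by (simp add: cscale.zero_left)
  define \<alpha> where "\<alpha> = form (d_z ZB z) (cvec n)"
  define \<beta> where "\<beta> = form (d_zbar BB z) (cvec n)"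
  have a: "form (d_z ZB z) (ZZ z) = k * \<alpha>" "form (d_z ZB z) (BB z) = cnj k * \<alpha>"
    "form (d_zbar BB z) (ZZ z) = k * \<beta>" "form (d_zbar BB z) (BB z) = cnj k * \<beta>"
    using pairings(16,18)[OF assms] by (simp_all add: ZZ BB cform.diff_right \<alpha>_def \<beta>_def)
  have ga: "k * \<beta> = -3 * (cnj k * \<alpha>)"
    using gauss[OF assms] a form_commute[of "BB z"] by simp
  have 1: "wirt_bar hopf_sq z = 2 * (k * \<alpha>)"
    using wirt_form(2)[OF sm(4) sm(4) assms] a cnj_frame(11)[OF assms] form_commute[of "ZZ z"]
    by (simp add: hopf_sq_def[abs_def])
  have 2: "wirt_bar hopf_abs2 z = -2 * (cnj k * \<alpha>)"
    using wirt_form(2)[OF sm(4) sm(7) assms] a cnj_frame(11)[OF assms] form_commute[of "ZZ z"] ga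
    by (simp add: hopf_abs2_def[abs_def])
  have 3: "cnj (wirt hopf_sq z) = 2 * (cnj k * \<beta>)"
  proof -
    have "wirt hopf_sq z = 2 * form (d_z ZZ z) (ZZ z)"
      using wirt_form(1)[OF sm(4) sm(4) assms] form_commute[of "ZZ z"]
      by (simp add: hopf_sq_def[abs_def])
    then have "cnj (wirt hopf_sq z) = 2 * form (cnj_vec (d_z ZZ z)) (cnj_vec (ZZ z))" by simp
    then show ?thesis using cnj_frame[OF assms] a by simp
  qed
  have 4: "cnj (wirt hopf_abs2 z) = -2 * (cnj k * \<alpha>)"
  proof -
    have "wirt hopf_abs2 z = form (d_z ZZ z) (BB z) + form (ZZ z) (d_zbar ZB z)"
      using wirt_form(1)[OF sm(4) sm(7) assms] cnj_frame(12)[OF assms] by (simp add: hopf_abs2_def[abs_def])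
    then have "cnj (wirt hopf_abs2 z) = form (cnj_vec (d_z ZZ z)) (cnj_vec (BB z)) + form (cnj_vec (ZZ z)) (cnj_vec (d_zbar ZB z))" by simp
    then show ?thesis using cnj_frame[OF assms] a ga form_commute[of "BB z"] by simp
  qed
  have q: "wirt quartic z = wirt hopf_sq z * hopf_abs2 z + hopf_sq z * wirt hopf_abs2 z"
     "wirt_bar quartic z = wirt_bar hopf_sq z * hopf_abs2 z + hopf_sq z * wirt_bar hopf_abs2 z"
    unfolding quartic_def[abs_def]
    by (rule wirt_mult[OF smooth_deriv[OF smooth_quartic(1) assms] smooth_deriv[OF smooth_quartic(2) assms]])+
  show "wirt_bar quartic z = 0" unfolding q 1 2 h by (simp add: algebra_simps)
  have "cnj (wirt quartic z) = 2 * (cnj k * cnj k) * (k * \<beta>) - 2 * (cnj k * cnj k) * (cnj k * \<alpha>)"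
    unfolding q complex_cnj_add complex_cnj_mult 3 4 h by (simp add: algebra_simps)
  also have "\<dots> = - 8 * (cnj k * cnj k * cnj k * \<alpha>)" unfolding ga by (simp add: algebra_simps)
  finally have 5: "cnj (wirt quartic z) = - 8 * (cnj k * cnj k * cnj k * \<alpha>)" .
  show "4 * wirt_bar hopf_sq z * cnj (quartic z) = - cnj (wirt quartic z) * hopf_sq z"
    unfolding 5 1 quartic_def h by (simp add: algebra_simps)
qed

lemma quartic_holomorphic: "quartic holomorphic_on D"
  by (rule smooth_holomorphicI[OF smooth_quartic(3) quartic_derivs(2)])

end

section \<open>The quartic differential has no isolated zeros\<close>

context schwarzian_lift
begin

text \<open>
  Away from the zero, k^2 is locally a holomorphic function times conj(h)^(-1/4), so each
  zbar-derivative divides its size by the distance to the zero, up to a nonzero factor. As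
  |k^2| has the size of the distance to the power n/2, the n-th zbar-derivative would be
  unbounded, against the smoothness of k^2.
\<close>

lemma quartic_no_finite_order_zero:
  assumes r: "0 < r" "ball z0 r \<subseteq> D" and n: "0 < n" and g: "g holomorphic_on ball z0 r"
    and q: "\<And>w. w \<in> ball z0 r \<Longrightarrow> quartic w = (w - z0) ^ n * g w"
    and nz: "\<And>w. w \<in> ball z0 r \<Longrightarrow> g w \<noteq> 0"
  shows False
proof -
  define W where "W = ball z0 r - {z0}"
  have oW: "open W" and WD: "W \<subseteq> D" and WB: "W \<subseteq> ball z0 r" using r by (auto simp: W_def)
  have z0: "z0 \<in> ball z0 r" using r by simp
  define it where "it j = (wirt_bar ^^ j) hopf_sq" for j
  have sm: "smooth_on (it j) D" for j
    by (induction j) (auto simp: it_def smooth_quartic intro: smooth_on_wirt)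
  have it0: "it 0 = hopf_sq" and itS: "it (Suc j) = wirt_bar (it j)" for j by (simp_all add: it_def)
  have log_deriv: "4 * cnj (w - z0) * wirt_bar hopf_sq w * cnj (g w) = - cnj (of_nat n * g w + (w - z0) * deriv g w) * hopf_sq w"
    if w: "w \<in> W" for w
  proof -
    have wB: "w \<in> ball z0 r" and wD: "w \<in> D" and y: "w - z0 \<noteq> 0" using w WD by (auto simp: W_def)
    have "(quartic has_field_derivative (w - z0) ^ n * deriv g w + of_nat n * (w - z0) ^ (n - 1) * g w) (at w)"
    proof (rule has_field_derivative_transform_within_open[OF _ open_ball wB])
      show "((\<lambda>w. (w - z0) ^ n * g w) has_field_derivative (w - z0) ^ n * deriv g w + of_nat n * (w - z0) ^ (n - 1) * g w) (at w)"
        by (rule derivative_eq_intros holomorphic_derivI[OF g open_ball wB] refl)+ (simp add: algebra_simps)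
    qed (use q in simp)
    then have "deriv quartic w = (w - z0) ^ n * deriv g w + of_nat n * (w - z0) ^ (n - 1) * g w"
      by (rule DERIV_imp_deriv)
    then have "wirt quartic w = (w - z0) ^ n * deriv g w + of_nat n * (w - z0) ^ (n - 1) * g w"
      using wirt_holomorphic(1)[OF quartic_holomorphic open_D wD] by simp
    moreover obtain m where "n = Suc m" using n by (cases n) auto
    ultimately have "(w - z0) * wirt quartic w = (w - z0) ^ n * (of_nat n * g w + (w - z0) * deriv g w)"
      by (simp add: ring_distribs mult_ac)
    then have 1: "cnj (w - z0) * cnj (wirt quartic w) = cnj ((w - z0) ^ n) * cnj (of_nat n * g w + (w - z0) * deriv g w)"
      by (metis complex_cnj_mult)
    have "cnj ((w - z0) ^ n) * (4 * cnj (w - z0) * wirt_bar hopf_sq w * cnj (g w)) = cnj (w - z0) * (4 * wirt_bar hopf_sq w * cnj (quartic w))"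
      using q[OF wB] by (simp add: algebra_simps)
    also have "\<dots> = - (cnj (w - z0) * cnj (wirt quartic w)) * hopf_sq w"
      unfolding quartic_derivs(3)[OF wD] by (simp add: algebra_simps)
    also have "\<dots> = cnj ((w - z0) ^ n) * (- cnj (of_nat n * g w + (w - z0) * deriv g w) * hopf_sq w)"
      unfolding 1 by (simp add: algebra_simps)
    finally show ?thesis using y by simp
  qed
  \<comment> \<open>The j-th zbar-derivative of k^2 is k^2 times the conjugate of a function with a pole of order exactly j.\<close>
  have "\<exists>s. s holomorphic_on ball z0 r \<and> s z0 \<noteq> 0 \<and> (\<forall>w\<in>W. (cnj (w - z0)) ^ j * it j w = cnj (s w) * hopf_sq w)" for j
  proof (induction j)
    case 0
    show ?case by (rule exI[of _ "\<lambda>_. 1"]) (auto simp: it0)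
  next
    case (Suc j)
    then obtain s where s: "s holomorphic_on ball z0 r" "s z0 \<noteq> 0"
      and e: "\<And>w. w \<in> W \<Longrightarrow> (cnj (w - z0)) ^ j * it j w = cnj (s w) * hopf_sq w" by blast
    \<comment> \<open>The leading coefficient of the next derivative is multiplied by -(n/4 + j), which is not zero.\<close>
    define s' where "s' w = (w - z0) * deriv s w - (of_nat n + (w - z0) * deriv g w / g w) / 4 * s w - of_nat j * s w" for w
    have "s' holomorphic_on ball z0 r"
      unfolding s'_def[abs_def] by (intro holomorphic_intros s g holomorphic_deriv nz; simp)
    moreover have "s' z0 \<noteq> 0"
    proof -
      have "s' z0 = - (of_nat n / 4 + of_nat j) * s z0" by (simp add: s'_def algebra_simps)
      moreover have "of_nat n / 4 + of_nat j = (of_real (real n / 4 + real j) :: complex)" by simp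
      then have "of_nat n / 4 + of_nat j \<noteq> (0 :: complex)"
        using n by (metis add_pos_nonneg divide_pos_pos less_irrefl of_nat_0_le_iff of_nat_0_less_iff of_real_eq_0_iff zero_less_numeral)
      ultimately show ?thesis using s(2) by (metis mult_eq_0_iff neg_equal_0_iff_equal)
    qed
    moreover have "(cnj (w - z0)) ^ Suc j * it (Suc j) w = cnj (s' w) * hopf_sq w" if w: "w \<in> W" for w
    proof -
      have wB: "w \<in> ball z0 r" and wD: "w \<in> D" and y: "w - z0 \<noteq> 0" using w WD by (auto simp: W_def)
      define y where "y = w - z0"
      have hu: "(\<lambda>w. (w - z0) ^ j) holomorphic_on ball z0 r" by (intro holomorphic_intros)
      have du: "deriv (\<lambda>w. (w - z0) ^ j) w = of_nat j * (w - z0) ^ (j - 1)"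
        by (rule DERIV_imp_deriv) (auto intro!: derivative_eq_intros)
      have fu: "((\<lambda>w. (w - z0) ^ j) has_derivative (*) (deriv (\<lambda>w. (w - z0) ^ j) w)) (at w)"
        using frechet_holomorphic[OF hu open_ball wB] .
      have fs: "(s has_derivative (*) (deriv s w)) (at w)"
        using frechet_holomorphic[OF s(1) open_ball wB] .
      have "wirt_bar (\<lambda>w. cnj ((w - z0) ^ j) * it j w) w
          = cnj (of_nat j * (w - z0) ^ (j - 1)) * it j w + cnj ((w - z0) ^ j) * it (Suc j) w"
        using wirt_mult(2)[OF bounded_linear.has_derivative[OF bounded_linear_cnj fu] smooth_deriv[OF sm wD]]
          wirt_bar_cnj[OF fu] wirt_holomorphic(1)[OF hu open_ball wB] du itS by simp
      moreover have "wirt_bar (\<lambda>w. cnj (s w) * hopf_sq w) w = cnj (deriv s w) * hopf_sq w + cnj (s w) * wirt_bar hopf_sq w"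
        using wirt_mult(2)[OF bounded_linear.has_derivative[OF bounded_linear_cnj fs] smooth_deriv[OF smooth_quartic(1) wD]]
          wirt_bar_cnj[OF fs] wirt_holomorphic(1)[OF s(1) open_ball wB] by simp
      moreover have "wirt_bar (\<lambda>w. cnj ((w - z0) ^ j) * it j w) w = wirt_bar (\<lambda>w. cnj (s w) * hopf_sq w) w"
        using e by (intro wirt_cong_open(2)[OF oW w]) simp
      ultimately have 1: "cnj (of_nat j * y ^ (j - 1)) * it j w + cnj (y ^ j) * it (Suc j) w
          = cnj (deriv s w) * hopf_sq w + cnj (s w) * wirt_bar hopf_sq w" by (simp add: y_def)
      have 2: "cnj y * cnj (of_nat j * y ^ (j - 1)) = of_nat j * cnj (y ^ j)"
        by (cases j) simp_all
      have "cnj y * wirt_bar hopf_sq w = - cnj (of_nat n * g w + y * deriv g w) / (4 * cnj (g w)) * hopf_sq w"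
        using log_deriv[OF w] nz[OF wB] by (simp add: y_def divide_simps) (simp add: algebra_simps)
      then have 3: "cnj y * wirt_bar hopf_sq w = - cnj ((of_nat n + y * deriv g w / g w) / 4) * hopf_sq w"
        using nz[OF wB] by (simp add: divide_simps) (simp add: algebra_simps)
      have "cnj y ^ Suc j * it (Suc j) w = cnj y * (cnj (y ^ j) * it (Suc j) w)" by simp
      also have "cnj (y ^ j) * it (Suc j) w = cnj (deriv s w) * hopf_sq w + cnj (s w) * wirt_bar hopf_sq w - cnj (of_nat j * y ^ (j - 1)) * it j w"
        using 1 by (simp add: algebra_simps)
      also have "cnj y * \<dots> = cnj y * cnj (deriv s w) * hopf_sq w + cnj (s w) * (cnj y * wirt_bar hopf_sq w) - of_nat j * (cnj (y ^ j) * it j w)"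
        using 2 by (simp only: right_diff_distrib distrib_left mult.assoc[symmetric]) (simp add: mult_ac)
      also have "cnj (y ^ j) * it j w = cnj (s w) * hopf_sq w" using e[OF w] by (simp add: y_def)
      finally show ?thesis unfolding 3 s'_def y_def[symmetric] by (simp add: algebra_simps)
    qed
    ultimately show ?case by blast
  qed
  then obtain s where s: "s holomorphic_on ball z0 r" "s z0 \<noteq> 0"
      and e: "\<And>w. w \<in> W \<Longrightarrow> (cnj (w - z0)) ^ n * it n w = cnj (s w) * hopf_sq w" by blast
  \<comment> \<open>Since |k^2|^2 = |h|, squaring cancels one factor |w - z0|^n. As w tends to z0, the left-hand side tends to 0, the right-hand side to a nonzero limit.\<close>
  have eq: "cmod (w - z0) ^ n * (cmod (it n w))\<^sup>2 = (cmod (s w))\<^sup>2 * cmod (g w)" if w: "w \<in> W" for w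
  proof -
    have wB: "w \<in> ball z0 r" and wD: "w \<in> D" and y: "cmod (w - z0) ^ n \<noteq> 0" using w WD by (auto simp: W_def)
    have "(cmod (hopf_sq w))\<^sup>2 = cmod (quartic w)"
      unfolding quartic_def quartic_derivs(1)[OF wD] by (simp add: norm_mult power2_eq_square)
    also have "\<dots> = cmod (w - z0) ^ n * cmod (g w)" using q[OF wB] by (simp add: norm_mult norm_power)
    finally have h: "(cmod (hopf_sq w))\<^sup>2 = cmod (w - z0) ^ n * cmod (g w)" .
    have "cmod (w - z0) ^ n * cmod (it n w) = cmod (s w) * cmod (hopf_sq w)"
      using arg_cong[OF e[OF w], of cmod] by (simp add: norm_mult norm_power flip: complex_cnj_diff)
    then have "(cmod (w - z0) ^ n * cmod (it n w))\<^sup>2 = (cmod (s w))\<^sup>2 * (cmod (hopf_sq w))\<^sup>2" by (simp add: power_mult_distrib)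
    then have "cmod (w - z0) ^ n * (cmod (w - z0) ^ n * (cmod (it n w))\<^sup>2) = cmod (w - z0) ^ n * ((cmod (s w))\<^sup>2 * cmod (g w))"
      unfolding h by (simp add: power2_eq_square algebra_simps)
    then show ?thesis unfolding mult_left_cancel[OF y] .
  qed
  have cont: "isCont (it n) z0" "isCont s z0" "isCont g z0"
  proof -
    show "isCont (it n) z0"
      using smooth_on_continuous[OF sm[of n]] subsetD[OF r(2) z0] continuous_on_eq_continuous_at[OF open_D] by blast
    show "isCont s z0" "isCont g z0"
      using holomorphic_on_imp_continuous_on[OF s(1)] holomorphic_on_imp_continuous_on[OF g] z0
      by (auto simp: continuous_on_eq_continuous_at[OF open_ball])
  qed
  have "((\<lambda>w. cmod (w - z0) ^ n * (cmod (it n w))\<^sup>2) \<longlongrightarrow> cmod (z0 - z0) ^ n * (cmod (it n z0))\<^sup>2) (at z0)"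
    using cont by (intro tendsto_intros) (auto simp: isCont_def)
  moreover have "\<forall>\<^sub>F w in at z0. cmod (w - z0) ^ n * (cmod (it n w))\<^sup>2 = (cmod (s w))\<^sup>2 * cmod (g w)"
    unfolding eventually_at_topological using eq r by (intro exI[of _ "ball z0 r"]) (auto simp: W_def)
  ultimately have "((\<lambda>w. (cmod (s w))\<^sup>2 * cmod (g w)) \<longlongrightarrow> cmod (z0 - z0) ^ n * (cmod (it n z0))\<^sup>2) (at z0)"
    by (rule Lim_transform_eventually)
  moreover have "((\<lambda>w. (cmod (s w))\<^sup>2 * cmod (g w)) \<longlongrightarrow> (cmod (s z0))\<^sup>2 * cmod (g z0)) (at z0)"
    using cont by (intro tendsto_intros) (auto simp: isCont_def)
  ultimately have "(cmod (s z0))\<^sup>2 * cmod (g z0) = cmod (z0 - z0) ^ n * (cmod (it n z0))\<^sup>2"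
    using tendsto_unique[OF _ _ ] at_neq_bot by blast
  then show False using n s(2) nz[OF z0] by (simp add: zero_power)
qed

lemma quartic_zero_imp_locally_zero:
  assumes "z0 \<in> D" "quartic z0 = 0"
  obtains r where "r > 0" "ball z0 r \<subseteq> D" "\<And>w. w \<in> ball z0 r \<Longrightarrow> quartic w = 0"
proof -
  obtain r where r: "r > 0" "ball z0 r \<subseteq> D" using open_D assms(1) open_contains_ball by blast
  have h: "quartic holomorphic_on ball z0 r" using quartic_holomorphic r(2) holomorphic_on_subset by blast
  have "quartic constant_on ball z0 r"
  proof (rule ccontr)
    assume nc: "\<not> quartic constant_on ball z0 r"
    obtain g e n where e: "0 < n" "0 < e" "ball z0 e \<subseteq> ball z0 r" "g holomorphic_on ball z0 e"
      "\<And>w. w \<in> ball z0 e \<Longrightarrow> quartic w = (w - z0) ^ n * g w" "\<And>w. w \<in> ball z0 e \<Longrightarrow> g w \<noteq> 0"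
      by (rule holomorphic_factor_zero_nonconstant[OF h open_ball connected_ball _ assms(2) nc]) (use r in auto)
    show False by (rule quartic_no_finite_order_zero[OF e(2) _ e(1,4,5,6)]) (use e(3) r(2) in auto)
  qed
  then have "quartic w = 0" if "w \<in> ball z0 r" for w
    using that assms(2) r(1) unfolding constant_on_def by (metis centre_in_ball)
  then show ?thesis using that r by blast
qed

end

section \<open>Vanishing quartic differential: round spheres\<close>

text \<open>
  Gronwall's argument: |u|^2 exp(-2 K t) does not increase.
\<close>

lemma linear_growth_zero:
  fixes u :: "real \<Rightarrow> 'a::real_inner"
  assumes "\<And>t. 0 \<le> t \<Longrightarrow> t \<le> 1 \<Longrightarrow> (u has_vector_derivative u' t) (at t)"
    and "\<And>t. 0 \<le> t \<Longrightarrow> t \<le> 1 \<Longrightarrow> norm (u' t) \<le> K * norm (u t)" and "u 0 = 0"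
  shows "u 1 = 0"
proof -
  define E where "E t = (u t \<bullet> u t) * exp (- 2 * K * t)" for t
  have dE: "(E has_real_derivative (2 * (u t \<bullet> u' t) - 2 * K * (u t \<bullet> u t)) * exp (- 2 * K * t)) (at t)"
    if "0 \<le> t" "t \<le> 1" for t
  proof -
    have "((\<lambda>t. u t \<bullet> u t) has_vector_derivative 2 * (u t \<bullet> u' t)) (at t)"
      using bounded_bilinear.has_vector_derivative[OF bounded_bilinear_inner assms(1)[OF that] assms(1)[OF that]]
      by (simp add: inner_commute)
    then have "((\<lambda>t. u t \<bullet> u t) has_real_derivative 2 * (u t \<bullet> u' t)) (at t)"
      by (simp add: has_real_derivative_iff_has_vector_derivative)
    moreover have "((\<lambda>t. exp (- 2 * K * t)) has_real_derivative (- 2 * K) * exp (- 2 * K * t)) (at t)"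
      by (auto intro!: derivative_eq_intros)
    ultimately show ?thesis unfolding E_def
      using DERIV_mult[of "\<lambda>t. u t \<bullet> u t" "2 * (u t \<bullet> u' t)" t UNIV "\<lambda>t. exp (- 2 * K * t)" "(- 2 * K) * exp (- 2 * K * t)"]
      by (simp add: algebra_simps)
  qed
  have "u t \<bullet> u' t \<le> K * (u t \<bullet> u t)" if "0 \<le> t" "t \<le> 1" for t
  proof -
    have "u t \<bullet> u' t \<le> norm (u t) * norm (u' t)" by (rule norm_cauchy_schwarz)
    also have "\<dots> \<le> norm (u t) * (K * norm (u t))" using assms(2)[OF that] by (intro mult_left_mono) auto
    also have "\<dots> = K * (u t \<bullet> u t)" by (simp add: dot_square_norm power2_eq_square)
    finally show ?thesis .
  qed
  then have "(2 * (u t \<bullet> u' t) - 2 * K * (u t \<bullet> u t)) * exp (- 2 * K * t) \<le> 0" if "0 \<le> t" "t \<le> 1" for t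
    using that by (intro mult_nonpos_nonneg) auto
  then have "E 1 \<le> E 0"
    by (intro DERIV_nonpos_imp_nonincreasing[of 0 1 E]) (auto intro: dE)
  then have "(u 1 \<bullet> u 1) * exp (- 2 * K) \<le> 0" using assms(3) by (simp add: E_def)
  then have "u 1 \<bullet> u 1 \<le> 0" by (simp add: mult_le_0_iff)
  then show ?thesis by (metis inner_eq_zero_iff inner_ge_zero order_antisym)
qed

context schwarzian_lift
begin

lemma wirt_pair:
  assumes "smooth_on u D" "z \<in> D"
  shows "wirt (\<lambda>x. form v (u x)) z = form v (d_z u z)"
    "wirt_bar (\<lambda>x. form v (u x)) z = form v (d_zbar u z)"
    "smooth_on (\<lambda>x. form v (u x)) D"
proof -
  have "d_z (\<lambda>x. v) z = 0" "d_zbar (\<lambda>x. v) z = 0"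
    by (simp_all add: d_z_def d_zbar_def cscale.zero_right)
  then show "wirt (\<lambda>x. form v (u x)) z = form v (d_z u z)"
    "wirt_bar (\<lambda>x. form v (u x)) z = form v (d_zbar u z)"
    using wirt_form[OF smooth_on_const[OF open_D, of v] assms] by (simp_all add: cform.zero_left)
  show "smooth_on (\<lambda>x. form v (u x)) D"
    by (rule cform.smooth_on[OF smooth_on_const[OF open_D] assms(1)])
qed

lemma umbilic_equations:
  assumes "\<And>x. x \<in> D \<Longrightarrow> quartic x = 0" "z \<in> D"
  shows "ZZ z = cscale (- c z / 2) (\<Psi> z)" "BB z = cscale (- cnj (c z) / 2) (\<Psi> z)"
    "d_z ZB z = cscale (- c z / 2) (B z)" "d_zbar ZB z = cscale (- cnj (c z) / 2) (Z z)"
proof -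
  have ZZ: "ZZ x = cscale (- c x / 2) (\<Psi> x)" if "x \<in> D" for x
  proof -
    have "hopf_sq x = 0" using assms(1)[OF that] unfolding quartic_def quartic_derivs(1)[OF that] by auto
    then have "\<kappa> x = 0" by (rule quartic_derivs(4)[OF that])
    then have "ZZ x = - cscale (c x / 2) (\<Psi> x)" by (simp add: add_eq_0_iff2)
    also have "\<dots> = cscale (- c x / 2) (\<Psi> x)" by (simp add: minkowski_eqI)
    finally show ?thesis .
  qed
  show 1: "ZZ z = cscale (- c z / 2) (\<Psi> z)" by (rule ZZ[OF assms(2)])
  have h: "(\<lambda>x. - c x / 2) holomorphic_on D" by (intro holomorphic_intros hol) auto
  have "d_z ZB z = d_zbar ZZ z" using cnj_frame(11)[OF assms(2)] by simp
  also have "\<dots> = d_zbar (\<lambda>x. cscale (- c x / 2) (\<Psi> x)) z"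
    by (rule d_z_cong_open(2)[OF open_D assms(2) ZZ])
  also have "\<dots> = cscale (- c z / 2) (B z)"
    using d_z_cscale(2)[OF frechet_holomorphic[OF h open_D assms(2)] smooth_deriv[OF smooth_\<Psi> assms(2)]]
      wirt_holomorphic(2)[OF h open_D assms(2)] by (simp add: cscale.zero_left)
  finally show 2: "d_z ZB z = cscale (- c z / 2) (B z)" .
  show "BB z = cscale (- cnj (c z) / 2) (\<Psi> z)"
    using arg_cong[OF 1, of cnj_vec] cnj_frame(3)[OF assms(2)] by simp
  show "d_zbar ZB z = cscale (- cnj (c z) / 2) (Z z)"
    using arg_cong[OF 2, of cnj_vec] cnj_frame(2,7)[OF assms(2)] by simp
qed

lemma frechet_norm_le:
  assumes "smooth_on a D" "z \<in> D" "cmod (wirt a z) \<le> m" "cmod (wirt_bar a z) \<le> m"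
  shows "cmod (fderiv a z h) \<le> 2 * m * cmod h"
proof -
  have "cmod (fderiv a z h) \<le> cmod (wirt a z) * cmod h + cmod (wirt_bar a z) * cmod h"
    unfolding frechet_eq_wirt[OF assms(1,2)] by (metis complex_mod_cnj norm_mult norm_triangle_ineq)
  also have "\<dots> \<le> m * cmod h + m * cmod h" using assms by (intro add_mono mult_right_mono) auto
  finally show ?thesis by simp
qed

text \<open>
  If h = 0, the derivatives of the frame \<psi>, \<open>\<psi>_z\<close>,
  \<open>\<psi>_zbar\<close>, \<open>\<psi>_zzbar\<close> are combinations of the frame with
  bounded coefficients on segments. The pairings of the fixed vector N with the frame thus
  satisfy a homogeneous linear system of ordinary differential equations along each segment.
\<close>

lemma umbilic_perp_propagates:
  assumes q: "\<And>x. x \<in> D \<Longrightarrow> quartic x = 0" and "convex D" and z0: "z0 \<in> D"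
    and N: "N \<in> lorentz_perp (V_fibre \<psi> z0)" and z1: "z1 \<in> D"
  shows "form N (\<psi> z1) = 0"
proof -
  define d where "d = z1 - z0"
  define \<gamma> where "\<gamma> t = z0 + of_real t * d" for t
  have \<gamma>D: "\<gamma> t \<in> D" if "0 \<le> t" "t \<le> 1" for t
  proof -
    have "\<gamma> t = (1 - t) *\<^sub>R z0 + t *\<^sub>R z1" by (simp add: \<gamma>_def d_def scaleR_conv_of_real algebra_simps)
    then show ?thesis using convexD_alt[OF assms(2) z0 z1 that] by simp
  qed
  define a where "a i x = form (cvec N) (if i = (0::nat) then \<Psi> x else if i = 1 then Z x else if i = 2 then B x else ZB x)" for i x
  have a: "a 0 = (\<lambda>x. form (cvec N) (\<Psi> x))" "a 1 = (\<lambda>x. form (cvec N) (Z x))"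
    "a 2 = (\<lambda>x. form (cvec N) (B x))" "a 3 = (\<lambda>x. form (cvec N) (ZB x))"
    by (auto simp: a_def)
  have sm: "smooth_on (a 0) D" "smooth_on (a 1) D" "smooth_on (a 2) D" "smooth_on (a 3) D"
    unfolding a by (rule wirt_pair(3)[OF smooth_frame(1) z0] wirt_pair(3)[OF smooth_frame(2) z0] 
      wirt_pair(3)[OF smooth_frame(3) z0] wirt_pair(3)[OF smooth_frame(5) z0])+
  have w: "wirt (a 0) x = a 1 x" "wirt_bar (a 0) x = a 2 x" "wirt (a 1) x = - c x / 2 * a 0 x" "wirt_bar (a 1) x = a 3 x"
    "wirt (a 2) x = a 3 x" "wirt_bar (a 2) x = - cnj (c x) / 2 * a 0 x" "wirt (a 3) x = - c x / 2 * a 2 x"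
    "wirt_bar (a 3) x = - cnj (c x) / 2 * a 1 x" if x: "x \<in> D" for x
    using wirt_pair(1,2)[OF smooth_frame(1) x] wirt_pair(1,2)[OF smooth_frame(2) x] wirt_pair(1,2)[OF smooth_frame(3) x]
      wirt_pair(1,2)[OF smooth_frame(5) x] umbilic_equations[OF q x] cnj_frame(6)[OF x]
    by (simp_all only: a cform_scale)
  have "compact (\<gamma> ` {0..1})"
    unfolding \<gamma>_def by (intro compact_continuous_image continuous_intros) auto
  moreover have "continuous_on (\<gamma> ` {0..1}) c"
    using holomorphic_on_imp_continuous_on[OF hol] \<gamma>D by (auto intro: continuous_on_subset)
  ultimately have "bounded (c ` (\<gamma> ` {0..1}))"
    using compact_continuous_image compact_imp_bounded by blast
  then obtain K0 where K0: "\<And>t. t \<in> {0..1} \<Longrightarrow> cmod (c (\<gamma> t)) \<le> K0" unfolding bounded_iff by blast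
  define K where "K = 1 + K0"
  have K: "0 \<le> K0" using order_trans[OF norm_ge_zero K0[of 0]] by simp
  define u where "u t = (a 0 (\<gamma> t), a 1 (\<gamma> t), a 2 (\<gamma> t), a 3 (\<gamma> t))" for t
  define u' where "u' t = (fderiv (a 0) (\<gamma> t) d, fderiv (a 1) (\<gamma> t) d,
    fderiv (a 2) (\<gamma> t) d, fderiv (a 3) (\<gamma> t) d)" for t
  have dcomp: "((\<lambda>t. b (\<gamma> t)) has_vector_derivative fderiv b (\<gamma> t) d) (at t)"
    if "smooth_on b D" "0 \<le> t" "t \<le> 1" for b :: "complex \<Rightarrow> complex" and t
  proof -
    have "(\<gamma> has_vector_derivative d) (at t)"
      unfolding \<gamma>_def by (auto intro!: derivative_eq_intros simp: has_vector_derivative_def scaleR_conv_of_real)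
    then show ?thesis
      using vector_derivative_diff_chain_within[of \<gamma> d t UNIV b] smooth_deriv[OF that(1) \<gamma>D[OF that(2,3)]]
      by (auto simp: comp_def intro: has_derivative_at_withinI)
  qed
  have "u 1 = 0"
  proof (rule linear_growth_zero[where u' = u' and K = "8 * (K * cmod d)"])
    fix t :: real assume t: "0 \<le> t" "t \<le> 1"
    show "(u has_vector_derivative u' t) (at t)"
      unfolding u_def u'_def by (intro has_vector_derivative_Pair dcomp sm t)
    have l: "cmod (a 0 (\<gamma> t)) \<le> norm (u t)" "cmod (a 1 (\<gamma> t)) \<le> norm (u t)" "cmod (a 2 (\<gamma> t)) \<le> norm (u t)" "cmod (a 3 (\<gamma> t)) \<le> norm (u t)"
      using norm_fst_le[of "a 0 (\<gamma> t)" "(a 1 (\<gamma> t), a 2 (\<gamma> t), a 3 (\<gamma> t))"]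
        norm_snd_le[of "(a 1 (\<gamma> t), a 2 (\<gamma> t), a 3 (\<gamma> t))" "a 0 (\<gamma> t)"]
        norm_fst_le[of "a 1 (\<gamma> t)" "(a 2 (\<gamma> t), a 3 (\<gamma> t))"] norm_snd_le[of "(a 2 (\<gamma> t), a 3 (\<gamma> t))" "a 1 (\<gamma> t)"]
        norm_fst_le[of "a 2 (\<gamma> t)" "a 3 (\<gamma> t)"] norm_snd_le[of "a 3 (\<gamma> t)" "a 2 (\<gamma> t)"]
      unfolding u_def by linarith+
    have cK: "cmod (- c (\<gamma> t) / 2 * b) \<le> K * norm (u t)" "cmod (- cnj (c (\<gamma> t)) / 2 * b) \<le> K * norm (u t)" "cmod b \<le> K * norm (u t)"
      if "cmod b \<le> norm (u t)" for b
    proof -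
      have c2: "cmod (c (\<gamma> t)) / 2 \<le> K" using K0[of t] t K by (simp add: K_def)
      show "cmod (- c (\<gamma> t) / 2 * b) \<le> K * norm (u t)" "cmod (- cnj (c (\<gamma> t)) / 2 * b) \<le> K * norm (u t)"
        using mult_mono[OF c2 that] K by (simp_all add: norm_mult norm_divide K_def)
      show "cmod b \<le> K * norm (u t)" using mult_mono[of 1 K "cmod b" "norm (u t)"] that K by (simp add: K_def)
    qed
    have f: "cmod (fderiv (a 0) (\<gamma> t) d) \<le> 2 * (K * norm (u t)) * cmod d"
      "cmod (fderiv (a 1) (\<gamma> t) d) \<le> 2 * (K * norm (u t)) * cmod d"
      "cmod (fderiv (a 2) (\<gamma> t) d) \<le> 2 * (K * norm (u t)) * cmod d"
      "cmod (fderiv (a 3) (\<gamma> t) d) \<le> 2 * (K * norm (u t)) * cmod d"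
      by (rule frechet_norm_le[OF sm(1) \<gamma>D[OF t]] frechet_norm_le[OF sm(2) \<gamma>D[OF t]]
        frechet_norm_le[OF sm(3) \<gamma>D[OF t]] frechet_norm_le[OF sm(4) \<gamma>D[OF t]]; 
        unfold w[OF \<gamma>D[OF t]]; rule cK; rule l)+
    have "norm (u' t) \<le> cmod (fderiv (a 0) (\<gamma> t) d) + (cmod (fderiv (a 1) (\<gamma> t) d) +
      (cmod (fderiv (a 2) (\<gamma> t) d) + cmod (fderiv (a 3) (\<gamma> t) d)))"
      unfolding u'_def by (intro order_trans[OF norm_Pair_le] add_left_mono order_refl)
    then show "norm (u' t) \<le> 8 * (K * cmod d) * norm (u t)" using f by (simp add: algebra_simps)
  next
    have n: "form N (\<psi> z0) = 0" "form N (X z0) = 0" "form N (Y z0) = 0" "form N (M z0) = 0"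
      using N unfolding perp_V[OF z0] by auto
    have "a 0 z0 = 0" using n by (simp add: a \<Psi>_def)
    moreover have "a 1 z0 = 0" "a 2 z0 = 0" using n
      unfolding a by (simp_all add: Z_eq[OF z0] B_eq[OF z0] cform.diff_right cform.add_right)
    moreover have "a 3 z0 = form (cvec N) (cvec (M z0))" by (simp only: a cvec_M[OF z0])
    then have "a 3 z0 = 0" using n by simp
    ultimately show "u 0 = 0" by (simp add: u_def \<gamma>_def zero_prod_def)
  qed
  then have "a 0 z1 = 0" by (simp add: u_def \<gamma>_def d_def zero_prod_def)
  then show ?thesis by (simp add: a \<Psi>_def)
qed

lemma locally_perp_imp_perp_V:
  assumes W: "open W" "W \<subseteq> D" "z \<in> W" and N: "\<And>x. x \<in> W \<Longrightarrow> form N (\<psi> x) = 0"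
  shows "N \<in> lorentz_perp (V_fibre \<psi> z)"
proof -
  have z: "z \<in> D" using W by auto
  have 0: "form (cvec N) (\<Psi> x) = 0" if "x \<in> W" for x using N[OF that] by (simp add: \<Psi>_def)
  have 1: "form (cvec N) (Z x) = 0" "form (cvec N) (B x) = 0" if "x \<in> W" for x
  proof -
    have x: "x \<in> D" using that W by auto
    show "form (cvec N) (Z x) = 0" "form (cvec N) (B x) = 0"
      using wirt_pair(1,2)[OF smooth_frame(1) x, of "cvec N"] wirt_cong_open[OF W(1) that 0] by simp_all
  qed
  have "form (cvec N) (ZB z) = 0"
    using wirt_pair(2)[OF smooth_frame(2) z, of "cvec N"] wirt_cong_open(2)[OF W(1,3) 1(1)] by simp
  then have "form (cvec N) (cvec (M z)) = 0" by (simp only: cvec_M[OF z])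
  then have "form N (M z) = 0" by simp
  moreover have "form (cvec N) (cvec (X z)) = 0" "form (cvec N) (cvec (Y z)) = 0"
    unfolding XY_eq[OF z] using 1[OF W(3)] by (simp_all add: cform.add_right cform.diff_right)
  ultimately show ?thesis unfolding perp_V[OF z] using N[OF W(3)] by simp
qed

end

section \<open>Normalised coordinates\<close>

locale normalised_lift = schwarzian_lift +
  assumes quartic_1: "\<And>z. z \<in> D \<Longrightarrow> quartic z = 1"
begin

text \<open>
  From k^3 conj(k) = 1 follows k = 1 or k = -1, so \<kappa> itself is a real unit normal.
\<close>

lemma kappa_unit:
  assumes "z \<in> D"
  shows "form (\<kappa> z) (\<kappa> z) = 1" "cnj_vec (\<kappa> z) = \<kappa> z"
proof -
  have 1: "hopf_sq z * of_real (cmod (hopf_sq z)) = 1"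
    using quartic_1[OF assms] quartic_derivs(1)[OF assms] by (simp add: quartic_def)
  then have "cmod (hopf_sq z) * cmod (hopf_sq z) = 1" by (metis abs_norm_cancel norm_mult norm_of_real norm_one)
  then have "cmod (hopf_sq z) = 1" by (metis abs_norm_cancel power2_eq_square power2_eq_1_iff abs_1 abs_minus_cancel)
  then have h: "hopf_sq z = 1" using 1 by simp
  obtain n k where n: "form n n = 1" and k: "\<kappa> z = cscale k (cvec n)" "cnj_vec (\<kappa> z) = cscale (cnj k) (cvec n)"
    "hopf_sq z = k * k"
    using kappa_multiple[OF assms] by metis
  have "k = 1 \<or> k = -1" using h k(3) by (metis square_eq_1_iff)
  then show "form (\<kappa> z) (\<kappa> z) = 1" "cnj_vec (\<kappa> z) = \<kappa> z"
    unfolding k(2) unfolding k(1) using n by auto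
qed

lemma smooth_kappa: "smooth_on \<kappa> D"
proof -
  have "4 * form (ZZ x) (ZB x) = c x" if "x \<in> D" for x using schwarzian_eq[OF that] by (simp add: mult.commute)
  moreover have "smooth_on (\<lambda>x. 4 * form (ZZ x) (ZB x)) D"
    by (rule bounded_linear.smooth_on[OF bounded_linear_mult_right cform.smooth_on[OF smooth_frame(4,5)]])
  ultimately have "smooth_on c D" using smooth_on_cong by blast
  then have "smooth_on (\<lambda>x. c x / 2) D" by (rule bounded_linear.smooth_on[OF bounded_linear_divide])
  then show ?thesis by (intro smooth_on_add smooth_frame cscale.smooth_on)
qed

lemma frame_complete:
  assumes "z \<in> D" "form w (\<Psi> z) = 0" "form w (Z z) = 0" "form w (B z) = 0"
    "form w (ZB z) = 0" "form w (\<kappa> z) = 0"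
  shows "w = 0"
proof -
  define n where "n = Re_vec (\<kappa> z)"
  have cn: "cvec n = \<kappa> z"
    unfolding n_def by (rule cvec_Re_vec_cnj[OF kappa_unit(2)[OF assms(1)]])
  have "form (cvec n) (cvec n) = 1" unfolding cn by (rule kappa_unit(1)[OF assms(1)])
  then have nn: "form n n = 1" by simp
  have np: "form n (\<psi> z) = 0" "form n (dual_null z) = 0" "form n (X z) = 0" "form n (Y z) = 0"
    using kappa_perp(5)[OF assms(1)] unfolding n_def perp_V_null_frame[OF assms(1)] by auto
  have e: "u = 0" if "form u (\<psi> z) = 0" "form u (X z) = 0" "form u (Y z) = 0" 
    "form u (M z) = 0" "form u n = 0" for u
  proof -
    have "form u (dual_null z) = 0" using that by (simp add: dual_null_def form.add_right form.scaleR_right)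
    then show ?thesis using null_frame_expand[OF null_frame_lift[OF assms(1)] nn np, of u] that by simp
  qed
  have "form w (cvec (\<psi> z)) = 0" using assms(2) by (simp add: \<Psi>_def)
  moreover have "form w (cvec (X z)) = 0" "form w (cvec (Y z)) = 0"
    unfolding XY_eq[OF assms(1)] using assms(3,4) by (simp_all add: cform.add_right cform.diff_right)
  moreover have "form w (cvec (M z)) = 0" unfolding cvec_M[OF assms(1)] by (rule assms(5))
  moreover have "form w (cvec n) = 0" unfolding cn by (rule assms(6))
  ultimately have "Re_vec w = 0" "Im_vec w = 0"
    unfolding complex_eq_iff Re_Im_form_cvec by (auto intro: e)
  then show ?thesis by (metis cvec_Re_eq linear_0[OF bounded_linear.linear[OF bounded_linear_cvec]])
qed

text \<open>
  The pairings of \<open>\<kappa>_z\<close> with the frame \<psi>, \<open>\<psi>_z\<close>,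
  \<open>\<psi>_zbar\<close>, \<open>\<psi>_zzbar\<close>, \<kappa> are those of \<open>-2
  \<psi>_zbar\<close>, so the two are equal; conjugation gives \<open>\<kappa>_zbar = -2
  \<psi>_z\<close>. Comparing \<open>\<kappa>_zzbar\<close> computed from both shows that
  \<open>\<psi>_zz\<close> is real, and then so is c.
\<close>

lemma kappa_parallel:
  assumes z: "z \<in> D"
  shows "ZZ z = BB z" "Im (c z) = 0" "d_z ZB z = cscale (-2) (Z z) - cscale (c z / 2) (B z)"
proof -
  have sK: "smooth_on \<kappa> D" by (rule smooth_kappa)
  have hc: "(\<lambda>x. c x / 2) holomorphic_on D" by (intro holomorphic_intros hol) auto
  have s\<Psi>: "smooth_on (\<lambda>x. cscale (c x / 2) (\<Psi> x)) D"
    using smooth_on_diff[OF sK smooth_frame(4)] by simp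
  have dbK: "d_zbar \<kappa> x = d_z ZB x + cscale (c x / 2) (B x)" if x: "x \<in> D" for x
    using d_z_add(2)[OF smooth_frame(4) s\<Psi> x] cnj_frame(11)[OF x]
      d_z_cscale(2)[OF frechet_holomorphic[OF hc open_D x] smooth_deriv[OF smooth_\<Psi> x]]
      wirt_holomorphic(2)[OF hc open_D x] by (simp add: cscale.zero_left)
  have dK: "d_z \<kappa> x = cscale (-2) (B x)" if x: "x \<in> D" for x
  proof -
    note pr = pairings[OF x]
    have kZZ: "form (\<kappa> x) (ZZ x) = 1"
    proof -
      have "form (\<kappa> x) (\<kappa> x) = form (\<kappa> x) (ZZ x) + c x / 2 * form (\<kappa> x) (\<Psi> x)"
        by (simp only: cform.add_right cform_scale)
      then show ?thesis using kappa_unit(1)[OF x] kappa_perp(1)[OF x] by simp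
    qed
    have kBK: "form (d_z \<kappa> x) (\<kappa> x) = 0" "form (d_zbar \<kappa> x) (\<kappa> x) = 0"
      using pair_const_deriv[OF sK sK kappa_unit(1) x] form_commute[of "\<kappa> x" "d_z \<kappa> x"] form_commute[of "\<kappa> x" "d_zbar \<kappa> x"] by auto
    have "form (\<kappa> x) (d_z ZB x) = 0"
    proof -
      have "form (\<kappa> x) (d_zbar \<kappa> x) = form (\<kappa> x) (d_z ZB x) + c x / 2 * form (\<kappa> x) (B x)"
        unfolding dbK[OF x] by (simp only: cform.add_right cform_scale)
      then show ?thesis using kBK(2) kappa_perp(3)[OF x] form_commute[of "\<kappa> x" "d_zbar \<kappa> x"] by simp
    qed
    then have p5: "form (d_z \<kappa> x) (ZB x) = 0"
      using pair_const_deriv(1)[OF sK smooth_frame(5) kappa_perp(4) x] by simp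
    have p1: "form (d_z \<kappa> x) (\<Psi> x) = 0"
      using pair_const_deriv(1)[OF sK smooth_frame(1) kappa_perp(1) x] kappa_perp(2)[OF x] by simp
    have p2: "form (d_z \<kappa> x) (Z x) = -1"
      using pair_const_deriv(1)[OF sK smooth_frame(2) kappa_perp(2) x] kZZ by (simp add: add_eq_0_iff2)
    have p3: "form (d_z \<kappa> x) (B x) = 0"
      using pair_const_deriv(1)[OF sK smooth_frame(3) kappa_perp(3) x] kappa_perp(4)[OF x] cnj_frame(6)[OF x] by simp
    have "d_z \<kappa> x + cscale 2 (B x) = 0"
    proof (rule frame_complete[OF x])
      show "form (d_z \<kappa> x + cscale 2 (B x)) (\<Psi> x) = 0" "form (d_z \<kappa> x + cscale 2 (B x)) (Z x) = 0"
        "form (d_z \<kappa> x + cscale 2 (B x)) (B x) = 0" "form (d_z \<kappa> x + cscale 2 (B x)) (ZB x) = 0"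
        "form (d_z \<kappa> x + cscale 2 (B x)) (\<kappa> x) = 0"
        unfolding cform.add_left cform_scale form_commute[of "B x" "Z x"] form_commute[of "B x" "ZB x"]
          form_commute[of "B x" "\<kappa> x"] form_commute[of "\<Psi> x" "B x"] p1 p2 p3 p5 kBK pr kappa_perp[OF x] by simp_all
    qed
    then have "d_z \<kappa> x = - cscale 2 (B x)" by (rule eq_neg_iff_add_eq_0[THEN iffD2])
    also have "\<dots> = cscale (-2) (B x)" by (simp add: minkowski_eqI)
    finally show ?thesis .
  qed
  have dbK': "d_zbar \<kappa> x = cscale (-2) (Z x)" if x: "x \<in> D" for x
    using d_z_cnj(2)[OF sK x] d_z_cong_open(2)[OF open_D x, of "\<lambda>x. cnj_vec (\<kappa> x)" \<kappa>] kappa_unit(2) dK[OF x] cnj_frame(2)[OF x] by simp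
  have 1: "d_zbar (d_z \<kappa>) z = cscale (-2) (BB z)"
    using d_z_cong_open(2)[OF open_D z, of "d_z \<kappa>" "\<lambda>x. cscale (-2) (B x)"] dK d_z_cscale_const(2)[OF smooth_frame(3) z] by simp
  have 2: "d_z (d_zbar \<kappa>) z = cscale (-2) (ZZ z)"
    using d_z_cong_open(1)[OF open_D z, of "d_zbar \<kappa>" "\<lambda>x. cscale (-2) (Z x)"] dbK' d_z_cscale_const(1)[OF smooth_frame(2) z] by simp
  have "cscale (-2) (ZZ z) = cscale (-2) (BB z)" using d_z_d_zbar_commute[OF sK z] 1 2 by simp
  then have "cscale (-1/2) (cscale (-2) (ZZ z)) = cscale (-1/2) (cscale (-2) (BB z))" by simp
  then show ZB: "ZZ z = BB z" by simp
  have "ZZ z + cscale (cnj (c z) / 2) (\<Psi> z) = cnj_vec (\<kappa> z)"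
    using ZB cnj_frame(3)[OF z] by (simp add: linear_add[OF bounded_linear.linear[OF bounded_linear_cnj_vec]])
  then have "cscale (cnj (c z) / 2) (\<Psi> z) = cscale (c z / 2) (\<Psi> z)" using kappa_unit(2)[OF z] by simp
  then have "cnj (c z) * fst (\<Psi> z) = c z * fst (\<Psi> z)" by (metis (no_types, lifting) cscale_nth(1) times_divide_eq_left divide_cancel_right zero_neq_numeral)
  moreover have "fst (\<Psi> z) \<noteq> 0" using real_frame(2)[OF z] by (simp add: \<Psi>_def)
  ultimately have "cnj (c z) = c z" by simp
  then show "Im (c z) = 0" by (simp add: complex_eq_iff)
  show "d_z ZB z = cscale (-2) (Z z) - cscale (c z / 2) (B z)"
    using dbK[OF z] dbK'[OF z] by (simp add: algebra_simps)
qed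

definition XX where "XX z = fderiv X z 1"
definition YY where "YY z = fderiv Y z \<i>"

lemma smooth_XY: "smooth_on X D" "smooth_on Y D" "smooth_on XX D" "smooth_on YY D"
proof -
  show x: "smooth_on X D" and y: "smooth_on Y D" by (rule smooth_on_frechet[OF smooth_\<psi>])+
  show "smooth_on XX D" "smooth_on YY D"
    unfolding XX_def[abs_def] YY_def[abs_def] by (rule smooth_on_frechet[OF x] smooth_on_frechet[OF y])+
qed

lemma cvec_XX_YY:
  assumes z: "z \<in> D"
  shows "cvec (XX z) = cscale 2 (ZZ z + ZB z)" "cvec (YY z) = cscale 2 (ZB z - ZZ z)"
    "fderiv X z \<i> = 0" "fderiv Y z 1 = 0"
proof -
  have fX: "cvec (fderiv X z h) = fderiv (\<lambda>x. Z x + B x) z h" for h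
    by (rule trans[OF frechet_cvec[OF smooth_XY(1) z] fun_cong[OF frechet_derivative_cong_open[OF open_D z XY_eq(1)]]])
  have fY: "cvec (fderiv Y z h) = fderiv (\<lambda>x. cscale \<i> (Z x - B x)) z h" for h
    by (rule trans[OF frechet_cvec[OF smooth_XY(2) z] fun_cong[OF frechet_derivative_cong_open[OF open_D z XY_eq(2)]]])
  note d = d_z_add[OF smooth_frame(2,3) z] d_z_cscale_const[OF smooth_on_diff[OF smooth_frame(2,3)] z] d_z_diff[OF smooth_frame(2,3) z]
    cnj_frame(6)[OF z] kappa_parallel(1)[OF z]
  show "cvec (XX z) = cscale 2 (ZZ z + ZB z)"
    unfolding XX_def fX frechet_d_z d by (auto intro!: minkowski_eqI)
  show "cvec (YY z) = cscale 2 (ZB z - ZZ z)"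
    unfolding YY_def fY frechet_d_z d by (auto intro!: minkowski_eqI simp: algebra_simps)
  have "cvec (fderiv X z \<i>) = cvec 0"
    unfolding fX frechet_d_z d by (auto intro!: minkowski_eqI)
  then show "fderiv X z \<i> = 0" by simp
  have "cvec (fderiv Y z 1) = cvec 0"
    unfolding fY frechet_d_z d by (auto intro!: minkowski_eqI simp: algebra_simps)
  then show "fderiv Y z 1 = 0" by simp
qed

text \<open>
  The coordinate lines are the curvature lines: the tangent fields \<open>\<psi>_x\<close> and
  \<open>\<psi>_y\<close> depend on x alone and on y alone, and each satisfies a linear
  oscillator equation. In complex terms this rests on \<open>\<psi>_zzz =
  \<psi>_zzbarzbar\<close>, a consequence of the reality of \<open>\<psi>_zz\<close>.
\<close>

lemma curvature_line_equations:
  assumes z: "z \<in> D"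
  shows "fderiv XX z 1 = (- 8 - 2 * Re (c z)) *\<^sub>R X z" "fderiv XX z \<i> = 0"
    "fderiv YY z \<i> = (2 * Re (c z) - 8) *\<^sub>R Y z" "fderiv YY z 1 = 0"
proof -
  have fX: "cvec (fderiv XX z h) = fderiv (\<lambda>x. cscale 2 (ZZ x + ZB x)) z h" for h
    by (rule trans[OF frechet_cvec[OF smooth_XY(3) z] fun_cong[OF frechet_derivative_cong_open[OF open_D z cvec_XX_YY(1)]]])
  have fY: "cvec (fderiv YY z h) = fderiv (\<lambda>x. cscale 2 (ZB x - ZZ x)) z h" for h
    by (rule trans[OF frechet_cvec[OF smooth_XY(4) z] fun_cong[OF frechet_derivative_cong_open[OF open_D z cvec_XX_YY(2)]]])
  have ZZZ: "d_z ZZ z = d_zbar ZB z"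
    using d_z_cong_open(1)[OF open_D z kappa_parallel(1)] cnj_frame(12)[OF z] by simp
  have c: "c z = of_real (Re (c z))" using kappa_parallel(2)[OF z] by (simp add: complex_eq_iff)
  have ZBB: "d_zbar ZB z = cscale (-2) (B z) - cscale (c z / 2) (Z z)"
    using arg_cong[OF kappa_parallel(3)[OF z], of cnj_vec] cnj_frame(1,2,7)[OF z] c
    by (simp add: linear_diff[OF bounded_linear.linear[OF bounded_linear_cnj_vec]])
      (metis complex_cnj_complex_of_real)
  note d = d_z_cscale_const[OF smooth_on_add[OF smooth_frame(4,5)] z] d_z_add[OF smooth_frame(4,5) z]
    d_z_cscale_const[OF smooth_on_diff[OF smooth_frame(5,4)] z] d_z_diff[OF smooth_frame(5,4) z]
    cnj_frame(11)[OF z] ZZZ ZBB kappa_parallel(3)[OF z]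
  have comp_X: "of_real (fst (X z)) = fst (Z z) + fst (B z)" "of_real (snd (X z) $ k) = snd (Z z) $ k + snd (B z) $ k"
    and comp_Y: "of_real (fst (Y z)) = \<i> * (fst (Z z) - fst (B z))" "of_real (snd (Y z) $ k) = \<i> * (snd (Z z) $ k - snd (B z) $ k)" for k
    using XY_eq[OF z] by (simp_all add: prod_eq_iff vec_eq_iff)
  have "cvec (fderiv XX z 1) = cvec ((- 8 - 2 * Re (c z)) *\<^sub>R X z)"
    unfolding fX frechet_d_z d
    by (intro minkowski_eqI) (simp_all add: c[symmetric] comp_X algebra_simps)
  then show "fderiv XX z 1 = (- 8 - 2 * Re (c z)) *\<^sub>R X z" by simp
  have "cvec (fderiv XX z \<i>) = cvec 0"
    unfolding fX frechet_d_z d by (auto intro!: minkowski_eqI simp: algebra_simps)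
  then show "fderiv XX z \<i> = 0" by simp
  have "cvec (fderiv YY z \<i>) = cvec ((2 * Re (c z) - 8) *\<^sub>R Y z)"
    unfolding fY frechet_d_z d
    by (intro minkowski_eqI) (simp_all add: c[symmetric] comp_Y algebra_simps)
  then show "fderiv YY z \<i> = (2 * Re (c z) - 8) *\<^sub>R Y z" by simp
  have "cvec (fderiv YY z 1) = cvec 0"
    unfolding fY frechet_d_z d by (auto intro!: minkowski_eqI simp: algebra_simps)
  then show "fderiv YY z 1 = 0" by simp
qed

end

section \<open>Two commuting rotations\<close>

text \<open>
  If p and q are orthogonal, this is an infinitesimal rotation in the plane of p and q, or an
  infinitesimal boost or parabolic transformation, depending on the signs of their squares.
\<close>

definition plane_rotation :: "real minkowski \<Rightarrow> real minkowski \<Rightarrow> (real minkowski \<Rightarrow>\<^sub>L real minkowski)" where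
  "plane_rotation p q = Blinfun (\<lambda>v. form v p *\<^sub>R q - form v q *\<^sub>R p)"

lemma plane_rotation_apply [simp]:
  "blinfun_apply (plane_rotation p q) v = form v p *\<^sub>R q - form v q *\<^sub>R p"
  unfolding plane_rotation_def
  by (subst bounded_linear_Blinfun_apply)
    (auto intro!: bounded_linear_sub bounded_linear_scaleR_const form.bounded_linear_left bounded_linear_const_scaleR
      bounded_linear_compose[OF bounded_linear_scaleR_left form.bounded_linear_left])

lemma skew_plane_rotation:
  "form (blinfun_apply (plane_rotation p q) v) w = - form v (blinfun_apply (plane_rotation p q) w)"
  by (simp add: form.diff_left form.diff_right form.scaleR_left form.scaleR_right form_commute[of p] form_commute[of q])

lemma plane_rotation_cube:
  assumes "form p p = 1" "form p q = 0"
  shows "plane_rotation p q o\<^sub>L plane_rotation p q o\<^sub>L plane_rotation p q = - form q q *\<^sub>R plane_rotation p q"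
proof (rule blinfun_eqI)
  fix v show "blinfun_apply (plane_rotation p q o\<^sub>L plane_rotation p q o\<^sub>L plane_rotation p q) v
    = blinfun_apply (- form q q *\<^sub>R plane_rotation p q) v"
    using assms form_commute[of q p]
    by (simp add: blinfun.scaleR_left blinfun.minus_left form.minus_left form.diff_left form.scaleR_left algebra_simps)
qed

text \<open>
  S and C are the sine and the versine of frequency \<omega>, divided by \<omega> and
  \<omega>^2, where \<omega>^2 = a may be negative or zero. They are such that I + S B + C B^2
  is the exponential of s B whenever B^3 = -a B. The conditions are the ones for derivatives,
  for the group law, and for isometry.
\<close>

definition rotation_functions :: "real \<Rightarrow> (real \<Rightarrow> real) \<Rightarrow> (real \<Rightarrow> real) \<Rightarrow> bool" where
  "rotation_functions a S C \<longleftrightarrow>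
     (\<forall>s. (S has_real_derivative 1 - a * C s) (at s)) \<and> (\<forall>s. (C has_real_derivative S s) (at s)) \<and>
     S 0 = 0 \<and> C 0 = 0 \<and> (\<forall>s. (S s)\<^sup>2 = 2 * C s - a * (C s)\<^sup>2) \<and>
     (\<forall>s t. S (s + t) = S s + S t - a * (S s * C t + C s * S t)) \<and>
     (\<forall>s t. C (s + t) = C s + C t + S s * S t - a * C s * C t)"

lemma rotation_functions_exist: "\<exists>S C. rotation_functions a S C"
proof -
  consider "a = 0" | w where "w > 0" "a = w\<^sup>2" | w where "w > 0" "a = - (w\<^sup>2)"
    by (metis less_eq_real_def linorder_neqE_linordered_idom minus_minus neg_0_less_iff_less real_sqrt_gt_zero real_sqrt_pow2)
  then show ?thesis
  proof cases
    case 1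
    then have "rotation_functions a (\<lambda>s. s) (\<lambda>s. s\<^sup>2 / 2)"
      by (auto simp: rotation_functions_def power2_eq_square algebra_simps intro!: derivative_eq_intros)
    then show ?thesis by blast
  next
    case 2
    have sc: "(sin x)\<^sup>2 = 1 - (cos x)\<^sup>2" for x :: real by (simp add: sin_squared_eq)
    have "rotation_functions a (\<lambda>s. sin (w * s) / w) (\<lambda>s. (1 - cos (w * s)) / w\<^sup>2)"
      unfolding rotation_functions_def
      using 2 
      by (auto simp: field_simps power2_eq_square sin_add cos_add sc[unfolded power2_eq_square] intro!: derivative_eq_intros)
    then show ?thesis by blast
  next
    case 3
    have sc: "(sinh x)\<^sup>2 = (cosh x)\<^sup>2 - 1" for x :: real by (simp add: cosh_square_eq)
    have "rotation_functions a (\<lambda>s. sinh (w * s) / w) (\<lambda>s. (cosh (w * s) - 1) / w\<^sup>2)"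
      unfolding rotation_functions_def
      using 3
      by (auto simp: field_simps power2_eq_square sinh_add cosh_add sc[unfolded power2_eq_square] intro!: derivative_eq_intros)
    then show ?thesis by blast
  qed
qed

definition rotation_exp where
  "rotation_exp S C p q s = id_blinfun + S s *\<^sub>R plane_rotation p q + C s *\<^sub>R (plane_rotation p q o\<^sub>L plane_rotation p q)"
  for S C :: "real \<Rightarrow> real"

lemma blinfun_compose_distrib:
  "(A + B) o\<^sub>L C = (A o\<^sub>L C) + (B o\<^sub>L C)" "A o\<^sub>L (B + C) = (A o\<^sub>L B) + (A o\<^sub>L C)"
  "(x *\<^sub>R A) o\<^sub>L C = x *\<^sub>R (A o\<^sub>L C)" "A o\<^sub>L (x *\<^sub>R C) = x *\<^sub>R (A o\<^sub>L C)"
  "A o\<^sub>L id_blinfun = A" "id_blinfun o\<^sub>L A = A" "0 o\<^sub>L A = 0" "A o\<^sub>L 0 = 0"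
  by (auto intro!: blinfun_eqI simp: blinfun.add_left blinfun.add_right blinfun.scaleR_left blinfun.scaleR_right)

lemma blinfun_compose_assoc: "(A o\<^sub>L B) o\<^sub>L C = A o\<^sub>L (B o\<^sub>L C)"
  by (auto intro!: blinfun_eqI)

lemma rotation_exp_add:
  assumes "rotation_functions (form q q) S C" "form p p = 1" "form p q = 0"
  shows "rotation_exp S C p q (s + t) = rotation_exp S C p q s o\<^sub>L rotation_exp S C p q t"
proof -
  define B where "B = plane_rotation p q"
  define a where "a = form q q"
  have c: "B (B (B v)) = - a *\<^sub>R B v" for v
    using arg_cong[OF plane_rotation_cube[OF assms(2,3)], of "\<lambda>L. blinfun_apply L v"]
    by (simp add: B_def a_def blinfun.scaleR_left blinfun.minus_left)
  show ?thesis
  proof (rule blinfun_eqI)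
    fix v
    have e: "S (s + t) = S s + S t - a * (S s * C t + C s * S t)" "C (s + t) = C s + C t + S s * S t - a * C s * C t"
      using assms(1) by (simp_all add: rotation_functions_def a_def)
    show "blinfun_apply (rotation_exp S C p q (s + t)) v = blinfun_apply (rotation_exp S C p q s o\<^sub>L rotation_exp S C p q t) v"
      unfolding rotation_exp_def B_def[symmetric] e
      by (simp add: blinfun.add_left blinfun.scaleR_left blinfun.add_right blinfun.scaleR_right c scaleR_add_left scaleR_add_right
          blinfun.minus_right blinfun.diff_left algebra_simps)
  qed
qed

lemma rotation_exp_isometry:
  assumes "rotation_functions (form q q) S C" "form p p = 1" "form p q = 0"
  shows "form (rotation_exp S C p q s v) (rotation_exp S C p q s w) = form v w"
proof -
  define B where "B = plane_rotation p q"
  define a where "a = form q q"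
  have c: "B (B (B v)) = - a *\<^sub>R B v" for v
    using arg_cong[OF plane_rotation_cube[OF assms(2,3)], of "\<lambda>L. blinfun_apply L v"]
    by (simp add: B_def a_def blinfun.scaleR_left blinfun.minus_left)
  have sk: "form (B u) x = - form u (B x)" for u x
    unfolding B_def by (rule skew_plane_rotation)
  have S2: "S s * S s = 2 * C s - a * (C s * C s)" using assms(1) by (simp add: rotation_functions_def a_def power2_eq_square)
  have "form (rotation_exp S C p q s v) (rotation_exp S C p q s w)
     = form v w + (2 * C s - a * (C s * C s) - S s * S s) * form v (B (B w))"
    unfolding rotation_exp_def B_def[symmetric]
    by (simp add: blinfun.add_left blinfun.scaleR_left form.add_left form.add_right form.scaleR_left form.scaleR_right sk c
      form.minus_right blinfun.scaleR_right blinfun.minus_right algebra_simps)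
  then show ?thesis using S2 by simp
qed

lemma rotation_exp_0: "rotation_functions a S C \<Longrightarrow> rotation_exp S C p q 0 = id_blinfun"
  by (simp add: rotation_exp_def rotation_functions_def)

lemma rotation_functions_smooth:
  assumes "rotation_functions a S C" and l: "bounded_linear l"
  shows "smooth_on (\<lambda>x. S (l x)) UNIV" "smooth_on (\<lambda>x. C (l x)) UNIV"
proof -
  have d: "((\<lambda>x. S (l x)) has_derivative (\<lambda>h. (1 - a * C (l x)) * l h)) (at x)"
    "((\<lambda>x. C (l x)) has_derivative (\<lambda>h. S (l x) * l h)) (at x)" for x
    using assms(1) has_derivative_compose[OF bounded_linear_imp_has_derivative[OF l]]
    unfolding rotation_functions_def has_field_derivative_def by blast+
  have "Ck_on k (\<lambda>x. S (l x)) UNIV \<and> Ck_on k (\<lambda>x. C (l x)) UNIV" for k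
  proof (induction k)
    case 0
    have "continuous_on UNIV (\<lambda>x. S (l x))" "continuous_on UNIV (\<lambda>x. C (l x))"
      using has_derivative_continuous[OF d(1)] has_derivative_continuous[OF d(2)]
      by (auto simp: continuous_on_eq_continuous_at)
    then show ?case by simp
  next
    case (Suc k)
    have "Ck_on k (\<lambda>x. (1 - a * C (l x)) * l v) UNIV" "Ck_on k (\<lambda>x. S (l x) * l v) UNIV" for v
    proof -
      have "Ck_on k (\<lambda>x. 1 + (- a) * C (l x)) UNIV"
        using Suc by (intro Ck_on_add Ck_on_const bounded_linear.Ck_on[OF bounded_linear_mult_right]) auto
      then show "Ck_on k (\<lambda>x. (1 - a * C (l x)) * l v) UNIV"
        using bounded_linear.Ck_on[OF bounded_linear_mult_left open_UNIV, of k "\<lambda>x. 1 + (- a) * C (l x)" "l v"] by simp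
      show "Ck_on k (\<lambda>x. S (l x) * l v) UNIV"
        using bounded_linear.Ck_on[OF bounded_linear_mult_left open_UNIV, of k] Suc by blast
    qed
    then show ?case using Ck_on_SucI[OF open_UNIV d(1)] Ck_on_SucI[OF open_UNIV d(2)] by blast
  qed
  then show "smooth_on (\<lambda>x. S (l x)) UNIV" "smooth_on (\<lambda>x. C (l x)) UNIV" by (simp_all add: smooth_on_def)
qed

lemma rotation_exp_smooth:
  assumes "rotation_functions a S C" "bounded_linear l"
  shows "smooth_on (\<lambda>x. rotation_exp S C p q (l x)) UNIV"
  unfolding rotation_exp_def
  by (intro smooth_on_add smooth_on_const bounded_linear.smooth_on[OF bounded_linear_scaleR_left]
      rotation_functions_smooth[OF assms] open_UNIV)

lemma rotation_exp_derivative: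
  assumes f: "rotation_functions (form q q) S C" "form p p = 1" "form p q = 0"
  shows "(rotation_exp S C p q has_derivative (\<lambda>h. h *\<^sub>R (rotation_exp S C p q s o\<^sub>L plane_rotation p q))) (at s)"
proof -
  define B where "B = plane_rotation p q"
  have S: "(S has_derivative (\<lambda>h. (1 - form q q * C s) * h)) (at s)" and C: "(C has_derivative (\<lambda>h. S s * h)) (at s)"
    using f(1) by (auto simp: rotation_functions_def has_field_derivative_def)
  have "(rotation_exp S C p q has_derivative (\<lambda>h. ((1 - form q q * C s) * h) *\<^sub>R B + (S s * h) *\<^sub>R (B o\<^sub>L B))) (at s)"
    unfolding rotation_exp_def[abs_def] B_def[symmetric] by (auto intro!: derivative_eq_intros S C)
  moreover have "((1 - form q q * C s) * h) *\<^sub>R B + (S s * h) *\<^sub>R (B o\<^sub>L B) = h *\<^sub>R (rotation_exp S C p q s o\<^sub>L B)" for h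
    using plane_rotation_cube[OF f(2,3)]
    by (simp add: rotation_exp_def B_def[symmetric] blinfun_compose_distrib algebra_simps)
  ultimately show ?thesis by (simp add: B_def)
qed

text \<open>
  The time component of the image of a null vector vanishes only if the image does, which an
  invertible map excludes; so it keeps its sign along the path that starts at the identity.
\<close>

lemma lorentz_isometry_path_future:
  fixes E :: "real \<Rightarrow> (real minkowski \<Rightarrow>\<^sub>L real minkowski)"
  assumes iso: "\<And>s v w. form (E s v) (E s w) = form v w"
    and cont: "continuous_on UNIV E" and E0: "E 0 = id_blinfun" and inv: "\<And>s. E (- s) o\<^sub>L E s = id_blinfun"
    and v: "v \<in> forward_light_cone"
  shows "E s v \<in> forward_light_cone"
proof -
  define g where "g t = fst (E t v)" for t
  have null: "form (E t v) (E t v) = 0" for t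
    using iso v by (simp add: forward_light_cone_def)
  have nz: "g t \<noteq> 0" for t
  proof
    assume g0: "g t = 0"
    have "snd (E t v) \<bullet> snd (E t v) = 0"
      using null[of t] g0 by (simp add: g_def lorentz_form_def inner_vec_def)
    then have "E t v = 0" using g0 by (simp add: g_def prod_eq_iff)
    then have "blinfun_apply (E (- t) o\<^sub>L E t) v = 0" by (simp add: blinfun.zero_right)
    then have "v = 0" unfolding inv by simp
    then show False using v by (simp add: forward_light_cone_def)
  qed
  have cg: "continuous_on UNIV g"
    unfolding g_def by (intro continuous_intros cont)
  have conn: "connected (range g)" using connected_continuous_image[OF cg connected_UNIV] .
  have "g 0 > 0" using v by (simp add: g_def E0 forward_light_cone_def)
  have "g s > 0"
  proof (rule ccontr)
    assume "\<not> g s > 0"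
    then have "0 \<in> range g"
      using connectedD_interval[OF conn, of "g s" "g 0" 0] \<open>g 0 > 0\<close> by auto
    then show False using nz by auto
  qed
  then show ?thesis using null by (simp add: forward_light_cone_def g_def)
qed

lemma rotation_exp_lorentz:
  assumes "rotation_functions (form q q) S C" "form p p = 1" "form p q = 0"
  shows "lorentz_transformation (rotation_exp S C p q s)"
proof -
  have "continuous_on UNIV (rotation_exp S C p q)"
    using smooth_on_continuous[OF rotation_exp_smooth[OF assms(1) bounded_linear_ident]] .
  moreover have "rotation_exp S C p q (- t) o\<^sub>L rotation_exp S C p q t = id_blinfun" for t
    using rotation_exp_add[OF assms, of "- t" t] rotation_exp_0[OF assms(1)] by simp
  ultimately show ?thesis
    unfolding lorentz_transformation_def
    using rotation_exp_isometry[OF assms] lorentz_isometry_path_future[of "rotation_exp S C p q"] rotation_exp_0[OF assms(1)]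
    by blast
qed

lemma lorentz_transformation_compose:
  "lorentz_transformation L \<Longrightarrow> lorentz_transformation K \<Longrightarrow> lorentz_transformation (L o\<^sub>L K)"
  by (simp add: lorentz_transformation_def image_subset_iff del: split_paired_All)

locale commuting_rotations =
  fixes p q r s :: "real minkowski"
  assumes pq: "form p p = 1" "form p q = 0" and rs: "form r r = 1" "form r s = 0"
    and orth: "form p r = 0" "form p s = 0" "form q r = 0" "form q s = 0"
begin

lemma orth_sym: "form r p = 0" "form s p = 0" "form r q = 0" "form s q = 0"
  "form q p = 0" "form s r = 0"
  using orth pq rs form_commute by metis+


lemma rotations_annihilate:
  "plane_rotation p q o\<^sub>L plane_rotation r s = 0" "plane_rotation r s o\<^sub>L plane_rotation p q = 0"
  by (auto intro!: blinfun_eqI simp: form.diff_left form.scaleR_left orth orth_sym)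

text \<open>
  The two planes are orthogonal, so each generator annihilates the image of the other. Hence
  the two one-parameter groups commute and their product is a homomorphism on the plane.
\<close>

lemma two_parameter_group_exists:
  obtains \<Phi> where "smooth_on \<Phi> UNIV" "\<And>t. lorentz_transformation (\<Phi> t)" "\<And>t u. \<Phi> (t + u) = \<Phi> t o\<^sub>L \<Phi> u"
    "\<And>t. (\<Phi> has_derivative (\<lambda>h. \<Phi> t o\<^sub>L (fst h *\<^sub>R plane_rotation p q + snd h *\<^sub>R plane_rotation r s))) (at t)"
    "\<Phi> 0 = id_blinfun"
proof -
  define P where "P = plane_rotation p q"
  define R where "R = plane_rotation r s"
  have PR: "P o\<^sub>L R = 0" "R o\<^sub>L P = 0" unfolding P_def R_def by (rule rotations_annihilate)+
  obtain S C where f: "rotation_functions (form q q) S C" using rotation_functions_exist by blast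
  obtain S' C' where f': "rotation_functions (form s s) S' C'" using rotation_functions_exist by blast
  define E where "E = rotation_exp S C p q"
  define E' where "E' = rotation_exp S' C' r s"
  have comm: "E a o\<^sub>L E' b = E' b o\<^sub>L E a" "P o\<^sub>L E' b = E' b o\<^sub>L P" for a b
  proof -
    have PRv: "blinfun_apply P (blinfun_apply R v) = 0" "blinfun_apply R (blinfun_apply P v) = 0" for v
      using arg_cong[OF PR(1), of "\<lambda>L. blinfun_apply L v"] arg_cong[OF PR(2), of "\<lambda>L. blinfun_apply L v"] by simp_all
    have z: "P o\<^sub>L (R o\<^sub>L R) = 0" "(R o\<^sub>L R) o\<^sub>L P = 0" "(P o\<^sub>L P) o\<^sub>L R = 0" "R o\<^sub>L (P o\<^sub>L P) = 0" 
      "(P o\<^sub>L P) o\<^sub>L (R o\<^sub>L R) = 0" "(R o\<^sub>L R) o\<^sub>L (P o\<^sub>L P) = 0"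
      by (auto intro!: blinfun_eqI simp: PRv blinfun.zero_right)
    show "E a o\<^sub>L E' b = E' b o\<^sub>L E a" "P o\<^sub>L E' b = E' b o\<^sub>L P"
      unfolding E_def E'_def rotation_exp_def P_def[symmetric] R_def[symmetric] blinfun_compose_distrib PR z
      by (simp_all add: algebra_simps)
  qed
  define \<Phi> where "\<Phi> t = E (fst t) o\<^sub>L E' (snd t)" for t :: "real \<times> real"
  show ?thesis
  proof (rule that[of \<Phi>])
    show "smooth_on \<Phi> UNIV" unfolding \<Phi>_def[abs_def] E_def E'_def
      by (intro bounded_bilinear.smooth_on[OF bounded_bilinear_blinfun_compose]
          rotation_exp_smooth[OF f] rotation_exp_smooth[OF f'] bounded_linear_fst bounded_linear_snd)
    show "lorentz_transformation (\<Phi> t)" for t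
      unfolding \<Phi>_def E_def E'_def
      by (intro lorentz_transformation_compose rotation_exp_lorentz f f' pq rs)
    show "\<Phi> (t + u) = \<Phi> t o\<^sub>L \<Phi> u" for t u
    proof -
      have "\<Phi> (t + u) = (E (fst t) o\<^sub>L E (fst u)) o\<^sub>L (E' (snd t) o\<^sub>L E' (snd u))"
        unfolding \<Phi>_def E_def E'_def by (simp add: rotation_exp_add[OF f pq] rotation_exp_add[OF f' rs])
      also have "\<dots> = E (fst t) o\<^sub>L (E (fst u) o\<^sub>L E' (snd t)) o\<^sub>L E' (snd u)" by (simp add: blinfun_compose_assoc)
      also have "\<dots> = \<Phi> t o\<^sub>L \<Phi> u" unfolding comm by (simp add: \<Phi>_def blinfun_compose_assoc)
      finally show ?thesis .
    qed
    show "\<Phi> 0 = id_blinfun"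
      by (simp add: \<Phi>_def E_def E'_def rotation_exp_0[OF f] rotation_exp_0[OF f'] blinfun_compose_distrib)
    show "(\<Phi> has_derivative (\<lambda>h. \<Phi> t o\<^sub>L (fst h *\<^sub>R plane_rotation p q + snd h *\<^sub>R plane_rotation r s))) (at t)" for t
    proof -
      have dE: "((\<lambda>t. E (fst t)) has_derivative (\<lambda>h. fst h *\<^sub>R (E (fst t) o\<^sub>L P))) (at t)"
        unfolding E_def P_def
        by (rule has_derivative_compose[OF has_derivative_fst[OF has_derivative_ident] rotation_exp_derivative[OF f pq]])
      have dE': "((\<lambda>t. E' (snd t)) has_derivative (\<lambda>h. snd h *\<^sub>R (E' (snd t) o\<^sub>L R))) (at t)"
        unfolding E'_def R_def
        by (rule has_derivative_compose[OF has_derivative_snd[OF has_derivative_ident] rotation_exp_derivative[OF f' rs]])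
      have "(\<Phi> has_derivative (\<lambda>h. (E (fst t) o\<^sub>L (snd h *\<^sub>R (E' (snd t) o\<^sub>L R))) + ((fst h *\<^sub>R (E (fst t) o\<^sub>L P)) o\<^sub>L E' (snd t)))) (at t)"
        using bounded_bilinear.FDERIV[OF bounded_bilinear_blinfun_compose dE dE']
        unfolding \<Phi>_def[abs_def] .
      moreover have "(E (fst t) o\<^sub>L (snd h *\<^sub>R (E' (snd t) o\<^sub>L R))) + ((fst h *\<^sub>R (E (fst t) o\<^sub>L P)) o\<^sub>L E' (snd t))
         = \<Phi> t o\<^sub>L (fst h *\<^sub>R P + snd h *\<^sub>R R)" for h
        unfolding blinfun_compose_distrib \<Phi>_def blinfun_compose_assoc comm(2) by (simp add: add.commute)
      ultimately show ?thesis unfolding P_def R_def by simp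
    qed
  qed
qed

end

lemma blinfun_apply_has_derivative:
  assumes "(\<Phi> has_derivative \<Phi>') (at t)"
  shows "((\<lambda>s. blinfun_apply (\<Phi> s) v) has_derivative (\<lambda>h. blinfun_apply (\<Phi>' h) v)) (at t)"
  using bounded_linear.has_derivative[OF blinfun.bounded_linear_left assms] .

text \<open>
  The projection of the light cone to the sphere kills only the multiples of the position
  vector, which are null, and by assumption no nonzero tangent vector of the orbit of (1, x)
  is null. The same assumption makes the differential of the group injective.
\<close>

lemma dupin_orbitI:
  fixes \<Phi> :: "real \<times> real \<Rightarrow> (real minkowski \<Rightarrow>\<^sub>L real minkowski)"
  assumes sm: "smooth_on \<Phi> UNIV" and lor: "\<And>t. lorentz_transformation (\<Phi> t)" and hom: "\<And>t u. \<Phi> (t + u) = \<Phi> t o\<^sub>L \<Phi> u"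
    and der: "\<And>t. (\<Phi> has_derivative (\<lambda>h. \<Phi> t o\<^sub>L (fst h *\<^sub>R P + snd h *\<^sub>R R))) (at t)"
    and x: "x \<in> sphere 0 1"
    and tangent: "\<And>a b. form (blinfun_apply (a *\<^sub>R P + b *\<^sub>R R) (1, x)) (blinfun_apply (a *\<^sub>R P + b *\<^sub>R R) (1, x)) = \<mu> * (a\<^sup>2 + b\<^sup>2)"
    and \<mu>: "\<mu> > 0"
  shows "dupin_orbit (range (\<lambda>t. moebius (\<Phi> t) x))"
proof -
  define v :: "real minkowski" where "v = (1, x)"
  have "x \<bullet> x = 1" using x by (simp add: dot_square_norm)
  then have vc: "v \<in> forward_light_cone"
    by (simp add: v_def forward_light_cone_def lorentz_form_def inner_vec_def)
  have iso: "form (\<Phi> t a) (\<Phi> t b) = form a b" for t a b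
    using lor unfolding lorentz_transformation_def by blast
  have nondeg: "h = 0" if "\<Phi> t (blinfun_apply (fst h *\<^sub>R P + snd h *\<^sub>R R) v) = k *\<^sub>R \<Phi> t v" for t h k
  proof -
    define u where "u = blinfun_apply (fst h *\<^sub>R P + snd h *\<^sub>R R) v"
    have "\<mu> * ((fst h)\<^sup>2 + (snd h)\<^sup>2) = form u u" using tangent by (simp add: u_def v_def)
    also have "\<dots> = form (\<Phi> t u) (\<Phi> t u)" by (simp add: iso)
    also have "\<dots> = form (k *\<^sub>R \<Phi> t v) (k *\<^sub>R \<Phi> t v)"
      using that by (simp add: u_def)
    also have "\<dots> = 0" using vc by (simp add: form.scaleR_left form.scaleR_right iso forward_light_cone_def)
    finally have "(fst h)\<^sup>2 + (snd h)\<^sup>2 = 0" using \<mu> by simp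
    then show ?thesis by (simp add: prod_eq_iff sum_power2_eq_zero_iff)
  qed
  have "inj (frechet_derivative \<Phi> (at 0))"
  proof -
    have "frechet_derivative \<Phi> (at 0) = (\<lambda>h. \<Phi> 0 o\<^sub>L (fst h *\<^sub>R P + snd h *\<^sub>R R))"
      by (rule frechet_derivative_at[OF der, symmetric])
    moreover have "linear (frechet_derivative \<Phi> (at 0))"
      using calculation has_derivative_linear[OF der] by simp
    moreover have "h = 0" if "\<Phi> 0 o\<^sub>L (fst h *\<^sub>R P + snd h *\<^sub>R R) = 0" for h
      using nondeg[of 0 h 0] arg_cong[OF that, of "\<lambda>L. blinfun_apply L v"] by simp
    ultimately show ?thesis by (simp add: linear_injective_0)
  qed
  then have "two_parameter_group \<Phi>"
    using sm lor hom by (simp add: two_parameter_group_def)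
  moreover have "inj (fderiv (\<lambda>s. moebius (\<Phi> s) x) t)" for t
  proof -
    define y where "y s = blinfun_apply (\<Phi> s) v" for s
    define dy where "dy h = \<Phi> t (blinfun_apply (fst h *\<^sub>R P + snd h *\<^sub>R R) v)" for h
    have ypos: "fst (y s) > 0" for s
      using lor[of s] vc by (auto simp: y_def lorentz_transformation_def forward_light_cone_def)
    have "(y has_derivative dy) (at t)"
      unfolding y_def dy_def using blinfun_apply_has_derivative[OF der] by simp
    then have d1: "((\<lambda>s. snd (y s)) has_derivative (\<lambda>h. snd (dy h))) (at t)"
      and d2: "((\<lambda>s. inverse (fst (y s))) has_derivative (\<lambda>h. - (inverse (fst (y t)) * fst (dy h) * inverse (fst (y t))))) (at t)"
      using ypos[of t] by (auto intro!: derivative_eq_intros)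
    have m: "(\<lambda>s. moebius (\<Phi> s) x) = (\<lambda>s. inverse (fst (y s)) *\<^sub>R snd (y s))"
      by (auto simp: moebius_def y_def v_def)
    define dm where "dm h = inverse (fst (y t)) *\<^sub>R snd (dy h) + (- (inverse (fst (y t)) * fst (dy h) * inverse (fst (y t)))) *\<^sub>R snd (y t)" for h
    have dm: "((\<lambda>s. moebius (\<Phi> s) x) has_derivative dm) (at t)"
      unfolding m dm_def by (rule has_derivative_scaleR[OF d2 d1])
    have "h = 0" if "dm h = 0" for h
    proof -
      have "fst (y t) *\<^sub>R dm h = 0" using that by simp
      then have "snd (dy h) = (fst (dy h) / fst (y t)) *\<^sub>R snd (y t)"
        using ypos[of t] by (simp add: dm_def algebra_simps divide_inverse)
      then have "dy h = (fst (dy h) / fst (y t)) *\<^sub>R y t"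
        using ypos[of t] by (simp add: prod_eq_iff)
      then show ?thesis using nondeg by (simp add: dy_def y_def)
    qed
    then have "inj dm" by (simp add: linear_injective_0[OF has_derivative_linear[OF dm]])
    then show ?thesis using frechet_derivative_at[OF dm] by simp
  qed
  ultimately show ?thesis unfolding dupin_orbit_def using x by blast
qed

context normalised_lift
begin

lemma XX_pairings:
  assumes z: "z \<in> D"
  shows "form (X z) (XX z) = 0" "form (Y z) (YY z) = 0" "form (X z) (YY z) = 0"
    "form (XX z) (Y z) = 0" "form (XX z) (YY z) = 0"
    "form (XX z) (\<psi> z) = -1" "form (YY z) (\<psi> z) = -1"
proof -
  note sm = smooth_XY smooth_\<psi>
  show "form (X z) (XX z) = 0"
    using real_pair_const_deriv[OF sm(1,1) real_frame(3) z, of 1] form_commute[of "XX z" "X z"]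
    by (simp add: XX_def[symmetric])
  show "form (Y z) (YY z) = 0"
    using real_pair_const_deriv[OF sm(2,2) real_frame(4) z, of \<i>] form_commute[of "YY z" "Y z"]
    by (simp add: YY_def[symmetric])
  have XYY: "form (X x) (YY x) = 0" if "x \<in> D" for x
    using real_pair_const_deriv[OF sm(1,2) real_frame(5) that, of \<i>] cvec_XX_YY(3)[OF that]
    by (simp add: YY_def[symmetric] form.zero_left)
  show "form (X z) (YY z) = 0" by (rule XYY[OF z])
  show "form (XX z) (Y z) = 0"
    using real_pair_const_deriv[OF sm(1,2) real_frame(5) z, of 1] cvec_XX_YY(4)[OF z]
    by (simp add: XX_def[symmetric] form.zero_right)
  show "form (XX z) (YY z) = 0"
    using real_pair_const_deriv[OF sm(1,4) XYY z, of 1] curvature_line_equations(4)[OF z]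
    by (simp add: XX_def[symmetric] form.zero_right)
  show "form (XX z) (\<psi> z) = -1"
    using real_pair_const_deriv[OF sm(1,5) real_pairings(1) z, of 1] real_frame(3)[OF z]
    by (simp add: XX_def[symmetric])
  show "form (YY z) (\<psi> z) = -1"
    using real_pair_const_deriv[OF sm(2,5) real_pairings(2) z, of \<i>] real_frame(4)[OF z]
    by (simp add: YY_def[symmetric])
qed

abbreviation "gen_x z \<equiv> plane_rotation (X z) (XX z)"
abbreviation "gen_y z \<equiv> plane_rotation (Y z) (YY z)"

lemma commuting_generators: "z \<in> D \<Longrightarrow> commuting_rotations (X z) (XX z) (Y z) (YY z)"
  by unfold_locales (simp_all add: XX_pairings real_frame)

lemma generators_lift:
  assumes "z \<in> D"
  shows "blinfun_apply (gen_x z) (\<psi> z) = X z" "blinfun_apply (gen_y z) (\<psi> z) = Y z"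
  using XX_pairings[OF assms] real_pairings[OF assms] form_commute[of "\<psi> z"] by auto

text \<open>
  In the derivative of \<open>\<langle>v,\<psi>_x\<rangle> \<psi>_xx -
  \<langle>v,\<psi>_xx\<rangle> \<psi>_x\<close> the terms with \<open>\<psi>_xx\<close> twice
  cancel, and so do the remaining ones, because \<open>\<psi>_xxx\<close> is a multiple of
  \<open>\<psi>_x\<close>; likewise for y.
\<close>

lemma generators_constant:
  assumes D: "convex D" and z: "z \<in> D" "z' \<in> D"
  shows "gen_x z = gen_x z'" "gen_y z = gen_y z'"
proof -
  have key: "form v (P z) *\<^sub>R Q z - form v (Q z) *\<^sub>R P z = form v (P z') *\<^sub>R Q z' - form v (Q z') *\<^sub>R P z'"
    if P: "smooth_on P D" and Q: "smooth_on Q D"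
      and dP: "\<And>x h. x \<in> D \<Longrightarrow> fderiv P x h = l h *\<^sub>R Q x"
      and dQ: "\<And>x h. x \<in> D \<Longrightarrow> fderiv Q x h = (l h * m x) *\<^sub>R P x" for v P Q l m
  proof -
    define G where "G x = form v (P x) *\<^sub>R Q x - form v (Q x) *\<^sub>R P x" for x
    have "(G has_derivative (\<lambda>h. 0)) (at x within D)" if x: "x \<in> D" for x
    proof -
      have "(G has_derivative (\<lambda>h. (form v (P x) *\<^sub>R fderiv Q x h + form v (fderiv P x h) *\<^sub>R Q x)
        - (form v (Q x) *\<^sub>R fderiv P x h + form v (fderiv Q x h) *\<^sub>R P x))) (at x)"
        unfolding G_def
        by (intro has_derivative_diff has_derivative_scaleR bounded_linear.has_derivative[OF form.bounded_linear_right]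
            smooth_deriv[OF P x] smooth_deriv[OF Q x])
      then have "(G has_derivative (\<lambda>h. 0)) (at x)"
        by (simp add: dP[OF x] dQ[OF x] form.scaleR_right algebra_simps)
      then show ?thesis by (rule has_derivative_at_withinI)
    qed
    then obtain k where "\<And>x. x \<in> D \<Longrightarrow> G x = k" using has_derivative_zero_constant[OF D] by blast
    then have "G z = G z'" using z by simp
    then show ?thesis by (simp add: G_def)
  qed
  have dX: "fderiv X x h = Re h *\<^sub>R XX x" "fderiv XX x h = (Re h * (- 8 - 2 * Re (c x))) *\<^sub>R X x"
   and dY: "fderiv Y x h = Im h *\<^sub>R YY x" "fderiv YY x h = (Im h * (2 * Re (c x) - 8)) *\<^sub>R Y x"
    if x: "x \<in> D" for x h
    unfolding frechet_Re_Im[OF smooth_XY(1) x, of h] frechet_Re_Im[OF smooth_XY(2) x, of h] 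
      frechet_Re_Im[OF smooth_XY(3) x, of h] frechet_Re_Im[OF smooth_XY(4) x, of h]
    using curvature_line_equations[OF x] cvec_XX_YY(3,4)[OF x] by (simp_all add: XX_def[symmetric] YY_def[symmetric])
  show "gen_x z = gen_x z'" "gen_y z = gen_y z'"
    using key[OF smooth_XY(1,3) dX] key[OF smooth_XY(2,4) dY] by (auto intro!: blinfun_eqI)
qed

text \<open>
  The lift and the orbit of the group through one of its values solve the same linear
  equation: transporting \<psi> back by the group gives a function with zero derivative.
\<close>

lemma lift_flow:
  fixes \<Phi> :: "real \<times> real \<Rightarrow> (real minkowski \<Rightarrow>\<^sub>L real minkowski)"
  assumes hom: "\<And>t u. \<Phi> (t + u) = \<Phi> t o\<^sub>L \<Phi> u" and one: "\<Phi> 0 = id_blinfun"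
    and der: "\<And>t. (\<Phi> has_derivative (\<lambda>h. \<Phi> t o\<^sub>L (fst h *\<^sub>R P + snd h *\<^sub>R R))) (at t)"
    and gen: "\<And>z. z \<in> D \<Longrightarrow> gen_x z = P" "\<And>z. z \<in> D \<Longrightarrow> gen_y z = R"
    and D: "convex D" and z: "z \<in> D" "z' \<in> D"
  obtains t where "\<psi> z' = \<Phi> t (\<psi> z)"
proof -
  define l where "l x = (- Re (x - z), - Im (x - z))" for x
  define G where "G x = blinfun_apply (\<Phi> (l x)) (\<psi> x)" for x
  have dl: "(l has_derivative (\<lambda>h. (- Re h, - Im h))) (at x)" for x
    unfolding l_def by (auto intro!: derivative_eq_intros)
  have "(G has_derivative (\<lambda>h. 0)) (at x within D)" if x: "x \<in> D" for x
  proof -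
    have d\<Phi>: "((\<lambda>x. \<Phi> (l x)) has_derivative (\<lambda>h. \<Phi> (l x) o\<^sub>L (fst (- Re h, - Im h) *\<^sub>R P + snd (- Re h, - Im h) *\<^sub>R R))) (at x)"
      by (rule has_derivative_compose[OF dl der])
    have "(G has_derivative (\<lambda>h. blinfun_apply (\<Phi> (l x)) (fderiv \<psi> x h) +
       blinfun_apply (\<Phi> (l x) o\<^sub>L (fst (- Re h, - Im h) *\<^sub>R P + snd (- Re h, - Im h) *\<^sub>R R)) (\<psi> x))) (at x)"
      unfolding G_def by (rule blinfun.FDERIV[OF d\<Phi> smooth_deriv[OF smooth_\<psi> x]])
    moreover have "blinfun_apply (\<Phi> (l x)) (fderiv \<psi> x h) +
       blinfun_apply (\<Phi> (l x) o\<^sub>L (fst (- Re h, - Im h) *\<^sub>R P + snd (- Re h, - Im h) *\<^sub>R R)) (\<psi> x) = 0" for h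
      unfolding frechet_Re_Im[OF smooth_\<psi> x, of h]
      using generators_lift[OF x] unfolding gen[OF x]
      by (simp add: blinfun.add_left blinfun.scaleR_left blinfun.minus_left blinfun.add_right blinfun.diff_left blinfun.diff_right blinfun.minus_right blinfun.scaleR_right)
    ultimately have "(G has_derivative (\<lambda>h. 0)) (at x)" by simp
    then show ?thesis by (rule has_derivative_at_withinI)
  qed
  then obtain k where "\<And>x. x \<in> D \<Longrightarrow> G x = k" using has_derivative_zero_constant[OF D] by blast
  then have "G z' = G z" using z by simp
  also have "G z = \<psi> z" using one by (simp add: G_def l_def zero_prod_def[symmetric])
  finally have e: "blinfun_apply (\<Phi> (l z')) (\<psi> z') = \<psi> z" by (simp add: G_def)
  have "\<Phi> (- l z') o\<^sub>L \<Phi> (l z') = id_blinfun" using hom[of "- l z'" "l z'"] one by simp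
  then have "\<psi> z' = blinfun_apply (\<Phi> (- l z')) (\<psi> z)"
    using e by (metis blinfun_apply_blinfun_compose id_blinfun.rep_eq id_apply)
  then show ?thesis by (rule that)
qed

end

lemma moebius_scale:
  assumes "k \<noteq> 0"
  shows "snd (blinfun_apply L (k *\<^sub>R (1, x))) /\<^sub>R fst (blinfun_apply L (k *\<^sub>R (1, x))) = moebius L x"
  unfolding blinfun.scaleR_right using assms by (simp add: moebius_def)

lemma moebius_compose:
  assumes "lorentz_transformation K" "x \<in> sphere 0 1"
  shows "moebius (L o\<^sub>L K) x = moebius L (moebius K x)"
proof -
  have "x \<bullet> x = 1" using assms(2) by (simp add: dot_square_norm)
  then have "(1, x) \<in> forward_light_cone"
    by (simp add: forward_light_cone_def lorentz_form_def inner_vec_def)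
  then have "blinfun_apply K (1, x) \<in> forward_light_cone" using assms(1) by (auto simp: lorentz_transformation_def)
  then have pos: "fst (blinfun_apply K (1, x)) > 0" by (simp add: forward_light_cone_def)
  then have "blinfun_apply K (1, x) = fst (blinfun_apply K (1, x)) *\<^sub>R (1, moebius K x)"
    by (simp add: moebius_def prod_eq_iff)
  then have "moebius (L o\<^sub>L K) x = snd (blinfun_apply L (fst (blinfun_apply K (1, x)) *\<^sub>R (1, moebius K x))) /\<^sub>R
     fst (blinfun_apply L (fst (blinfun_apply K (1, x)) *\<^sub>R (1, moebius K x)))"
    by (simp only: moebius_def[of "L o\<^sub>L K"] blinfun_apply_blinfun_compose)
  then show ?thesis using moebius_scale pos by simp
qed

section \<open>Change of the holomorphic coordinate\<close>

lemma frechet_compose: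
  assumes "smooth_on u D'" "\<phi> z \<in> D'" "(\<phi> has_field_derivative d) (at z)"
  shows "((\<lambda>x. u (\<phi> x)) has_derivative (\<lambda>h. fderiv u (\<phi> z) (d * h))) (at z)"
  using has_derivative_compose[of \<phi> "(*) d" z UNIV u "fderiv u (\<phi> z)"]
    smooth_deriv[OF assms(1,2)] assms(3)
  by (simp add: has_field_derivative_def)

lemma d_z_compose:
  assumes u: "smooth_on u D'" "\<phi> z \<in> D'" and d: "(\<phi> has_field_derivative d) (at z)"
  shows "d_z (\<lambda>x. u (\<phi> x)) z = cscale d (d_z u (\<phi> z))" "d_zbar (\<lambda>x. u (\<phi> x)) z = cscale (cnj d) (d_zbar u (\<phi> z))"
  unfolding d_z_def d_zbar_def frechet_derivative_at[OF frechet_compose[OF assms], symmetric] frechet_Re_Im[OF u, of "d * 1"] frechet_Re_Im[OF u, of "d * \<i>"]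
  by (auto intro!: minkowski_eqI simp: complex_eq_iff field_simps)

definition light_cone_section :: "(complex \<Rightarrow> real^4) \<Rightarrow> complex \<Rightarrow> complex minkowski" where
  "light_cone_section F z = cvec (1, F z)"

text \<open>
  These properties hold for every lift of a conformal map to the light cone, normalised or
  not.
\<close>

definition isotropic :: "complex set \<Rightarrow> (complex \<Rightarrow> complex minkowski) \<Rightarrow> bool" where
  "isotropic D Y \<longleftrightarrow> smooth_on Y D \<and> (\<forall>z\<in>D. form (Y z) (Y z) = 0 \<and> form (d_z Y z) (d_z Y z) = 0)"

lemma isotropic_pairings:
  assumes "isotropic D Y" "z \<in> D"
  shows "form (d_z Y z) (Y z) = 0" "form (d_zbar Y z) (Y z) = 0" "form (d_z (d_z Y) z) (Y z) = 0"
    "form (d_z (d_z Y) z) (d_z Y z) = 0"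
proof -
  have s: "smooth_on Y D" and yy: "\<And>x. x \<in> D \<Longrightarrow> form (Y x) (Y x) = 0"
    and dd: "\<And>x. x \<in> D \<Longrightarrow> form (d_z Y x) (d_z Y x) = 0" using assms(1) by (auto simp: isotropic_def)
  have 1: "form (d_z Y x) (Y x) = 0" "form (d_zbar Y x) (Y x) = 0" if "x \<in> D" for x
    using pair_const_deriv[OF s s yy that] form_commute[of "Y x" "d_z Y x"] form_commute[of "Y x" "d_zbar Y x"] by auto
  show "form (d_z Y z) (Y z) = 0" "form (d_zbar Y z) (Y z) = 0" using 1 assms(2) by auto
  show "form (d_z (d_z Y) z) (Y z) = 0"
    using pair_const_deriv(1)[OF smooth_on_d_z(1)[OF s] s 1(1) assms(2)] dd[OF assms(2)] by simp
  show "form (d_z (d_z Y) z) (d_z Y z) = 0"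
    using pair_const_deriv(1)[OF smooth_on_d_z(1)[OF s] smooth_on_d_z(1)[OF s] dd assms(2)]
      form_commute[of "d_z Y z" "d_z (d_z Y) z"] by simp
qed

context schwarzian_lift
begin

text \<open>
  For \<psi> = \<lambda> Y with Y = (1, F), all pairings of the terms of
  \<open>\<psi>_zz\<close> vanish except the one of \<open>\<lambda> Y_zz\<close> with itself.
  In contrast to \<psi>, the lift Y does not depend on the coordinate beyond composition with
  it.
\<close>

lemma section_quantities:
  assumes F: "smooth_on F D" and z: "z \<in> D"
  defines "y \<equiv> light_cone_section F"
  shows "isotropic D y" "hopf_sq z = (of_real (fst (\<psi> z)))\<^sup>2 * form (d_z (d_z y) z) (d_z (d_z y) z)"
    "(of_real (fst (\<psi> z)))\<^sup>2 * form (d_z y z) (d_zbar y z) = 1 / 2"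
proof -
  define l where "l x = complex_of_real (fst (\<psi> x))" for x
  have sl: "smooth_on l D" unfolding l_def
    by (rule bounded_linear.smooth_on[OF bounded_linear_of_real bounded_linear.smooth_on[OF bounded_linear_fst smooth_\<psi>]])
  have l0: "l x \<noteq> 0" if "x \<in> D" for x using real_frame(2)[OF that] by (simp add: l_def)
  have sp: "smooth_on (\<lambda>x. (1::real, F x)) D"
  proof -
    have "bounded_linear (\<lambda>y::real^4. (0::real, y))" by (rule bounded_linear_Pair[OF bounded_linear_zero bounded_linear_ident])
    from smooth_on_add[OF smooth_on_const[OF open_D] bounded_linear.smooth_on[OF this F], of "(1, 0)"]
    show ?thesis by simp
  qed
  have sY: "smooth_on y D"
    unfolding y_def light_cone_section_def[abs_def] by (rule bounded_linear.smooth_on[OF bounded_linear_cvec sp])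
  have \<Psi>Y: "\<Psi> x = cscale (l x) (y x)" if "x \<in> D" for x
    using arg_cong[OF lift_eq[OF that], of cvec] unfolding \<Psi>_def l_def y_def light_cone_section_def
    by (auto intro!: minkowski_eqI simp: cvec_def)
  have ZY: "Z x = cscale (wirt l x) (y x) + cscale (l x) (d_z y x)"
    "B x = cscale (wirt_bar l x) (y x) + cscale (l x) (d_zbar y x)" if x: "x \<in> D" for x
    using d_z_cong_open[OF open_D x \<Psi>Y] d_z_cscale[OF smooth_deriv[OF sl x] smooth_deriv[OF sY x]] by auto
  have YY: "form (y x) (y x) = 0" if x: "x \<in> D" for x
    using pairings(1)[OF x] l0[OF x] unfolding \<Psi>Y[OF x] by simp
  have dYY: "form (d_z y x) (y x) = 0" "form (d_zbar y x) (y x) = 0" if "x \<in> D" for x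
    using pair_const_deriv[OF sY sY YY that] form_commute[of "y x" "d_z y x"] form_commute[of "y x" "d_zbar y x"] by auto
  have dd: "form (d_z y x) (d_z y x) = 0" if x: "x \<in> D" for x
    using pairings(2)[OF x] l0[OF x] unfolding ZY[OF x] cform.add_left cform.add_right cform_scale
    using YY[OF x] dYY[OF x] form_commute[of "y x" "d_z y x"] by simp
  show iso: "isotropic D y" using sY YY dd by (simp add: isotropic_def)
  note ip = isotropic_pairings[OF iso z]
  have "l z * (l z * form (d_z y z) (d_zbar y z)) = 1/2"
    using pairings(3)[OF z] unfolding ZY[OF z] cform.add_left cform.add_right cform_scale
    using YY[OF z] dYY[OF z] form_commute[of "y z" "d_zbar y z"] by (simp add: algebra_simps)
  then show "(of_real (fst (\<psi> z)))\<^sup>2 * form (d_z y z) (d_zbar y z) = 1 / 2"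
    by (simp add: l_def power2_eq_square algebra_simps)
  have sl': "smooth_on (wirt l) D" using smooth_on_wirt[OF sl] by simp
  have s1: "smooth_on (\<lambda>x. cscale (wirt l x) (y x)) D" "smooth_on (\<lambda>x. cscale (l x) (d_z y x)) D"
    by (rule cscale.smooth_on[OF sl' sY] cscale.smooth_on[OF sl smooth_on_d_z(1)[OF sY]])+
  have "ZZ z = d_z (\<lambda>x. cscale (wirt l x) (y x) + cscale (l x) (d_z y x)) z"
    by (rule d_z_cong_open(1)[OF open_D z ZY(1)])
  also have "\<dots> = cscale (wirt (wirt l) z) (y z) + cscale (wirt l z) (d_z y z) + (cscale (wirt l z) (d_z y z) + cscale (l z) (d_z (d_z y) z))"
    unfolding d_z_add(1)[OF s1 z] d_z_cscale(1)[OF smooth_deriv[OF sl' z] smooth_deriv[OF sY z]]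
      d_z_cscale(1)[OF smooth_deriv[OF sl z] smooth_deriv[OF smooth_on_d_z(1)[OF sY] z]] ..
  finally have ZZ: "ZZ z = cscale (wirt (wirt l) z) (y z) + cscale (wirt l z) (d_z y z) + (cscale (wirt l z) (d_z y z) + cscale (l z) (d_z (d_z y) z))" .
  have "hopf_sq z = l z * (l z * form (d_z (d_z y) z) (d_z (d_z y) z))"
    unfolding hopf_sq_def ZZ cform.add_left cform.add_right cform_scale
    using YY[OF z] dd[OF z] ip form_commute[of "y z" "d_z y z"] form_commute[of "y z" "d_z (d_z y) z"]
      form_commute[of "d_z y z" "d_z (d_z y) z"] by simp
  then show "hopf_sq z = (of_real (fst (\<psi> z)))\<^sup>2 * form (d_z (d_z y) z) (d_z (d_z y) z)"
    by (simp add: l_def power2_eq_square algebra_simps)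
qed

end

text \<open>
  For Y = Y' \<circ> \<phi> the second derivative is \<open>Y_zz = \<phi>'^2 Y'_ww + \<phi>''
  Y'_w\<close>, and the second term is null and orthogonal to the first. So
  \<open>\<langle>Y_zz,Y_zz\<rangle> = \<phi>'^4 \<langle>Y'_ww,Y'_ww\<rangle>\<close>, and
  the normalisation of the lifts accounts for the factors |\<phi>'|.
\<close>

lemma coordinate_change:
  assumes L: "schwarzian_lift D F \<psi> c" "smooth_on F D" and L': "schwarzian_lift D' F' \<psi>' c'" "smooth_on F' D'"
    and W: "open W" "W \<subseteq> D" "\<phi> ` W \<subseteq> D'" and \<phi>: "\<phi> holomorphic_on W" "\<And>x. x \<in> W \<Longrightarrow> F x = F' (\<phi> x)"
    and z: "z \<in> W"
  shows "fst (\<psi> z) * cmod (deriv \<phi> z) = fst (\<psi>' (\<phi> z))"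
    "schwarzian_lift.quartic \<psi> z = deriv \<phi> z ^ 4 * schwarzian_lift.quartic \<psi>' (\<phi> z)"
proof -
  interpret A: schwarzian_lift D F \<psi> c by (rule L(1))
  interpret A': schwarzian_lift D' F' \<psi>' c' by (rule L'(1))
  define Y where "Y = light_cone_section F"
  define Y' where "Y' = light_cone_section F'"
  have zD: "z \<in> D" and zD': "\<phi> z \<in> D'" using z W by auto
  note sq = A.section_quantities[OF L(2) zD, folded Y_def]
  note sq' = A'.section_quantities[OF L'(2) zD', folded Y'_def]
  note ip = isotropic_pairings[OF sq'(1) zD']
  have i0: "form (d_z Y' (\<phi> z)) (d_z Y' (\<phi> z)) = 0" and sY': "smooth_on Y' D'" using sq'(1) zD' by (auto simp: isotropic_def)
  have YY': "Y x = Y' (\<phi> x)" if "x \<in> W" for x using \<phi>(2)[OF that] by (simp add: Y_def Y'_def light_cone_section_def)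
  have d\<phi>: "(\<phi> has_field_derivative deriv \<phi> x) (at x)" if "x \<in> W" for x by (rule holomorphic_derivI[OF \<phi>(1) W(1) that])
  have dY: "d_z Y x = cscale (deriv \<phi> x) (d_z Y' (\<phi> x))" "d_zbar Y x = cscale (cnj (deriv \<phi> x)) (d_zbar Y' (\<phi> x))" if x: "x \<in> W" for x
    using d_z_cong_open[OF W(1) x YY'] d_z_compose[OF sY' _ d\<phi>[OF x]] W(3) x by auto
  define g where "g = deriv \<phi>"
  have g: "g holomorphic_on W" unfolding g_def by (rule holomorphic_deriv[OF \<phi>(1) W(1)])
  have "d_z (d_z Y) z = d_z (\<lambda>x. cscale (g x) (d_z Y' (\<phi> x))) z"
    unfolding g_def by (rule d_z_cong_open(1)[OF W(1) z dY(1)])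
  also have "\<dots> = cscale (wirt g z) (d_z Y' (\<phi> z)) + cscale (g z) (cscale (g z) (d_z (d_z Y') (\<phi> z)))"
    unfolding d_z_cscale(1)[OF frechet_holomorphic[OF g W(1) z] frechet_compose[OF smooth_on_d_z(1)[OF sY'] zD' d\<phi>[OF z]]]
    unfolding d_z_compose(1)[OF smooth_on_d_z(1)[OF sY'] zD' d\<phi>[OF z]] unfolding g_def ..
  finally have ddY: "d_z (d_z Y) z = cscale (wirt g z) (d_z Y' (\<phi> z)) + cscale (g z * g z) (d_z (d_z Y') (\<phi> z))" by simp
  have Q: "form (d_z (d_z Y) z) (d_z (d_z Y) z) = g z ^ 4 * form (d_z (d_z Y') (\<phi> z)) (d_z (d_z Y') (\<phi> z))"
    unfolding ddY cform.add_left cform.add_right cform_scale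
    using ip i0 form_commute[of "d_z Y' (\<phi> z)" "d_z (d_z Y') (\<phi> z)"] by (simp add: power4_eq_xxxx algebra_simps)
  define l l' where "l = fst (\<psi> z)" and "l' = fst (\<psi>' (\<phi> z))"
  have pos: "l > 0" "l' > 0" using A.real_frame(2)[OF zD] A'.real_frame(2)[OF zD'] by (auto simp: l_def l'_def)
  define e where "e = form (d_z Y' (\<phi> z)) (d_zbar Y' (\<phi> z))"
  have "form (d_z Y z) (d_zbar Y z) = of_real ((cmod (g z))\<^sup>2) * e"
    unfolding dY[OF z] using complex_norm_square[of "g z"] by (simp add: g_def e_def)
  then have e1: "(of_real l)\<^sup>2 * (of_real ((cmod (g z))\<^sup>2) * e) = 1 / 2" and e2: "(of_real l')\<^sup>2 * e = 1/2"
    using sq(3) sq'(3) by (simp_all add: l_def l'_def e_def)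
  then have "e \<noteq> 0" by auto
  have "of_real ((l * cmod (g z))\<^sup>2) * e = 1 / 2"
    using e1 by (simp only: power_mult_distrib of_real_mult of_real_power mult.assoc)
  also have "\<dots> = of_real (l'\<^sup>2) * e" using e2 by (simp only: of_real_power)
  finally have "of_real ((l * cmod (g z))\<^sup>2) * e = of_real (l'\<^sup>2) * e" .
  then have "complex_of_real ((l * cmod (g z))\<^sup>2) = of_real (l'\<^sup>2)" using \<open>e \<noteq> 0\<close> by simp
  then have "(l * cmod (g z))\<^sup>2 = l'\<^sup>2" using of_real_eq_iff by blast
  then have ll: "l * cmod (g z) = l'" using pos by (simp add: power2_eq_iff_nonneg)
  then show "fst (\<psi> z) * cmod (deriv \<phi> z) = fst (\<psi>' (\<phi> z))" by (simp add: l_def l'_def g_def)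
  define q where "q = form (d_z (d_z Y') (\<phi> z)) (d_z (d_z Y') (\<phi> z))"
  have h: "A.hopf_sq z = (of_real l)\<^sup>2 * (g z ^ 4 * q)" "A'.hopf_sq (\<phi> z) = (of_real l')\<^sup>2 * q"
    using sq(2) sq'(2) by (simp_all add: l_def l'_def Q q_def)
  have qq: "A.quartic z = A.hopf_sq z * of_real (cmod (A.hopf_sq z))" "A'.quartic (\<phi> z) = A'.hopf_sq (\<phi> z) * of_real (cmod (A'.hopf_sq (\<phi> z)))"
    using A.quartic_derivs(1)[OF zD] A'.quartic_derivs(1)[OF zD'] by (simp_all add: A.quartic_def A'.quartic_def)
  have "A.quartic z = g z ^ 4 * A'.quartic (\<phi> z)"
    unfolding qq h ll[symmetric] by (simp add: norm_mult norm_power power_mult_distrib power2_eq_square power4_eq_xxxx mult_ac)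
  then show "A.quartic z = deriv \<phi> z ^ 4 * A'.quartic (\<phi> z)" by (simp add: g_def)
qed

section \<open>Holomorphic coordinates\<close>

lemma complex_chartD:
  assumes "complex_chart X (U, z)"
  shows "openin X U" "open (z ` U)" "inj_on z U" "W \<subseteq> U \<Longrightarrow> openin X W \<longleftrightarrow> open (z ` W)"
proof -
  show o: "openin X U" and oz: "open (z ` U)" using assms by (simp_all add: complex_chart_def)
  have h: "homeomorphic_map (subtopology X U) (top_of_set (z ` U)) z" using assms by (simp add: complex_chart_def)
  have t: "topspace (subtopology X U) = U" using openin_subset[OF o] by (simp add: topspace_subtopology Int_absorb1)
  show "inj_on z U" using homeomorphic_imp_injective_map[OF h] t by simp
  show "openin X W \<longleftrightarrow> open (z ` W)" if "W \<subseteq> U"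
    using homeomorphic_map_openness_eq[OF h, of W] that openin_subset[OF o] image_mono[OF that, of z]
    by (auto simp: t openin_open_subtopology[OF o] openin_open_eq[OF oz])
qed

lemma complex_chart_compose:
  assumes c: "complex_chart X (U, z)" and V: "V \<subseteq> U" "openin X V" and g: "g holomorphic_on z ` V" "inj_on g (z ` V)"
  shows "complex_chart X (V, g \<circ> z)"
proof -
  note cd = complex_chartD[OF c]
  have oV: "open (z ` V)" using cd(4)[OF V(1)] V(2) by simp
  have h: "homeomorphic_map (subtopology X U) (top_of_set (z ` U)) z" using c by (simp add: complex_chart_def)
  have "homeomorphic_map (subtopology (subtopology X U) V) (subtopology (top_of_set (z ` U)) (z ` V)) z"
    using V(1) openin_subset[OF cd(1)] by (intro homeomorphic_map_subtopologies[OF h]) (auto simp: topspace_subtopology)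
  moreover have "U \<inter> V = V" "z ` U \<inter> z ` V = z ` V" using V(1) by auto
  ultimately have h1: "homeomorphic_map (subtopology X V) (top_of_set (z ` V)) z"
    by (simp add: subtopology_subtopology)
  have h2: "homeomorphic_map (top_of_set (z ` V)) (top_of_set (g ` z ` V)) g"
  proof (rule bijective_open_imp_homeomorphic_map)
    show "continuous_map (top_of_set (z ` V)) (top_of_set (g ` z ` V)) g"
      using holomorphic_on_imp_continuous_on[OF g(1)] by auto
    have og: "open (g ` z ` V)" by (rule open_mapping_thm3[OF g(1) oV g(2)])
    show "open_map (top_of_set (z ` V)) (top_of_set (g ` z ` V)) g"
      unfolding open_map_def
    proof (intro allI impI)
      fix W assume "openin (top_of_set (z ` V)) W"
      then have W: "open W" "W \<subseteq> z ` V" using openin_open_eq[OF oV] by auto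
      have "open (g ` W)"
        by (rule open_mapping_thm3[OF holomorphic_on_subset[OF g(1) W(2)] W(1) inj_on_subset[OF g(2) W(2)]])
      then show "openin (top_of_set (g ` z ` V)) (g ` W)" using W(2) openin_open_eq[OF og] by auto
    qed
  qed (use g(2) in auto)
  have "open ((g \<circ> z) ` V)" using open_mapping_thm3[OF g(1) oV g(2)] by (simp add: image_comp)
  then show ?thesis
    using homeomorphic_map_compose[OF h1 h2] V(2) by (simp add: complex_chart_def image_comp)
qed

lemma coordinate_compose:
  assumes rs: "riemann_surface X A" and c: "holomorphic_coordinate X A U z" and V: "V \<subseteq> U" "openin X V" and g: "g holomorphic_on z ` V" "inj_on g (z ` V)"
  shows "holomorphic_coordinate X A V (g \<circ> z)"
  unfolding holomorphic_coordinate_def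
proof (intro conjI ballI)
  have cc: "complex_chart X (U, z)" using c by (simp add: holomorphic_coordinate_def)
  note cd = complex_chartD[OF cc]
  have oV: "open (z ` V)" using cd(4)[OF V(1)] V(2) by simp
  show "complex_chart X (V, g \<circ> z)" by (rule complex_chart_compose[OF cc V g])
  fix a assume a: "a \<in> A"
  obtain Ua za where aa: "a = (Ua, za)" by (cases a)
  have t1: "(z \<circ> inv_into Ua za) holomorphic_on za ` (Ua \<inter> U)" and t2: "(za \<circ> inv_into U z) holomorphic_on z ` (U \<inter> Ua)"
    using c a by (auto simp: holomorphic_coordinate_def holomorphic_transition_def aa)
  show "holomorphic_transition a (V, g \<circ> z)"
  proof -
    have inj: "inj_on za Ua" using rs a complex_chartD(3)[of X Ua za] by (auto simp: riemann_surface_def aa)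
    have "(g \<circ> (z \<circ> inv_into Ua za)) holomorphic_on za ` (Ua \<inter> V)"
    proof (rule holomorphic_on_compose_gen[OF _ g(1)])
      show "(z \<circ> inv_into Ua za) holomorphic_on za ` (Ua \<inter> V)"
        by (rule holomorphic_on_subset[OF t1]) (use V(1) in auto)
      show "(z \<circ> inv_into Ua za) ` za ` (Ua \<inter> V) \<subseteq> z ` V" using inj by auto
    qed
    then show ?thesis by (simp add: holomorphic_transition_def aa comp_assoc)
  qed
  obtain k where k: "k holomorphic_on g ` z ` V" "\<And>x. x \<in> z ` V \<Longrightarrow> k (g x) = x"
    using holomorphic_has_inverse[OF g(1) oV g(2)] by metis
  have "((za \<circ> inv_into U z) \<circ> k) holomorphic_on (g \<circ> z) ` (V \<inter> Ua)"
  proof (rule holomorphic_on_compose_gen[OF _ t2])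
    show "k holomorphic_on (g \<circ> z) ` (V \<inter> Ua)" by (rule holomorphic_on_subset[OF k(1)]) auto
    show "k ` (g \<circ> z) ` (V \<inter> Ua) \<subseteq> z ` (U \<inter> Ua)" using k(2) V(1) by auto
  qed
  moreover have "((za \<circ> inv_into U z) \<circ> k) y = (za \<circ> inv_into V (g \<circ> z)) y" if "y \<in> (g \<circ> z) ` (V \<inter> Ua)" for y
  proof -
    obtain p where p: "p \<in> V" "y = g (z p)" using \<open>y \<in> _\<close> by auto
    have i: "inj_on (g \<circ> z) V" by (rule comp_inj_on[OF inj_on_subset[OF cd(3) V(1)] g(2)])
    have "inv_into V (g \<circ> z) y = p" using inv_into_f_f[OF i p(1)] p(2) by simp
    moreover have "inv_into U z (k y) = p" using k(2) p V(1) inv_into_f_f[OF cd(3), of p] by auto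
    ultimately show ?thesis by simp
  qed
  ultimately show "holomorphic_transition (V, g \<circ> z) a"
    unfolding holomorphic_transition_def aa case_prod_conv by (rule holomorphic_transform)
qed


text \<open>
  Near each point the transition factors through a chart of the atlas, with which both
  coordinates are compatible.
\<close>

lemma coordinate_transition:
  assumes rs: "riemann_surface X A" and c: "holomorphic_coordinate X A U z" and c': "holomorphic_coordinate X A V w"
  shows "(w \<circ> inv_into U z) holomorphic_on z ` (U \<inter> V)"
proof -
  have cd: "complex_chart X (U, z)" "complex_chart X (V, w)" using c c' by (simp_all add: holomorphic_coordinate_def)
  note U = complex_chartD[OF cd(1)] and V = complex_chartD[OF cd(2)]
  define S where "S a = z ` (U \<inter> V \<inter> fst a)" for a :: "'a set \<times> ('a \<Rightarrow> complex)"
  have "(w \<circ> inv_into U z) holomorphic_on (\<Union>a\<in>A. S a)"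
  proof (rule holomorphic_on_UN_open)
    fix a assume a: "a \<in> A"
    obtain Ua za where aa: "a = (Ua, za)" by (cases a)
    have ca: "complex_chart X (Ua, za)" using rs a by (auto simp: riemann_surface_def aa)
    note Ua = complex_chartD[OF ca]
    have "openin X (U \<inter> V \<inter> Ua)" using U(1) V(1) Ua(1) by auto
    then show "open (S a)" using U(4)[of "U \<inter> V \<inter> Ua"] by (auto simp: S_def aa)
    have t1: "(za \<circ> inv_into U z) holomorphic_on z ` (U \<inter> Ua)" and t2: "(w \<circ> inv_into Ua za) holomorphic_on za ` (Ua \<inter> V)"
      using c c' a by (auto simp: holomorphic_coordinate_def holomorphic_transition_def aa)
    have "((w \<circ> inv_into Ua za) \<circ> (za \<circ> inv_into U z)) holomorphic_on S a"
    proof (rule holomorphic_on_compose_gen[OF _ t2])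
      show "(za \<circ> inv_into U z) holomorphic_on S a" by (rule holomorphic_on_subset[OF t1]) (auto simp: S_def aa)
      show "(za \<circ> inv_into U z) ` S a \<subseteq> za ` (Ua \<inter> V)" using U(3) by (auto simp: S_def aa)
    qed
    moreover have "((w \<circ> inv_into Ua za) \<circ> (za \<circ> inv_into U z)) y = (w \<circ> inv_into U z) y" if "y \<in> S a" for y
      using that U(3) Ua(3) by (auto simp: S_def aa)
    ultimately show "(w \<circ> inv_into U z) holomorphic_on S a"
      using holomorphic_cong[OF refl, of "S a" "(w \<circ> inv_into Ua za) \<circ> (za \<circ> inv_into U z)" "w \<circ> inv_into U z"] by blast
  qed
  moreover have "z ` (U \<inter> V) \<subseteq> (\<Union>a\<in>A. S a)"
  proof
    fix y assume "y \<in> z ` (U \<inter> V)"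
    then obtain p where p: "p \<in> U" "p \<in> V" "y = z p" by auto
    have "p \<in> topspace X" using openin_subset[OF U(1)] p(1) by auto
    then have "p \<in> \<Union> (fst ` A)" using rs by (simp add: riemann_surface_def)
    then obtain a where "a \<in> A" "p \<in> fst a" by blast
    then show "y \<in> (\<Union>a\<in>A. S a)" using p by (auto simp: S_def)
  qed
  ultimately show ?thesis using holomorphic_on_subset by blast
qed

lemma atlas_coordinate:
  assumes "riemann_surface X A" "p \<in> topspace X"
  obtains U z where "holomorphic_coordinate X A U z" "p \<in> U"
proof -
  have "p \<in> \<Union> (fst ` A)" using assms by (simp add: riemann_surface_def)
  then obtain U z where "(U, z) \<in> A" "p \<in> U" by force
  then show ?thesis using that[of U z] assms(1) by (auto simp: riemann_surface_def holomorphic_coordinate_def)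
qed

lemma ball_coordinate:
  assumes rs: "riemann_surface X A" and c: "holomorphic_coordinate X A U z" and p: "p \<in> U" and S: "open S" "z p \<in> S"
  obtains V e where "V \<subseteq> U" "p \<in> V" "holomorphic_coordinate X A V z" "e > 0" "z ` V = ball (z p) e" "ball (z p) e \<subseteq> S"
proof -
  have cd: "complex_chart X (U, z)" using c by (simp add: holomorphic_coordinate_def)
  note U = complex_chartD[OF cd]
  have "open (S \<inter> z ` U)" "z p \<in> S \<inter> z ` U" using S U(2) p by auto
  then obtain e where e: "e > 0" "ball (z p) e \<subseteq> S \<inter> z ` U" using open_contains_ball by blast
  define V where "V = {q \<in> U. z q \<in> ball (z p) e}"
  have V: "V \<subseteq> U" "p \<in> V" using p e(1) by (auto simp: V_def)
  have zV: "z ` V = ball (z p) e" using e(2) by (force simp: V_def)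
  then have "openin X V" using U(4)[OF V(1)] by simp
  then have "holomorphic_coordinate X A V ((\<lambda>x. x) \<circ> z)"
    by (intro coordinate_compose[OF rs c V(1)] holomorphic_intros) (auto simp: inj_on_def)
  then have "holomorphic_coordinate X A V z" by (simp add: comp_def)
  then show ?thesis using that[OF V _ e(1) zV] e(2) by auto
qed

lemma clopen_induct:
  assumes "connected_space X" "p0 \<in> topspace X" "P p0"
    and "\<And>q. q \<in> topspace X \<Longrightarrow> \<exists>V. openin X V \<and> q \<in> V \<and> ((\<exists>p\<in>V. P p) \<longrightarrow> (\<forall>p\<in>V. P p))"
    and "p \<in> topspace X"
  shows "P p"
proof -
  define T where "T b = {q \<in> topspace X. P q = b}" for b
  have "openin X (T b)" for b
  proof (subst openin_subopen, intro ballI)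
    fix q assume q: "q \<in> T b"
    then obtain V where "openin X V" "q \<in> V" "(\<exists>p\<in>V. P p) \<longrightarrow> (\<forall>p\<in>V. P p)" using assms(4)[of q] by (auto simp: T_def)
    then show "\<exists>V. openin X V \<and> q \<in> V \<and> V \<subseteq> T b"
      using q openin_subset[of X V] by (intro exI[of _ V]) (auto simp: T_def)
  qed
  moreover have "T True \<union> T False = topspace X" "T True \<inter> T False = {}" by (auto simp: T_def)
  ultimately have "T True = {} \<or> T False = {}" using assms(1) unfolding connected_space_eq by blast
  then show ?thesis using assms(2,3,5) by (auto simp: T_def)
qed

section \<open>Surfaces with holomorphic Schwarzian derivative\<close>

locale holomorphic_schwarzian_surface =
  fixes X :: "'m topology" and A :: "('m set \<times> ('m \<Rightarrow> complex)) set" and f :: "'m \<Rightarrow> real^4"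
  assumes surface: "riemann_surface X A" and immersion: "conformal_immersion X A f"
    and holomorphic: "holomorphic_schwarzian X A f"
begin

abbreviation "coord \<equiv> holomorphic_coordinate X A"
abbreviation "local_map U z \<equiv> f \<circ> inv_into U z"

text \<open>
  Holomorphy of the Schwarzian provides some lift in each coordinate; one is chosen so that
  the quartic coefficient becomes a function of the coordinate.
\<close>

definition local_lift :: "'m set \<Rightarrow> ('m \<Rightarrow> complex) \<Rightarrow> complex \<Rightarrow> real minkowski" where
  "local_lift U z = (SOME \<psi>. \<exists>c. schwarzian_lift (z ` U) (local_map U z) \<psi> c)"

definition local_quartic :: "'m set \<Rightarrow> ('m \<Rightarrow> complex) \<Rightarrow> complex \<Rightarrow> complex" where
  "local_quartic U z = schwarzian_lift.quartic (local_lift U z)"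

lemma local_lift:
  assumes "coord U z"
  obtains c where "schwarzian_lift (z ` U) (local_map U z) (local_lift U z) c"
proof -
  obtain c \<psi> where "normalized_lift (z ` U) (local_map U z) \<psi>"
     "\<forall>\<zeta>\<in>z ` U. d_z (d_z (cvec \<circ> \<psi>)) \<zeta> + cscale (c \<zeta> / 2) (cvec (\<psi> \<zeta>)) \<in> complexify (lorentz_perp (V_fibre \<psi> \<zeta>))"
     "c holomorphic_on z ` U"
    using holomorphic assms unfolding holomorphic_schwarzian_def is_schwarzian_def by meson
  then have "schwarzian_lift (z ` U) (local_map U z) \<psi> c" by unfold_locales auto
  then have "\<exists>c. schwarzian_lift (z ` U) (local_map U z) (local_lift U z) c"
    unfolding local_lift_def by (intro someI[of "\<lambda>\<psi>. \<exists>c. schwarzian_lift (z ` U) (local_map U z) \<psi> c" \<psi>]) blast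
  then show ?thesis using that by blast
qed

lemma local_map_smooth: "coord U z \<Longrightarrow> smooth_on (local_map U z) (z ` U)"
  using immersion by (auto simp: conformal_immersion_def)

lemma coordD:
  assumes "coord U z"
  shows "openin X U" "open (z ` U)" "inj_on z U" "\<And>W. W \<subseteq> U \<Longrightarrow> openin X W \<longleftrightarrow> open (z ` W)"
  using complex_chartD[of X U z] assms by (auto simp: holomorphic_coordinate_def)

lemma local_map_eq: "coord U z \<Longrightarrow> p \<in> U \<Longrightarrow> local_map U z (z p) = f p"
  using coordD(3) by simp

lemma f_sphere: "p \<in> topspace X \<Longrightarrow> f p \<in> sphere 0 1"
  using immersion by (auto simp: conformal_immersion_def)

abbreviation (input) "change U z w \<equiv> w \<circ> inv_into U z"

context
  fixes U z V w
  assumes c: "coord U z" and c': "coord V w"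
begin

lemma trans_holomorphic: "(change U z w) holomorphic_on z ` (U \<inter> V)"
  by (rule coordinate_transition[OF surface c c'])

lemma trans_open: "open (z ` (U \<inter> V))"
  using coordD(4)[OF c, of "U \<inter> V"] coordD(1)[OF c] coordD(1)[OF c'] by auto

lemma trans_apply: "p \<in> U \<Longrightarrow> change U z w (z p) = w p"
  using coordD(3)[OF c] by simp

lemma trans_deriv_nonzero:
  assumes "p \<in> U \<inter> V"
  shows "deriv (change U z w) (z p) \<noteq> 0"
proof (rule holomorphic_injective_imp_regular[OF trans_holomorphic trans_open])
  show "inj_on (change U z w) (z ` (U \<inter> V))"
    using coordD(3)[OF c] coordD(3)[OF c'] by (auto simp: inj_on_def)
qed (use assms in auto)

lemma quartic_transition:
  assumes p: "p \<in> U \<inter> V"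
  shows "local_quartic U z (z p) = deriv (change U z w) (z p) ^ 4 * local_quartic V w (w p)"
    "fst (local_lift U z (z p)) * cmod (deriv (change U z w) (z p)) = fst (local_lift V w (w p))"
proof -
  obtain cU where U: "schwarzian_lift (z ` U) (local_map U z) (local_lift U z) cU" by (rule local_lift[OF c])
  obtain cV where V: "schwarzian_lift (w ` V) (local_map V w) (local_lift V w) cV" by (rule local_lift[OF c'])
  have e: "local_map U z x = local_map V w ((change U z w) x)" if "x \<in> z ` (U \<inter> V)" for x
    using that coordD(3)[OF c] coordD(3)[OF c'] by auto
  have im: "(change U z w) ` z ` (U \<inter> V) \<subseteq> w ` V" using coordD(3)[OF c] by auto
  have im0: "z ` (U \<inter> V) \<subseteq> z ` U" by blast
  have tp: "(change U z w) (z p) = w p" using p trans_apply by auto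
  have "z p \<in> z ` (U \<inter> V)" using p by auto
  from coordinate_change[where \<phi> = "change U z w", OF U local_map_smooth[OF c] V local_map_smooth[OF c'] trans_open im0 im trans_holomorphic e this]
  show "local_quartic U z (z p) = deriv (change U z w) (z p) ^ 4 * local_quartic V w (w p)"
    "fst (local_lift U z (z p)) * cmod (deriv (change U z w) (z p)) = fst (local_lift V w (w p))"
    unfolding local_quartic_def tp by simp_all
qed

lemma quartic_zero_iff: "p \<in> U \<inter> V \<Longrightarrow> local_quartic U z (z p) = 0 \<longleftrightarrow> local_quartic V w (w p) = 0"
  using quartic_transition(1) trans_deriv_nonzero by simp

end

lemma local_quartic_holomorphic: "coord U z \<Longrightarrow> local_quartic U z holomorphic_on z ` U"
  unfolding local_quartic_def by (rule local_lift) (auto intro: schwarzian_lift.quartic_holomorphic)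

lemma disc_coordinate:
  assumes "p \<in> topspace X"
  obtains U z e where "coord U z" "p \<in> U" "z ` U = ball (z p) e" "e > 0"
proof -
  obtain U z where c: "coord U z" and p: "p \<in> U" by (rule atlas_coordinate[OF surface assms])
  obtain V e where "V \<subseteq> U" "p \<in> V" "coord V z" "e > 0" "z ` V = ball (z p) e" "ball (z p) e \<subseteq> UNIV"
    by (rule ball_coordinate[OF surface c p open_UNIV UNIV_I])
  then show ?thesis using that by blast
qed

text \<open>
  By the identity theorem on discs, and because a zero of the quartic differential is never
  isolated, the set of zeros is open and closed.
\<close>

lemma quartic_dichotomy:
  assumes c0: "coord U0 z0" "p0 \<in> U0" "local_quartic U0 z0 (z0 p0) = 0" and c: "coord U z" "p \<in> U"
  shows "local_quartic U z (z p) = 0"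
proof -
  define P where "P p \<longleftrightarrow> (\<exists>U z. coord U z \<and> p \<in> U \<and> local_quartic U z (z p) = 0)" for p
  have "P p"
  proof (rule clopen_induct[where P = P])
    show "connected_space X" using surface by (simp add: riemann_surface_def)
    show "p0 \<in> topspace X" "p \<in> topspace X" using c0 c coordD(1) openin_subset by blast+
    show "P p0" using c0 unfolding P_def by blast
    fix q assume "q \<in> topspace X"
    then obtain V w e where V: "coord V w" "q \<in> V" "w ` V = ball (w q) e" "e > 0" by (rule disc_coordinate)
    have "P p2" if p1: "p1 \<in> V" "P p1" and p2: "p2 \<in> V" for p1 p2
    proof -
      have z1: "local_quartic V w (w p1) = 0" using p1 V(1) quartic_zero_iff unfolding P_def by blast
      obtain cV where L: "schwarzian_lift (w ` V) (local_map V w) (local_lift V w) cV" by (rule local_lift[OF V(1)])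
      interpret L: schwarzian_lift "w ` V" "local_map V w" "local_lift V w" cV by (rule L)
      obtain r where r: "r > 0" "ball (w p1) r \<subseteq> w ` V" "\<And>x. x \<in> ball (w p1) r \<Longrightarrow> L.quartic x = 0"
        using L.quartic_zero_imp_locally_zero[of "w p1"] p1(1) z1 unfolding local_quartic_def by blast
      have "L.quartic (w p2) = 0"
        by (rule analytic_continuation_open[of "ball (w p1) r" "w ` V" L.quartic "\<lambda>_. 0"])
          (use r V p2 L.quartic_holomorphic in auto)
      then show ?thesis using V(1) p2 unfolding P_def local_quartic_def by blast
    qed
    then show "\<exists>V. openin X V \<and> q \<in> V \<and> ((\<exists>p\<in>V. P p) \<longrightarrow> (\<forall>p\<in>V. P p))"
      using V(1,2) coordD(1) by blast
  qed
  then show ?thesis using quartic_zero_iff c unfolding P_def by blast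
qed

end

text \<open>
  For N = (t, n), orthogonality to (1, x) says that n \<bullet> x = t, and N being a unit
  vector says that |t| < |n|.
\<close>

lemma round_2_sphere_of_normal:
  assumes N: "form N N = 1" and f: "\<And>x. x \<in> T \<Longrightarrow> x \<in> sphere 0 1 \<and> form N (1, x) = 0"
  shows "\<exists>S. round_2_sphere S \<and> T \<subseteq> S"
proof -
  define t n where "t = fst N" and "n = snd N"
  have "n \<bullet> n = 1 + t * t" using N by (simp add: lorentz_form_def t_def n_def inner_vec_def)
  then have nn: "(norm n)\<^sup>2 = 1 + t\<^sup>2" by (simp add: power2_norm_eq_inner power2_eq_square[of t])
  then have pos: "norm n > 0" by (metis norm_eq_zero add_pos_nonneg less_irrefl norm_ge_zero order_le_less power_zero_numeral zero_le_power2 zero_less_one)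
  have "\<bar>t\<bar> < norm n" by (rule power2_less_imp_less) (use nn in auto)
  then have d: "\<bar>t / norm n\<bar> < 1" using pos by (simp add: abs_divide)
  define S where "S = {x \<in> sphere 0 1. (n /\<^sub>R norm n) \<bullet> x = t / norm n}"
  have "round_2_sphere S"
    unfolding round_2_sphere_def S_def using d pos by (intro exI[of _ "n /\<^sub>R norm n"] exI[of _ "t / norm n"]) auto
  moreover have "T \<subseteq> S"
  proof
    fix x assume "x \<in> T"
    then have x: "x \<in> sphere 0 1" "n \<bullet> x = t"
      using f[of x] by (auto simp: lorentz_form_def t_def n_def inner_vec_def)
    then show "x \<in> S" by (simp add: S_def divide_inverse)
  qed
  ultimately show ?thesis by blast
qed

context holomorphic_schwarzian_surface
begin

text \<open>
  A unit normal of V at one point stays orthogonal to the lift on a whole disc. If it is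
  orthogonal to the lift on some open set, it is orthogonal to V there, so the property
  spreads over the connected surface.
\<close>

lemma umbilic_in_round_sphere:
  assumes c0: "coord U0 z0" "p0 \<in> U0" and q: "\<And>U z p. coord U z \<Longrightarrow> p \<in> U \<Longrightarrow> local_quartic U z (z p) = 0"
  shows "\<exists>S. round_2_sphere S \<and> f ` topspace X \<subseteq> S"
proof -
  have loc: "N \<in> lorentz_perp (V_fibre (local_lift V w) (w p1)) \<Longrightarrow> form N (1, f p2) = 0"
    if V: "coord V w" "convex (w ` V)" and p: "p1 \<in> V" "p2 \<in> V" for V w p1 p2 N
  proof -
    assume N: "N \<in> lorentz_perp (V_fibre (local_lift V w) (w p1))"
    obtain cV where L: "schwarzian_lift (w ` V) (local_map V w) (local_lift V w) cV" by (rule local_lift[OF V(1)])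
    interpret L: schwarzian_lift "w ` V" "local_map V w" "local_lift V w" cV by (rule L)
    have p2: "w p2 \<in> w ` V" using p by auto
    have "form N (local_lift V w (w p2)) = 0"
      by (rule L.umbilic_perp_propagates[of "w p1"]) (use q V p N in \<open>auto simp: local_quartic_def\<close>)
    moreover have "local_lift V w (w p2) = fst (local_lift V w (w p2)) *\<^sub>R (1, f p2)"
      using L.lift_eq[OF p2] local_map_eq[OF V(1) p(2)] by simp
    ultimately have "fst (local_lift V w (w p2)) * form N (1, f p2) = 0"
      by (metis form.scaleR_right real_scaleR_def)
    then show ?thesis using L.real_frame(2)[OF p2] by simp
  qed
  have p0: "p0 \<in> topspace X" using c0 coordD(1) openin_subset by blast
  obtain U z e where U: "coord U z" "p0 \<in> U" "z ` U = ball (z p0) e" "e > 0" by (rule disc_coordinate[OF p0])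
  obtain cU where L: "schwarzian_lift (z ` U) (local_map U z) (local_lift U z) cU" by (rule local_lift[OF U(1)])
  obtain N where N: "form N N = 1" "N \<in> lorentz_perp (V_fibre (local_lift U z) (z p0))"
    using schwarzian_lift.unit_normal[OF L, of "z p0"] U(2) by blast
  define P where "P p \<longleftrightarrow> (\<exists>W. openin X W \<and> p \<in> W \<and> (\<forall>p'\<in>W. form N (1, f p') = 0))" for p
  have P: "P p" if "p \<in> topspace X" for p
  proof (rule clopen_induct[where P = P, OF _ p0 _ _ that])
    show "connected_space X" using surface by (simp add: riemann_surface_def)
    show "P p0" using loc[OF U(1) _ U(2) _ N(2)] U coordD(1)[OF U(1)] unfolding P_def by auto
    fix q assume "q \<in> topspace X"
    then obtain V w e where V: "coord V w" "q \<in> V" "w ` V = ball (w q) e" "e > 0" by (rule disc_coordinate)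
    have "P p2" if p1: "p1 \<in> V" "P p1" and p2: "p2 \<in> V" for p1 p2
    proof -
      obtain W where W: "openin X W" "p1 \<in> W" "\<And>p'. p' \<in> W \<Longrightarrow> form N (1, f p') = 0" using p1(2) unfolding P_def by blast
      obtain cV where L: "schwarzian_lift (w ` V) (local_map V w) (local_lift V w) cV" by (rule local_lift[OF V(1)])
      interpret L: schwarzian_lift "w ` V" "local_map V w" "local_lift V w" cV by (rule L)
      have "N \<in> lorentz_perp (V_fibre (local_lift V w) (w p1))"
      proof (rule L.locally_perp_imp_perp_V[of "w ` (V \<inter> W)"])
        show "open (w ` (V \<inter> W))" using coordD(4)[OF V(1), of "V \<inter> W"] W(1) coordD(1)[OF V(1)] by auto
        fix x assume "x \<in> w ` (V \<inter> W)"
        then obtain p' where p': "p' \<in> V" "p' \<in> W" "x = w p'" by auto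
        have "local_lift V w x = fst (local_lift V w x) *\<^sub>R (1, f p')"
          using L.lift_eq[of x] local_map_eq[OF V(1) p'(1)] p' by simp
        then show "form N (local_lift V w x) = 0"
          using W(3)[OF p'(2)] by (metis form.scaleR_right mult_zero_right real_scaleR_def)
      qed (use p1 W in auto)
      then have "\<forall>p'\<in>V. form N (1, f p') = 0" using loc[OF V(1) _ p1(1)] V(3) by auto
      then show ?thesis using coordD(1)[OF V(1)] p2 unfolding P_def by blast
    qed
    then show "\<exists>V. openin X V \<and> q \<in> V \<and> ((\<exists>p\<in>V. P p) \<longrightarrow> (\<forall>p\<in>V. P p))"
      using V(1,2) coordD(1) by blast
  qed
  show ?thesis
    by (rule round_2_sphere_of_normal[OF N(1)]) (use P f_sphere in \<open>auto simp: P_def\<close>)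
qed

end

section \<open>Gluing the local symmetry groups\<close>

text \<open>
  For h = 1 and h = \<i> these are the generators of the local symmetry group in the two
  coordinate directions, in terms of the lift alone.
\<close>

definition lift_rotation :: "(complex \<Rightarrow> real minkowski) \<Rightarrow> complex \<Rightarrow> complex \<Rightarrow> (real minkowski \<Rightarrow>\<^sub>L real minkowski)" where
  "lift_rotation \<psi> h \<zeta> = plane_rotation (fderiv \<psi> \<zeta> h)
     (fderiv (\<lambda>x. fderiv \<psi> x h) \<zeta> h)"

lemma (in normalised_lift) lift_rotation_eq:
  "lift_rotation \<psi> 1 \<zeta> = gen_x \<zeta>" "lift_rotation \<psi> \<i> \<zeta> = gen_y \<zeta>"
  by (simp_all add: lift_rotation_def XX_def YY_def)

lemma lift_rotation_translation:
  assumes W: "open W" "\<phi> ` W \<subseteq> D'" and \<psi>': "smooth_on \<psi>' D'" and e: "\<And>x. x \<in> W \<Longrightarrow> \<psi> x = \<psi>' (\<phi> x)"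
    and \<phi>: "\<And>x. x \<in> W \<Longrightarrow> (\<phi> has_field_derivative 1) (at x)" and z: "\<zeta> \<in> W"
  shows "lift_rotation \<psi> h \<zeta> = lift_rotation \<psi>' h (\<phi> \<zeta>)"
proof -
  have 1: "fderiv \<psi> x h = frechet_derivative \<psi>' (at (\<phi> x)) h" if x: "x \<in> W" for x
    using frechet_derivative_cong_open[OF W(1) x e] frechet_derivative_at[OF frechet_compose[OF \<psi>' _ \<phi>[OF x]]] W(2) x
    by (auto simp: fun_eq_iff)
  have "fderiv (\<lambda>x. fderiv \<psi> x h) \<zeta> h = fderiv (\<lambda>x. frechet_derivative \<psi>' (at x) h) (\<phi> \<zeta>) h"
    using frechet_derivative_cong_open[OF W(1) z 1] frechet_derivative_at[OF frechet_compose[OF smooth_on_frechet[OF \<psi>'] _ \<phi>[OF z]]] W(2) z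
    by (auto simp: fun_eq_iff)
  then show ?thesis using 1[OF z] by (simp add: lift_rotation_def)
qed

context holomorphic_schwarzian_surface
begin

definition normalised :: "'m set \<Rightarrow> ('m \<Rightarrow> complex) \<Rightarrow> bool" where
  "normalised U z \<longleftrightarrow> coord U z \<and> convex (z ` U) \<and> (\<forall>p\<in>U. local_quartic U z (z p) = 1)"

lemma normalisedD:
  assumes "normalised U z"
  obtains c where "normalised_lift (z ` U) (local_map U z) (local_lift U z) c"
proof -
  have c: "coord U z" and q: "\<And>p. p \<in> U \<Longrightarrow> local_quartic U z (z p) = 1" using assms by (auto simp: normalised_def)
  obtain c where L: "schwarzian_lift (z ` U) (local_map U z) (local_lift U z) c" by (rule local_lift[OF c])
  have "normalised_lift (z ` U) (local_map U z) (local_lift U z) c"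
    unfolding normalised_lift_def normalised_lift_axioms_def using L q by (auto simp: local_quartic_def)
  then show ?thesis by (rule that)
qed

text \<open>
  If h dz^4 is the quartic differential, a coordinate w with dw^4 = h dz^4 is a primitive of a
  fourth root of h.
\<close>

lemma normalised_coordinate:
  assumes nz: "\<And>U z p. coord U z \<Longrightarrow> p \<in> U \<Longrightarrow> local_quartic U z (z p) \<noteq> 0" and p: "p \<in> topspace X"
  obtains U z where "normalised U z" "p \<in> U"
proof -
  obtain U z e where U: "coord U z" "p \<in> U" "z ` U = ball (z p) e" "e > 0" by (rule disc_coordinate[OF p])
  note cd = coordD[OF U(1)]
  define Q where "Q = local_quartic U z"
  have Q: "Q holomorphic_on ball (z p) e" "\<And>x. x \<in> ball (z p) e \<Longrightarrow> Q x \<noteq> 0"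
    using local_quartic_holomorphic[OF U(1)] nz[OF U(1)] unfolding Q_def U(3)[symmetric] by auto
  obtain l where l: "l holomorphic_on ball (z p) e" "\<And>x. x \<in> ball (z p) e \<Longrightarrow> exp (l x) = Q x"
    using holomorphic_logarithm_exists[OF convex_ball open_ball Q, of "z p"] U(4) by auto
  define g where "g x = exp (l x / 4)" for x
  have g: "g holomorphic_on ball (z p) e" unfolding g_def by (intro holomorphic_intros l(1)) auto
  have g4: "g x ^ 4 = Q x" if "x \<in> ball (z p) e" for x
    using l(2)[OF that] exp_of_nat_mult[of 4 "l x / 4"] by (simp add: g_def)
  obtain w0 where w0: "\<And>x. x \<in> ball (z p) e \<Longrightarrow> (w0 has_field_derivative g x) (at x within ball (z p) e)"
    using holomorphic_convex_primitive'[OF convex_ball open_ball g] by blast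
  then have w0': "(w0 has_field_derivative g x) (at x)" if "x \<in> ball (z p) e" for x
    using that at_within_open[OF that open_ball] by metis
  have w0h: "w0 holomorphic_on ball (z p) e" by (rule holomorphic_onI) (use w0 field_differentiable_def in blast)
  have zp: "z p \<in> ball (z p) e" using U(4) by simp
  have "deriv w0 (z p) \<noteq> 0" using DERIV_imp_deriv[OF w0'[OF zp]] by (simp add: g_def)
  then obtain r where r: "r > 0" "ball (z p) r \<subseteq> ball (z p) e" "inj_on w0 (ball (z p) r)"
    using has_complex_derivative_locally_injective[OF w0h zp open_ball] by blast
  obtain V d where V: "V \<subseteq> U" "p \<in> V" "coord V z" "d > 0" "z ` V = ball (z p) d" "ball (z p) d \<subseteq> ball (z p) r"
    by (rule ball_coordinate[OF surface U(1,2) open_ball, of "z p" r]) (use r(1) in auto)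
  have "coord V (w0 \<circ> z)"
    by (rule coordinate_compose[OF surface V(3) order_refl coordD(1)[OF V(3)]])
      (use V(5,6) r w0h in \<open>auto intro: holomorphic_on_subset inj_on_subset\<close>)
  then obtain V' d' where V': "V' \<subseteq> V" "p \<in> V'" "coord V' (w0 \<circ> z)" "d' > 0" "(w0 \<circ> z) ` V' = ball ((w0 \<circ> z) p) d'"
    using ball_coordinate[OF surface _ V(2) open_UNIV UNIV_I] by metis
  have "local_quartic V' (w0 \<circ> z) ((w0 \<circ> z) p') = 1" if p': "p' \<in> V'" for p'
  proof -
    have p'U: "p' \<in> U" using p' V V' by auto
    have zp': "z p' \<in> ball (z p) d" using p' V'(1) V(5) by blast
    then have zp'e: "z p' \<in> ball (z p) e" using V(6) r(2) by blast
    have "deriv ((w0 \<circ> z) \<circ> inv_into U z) (z p') = g (z p')"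
    proof (rule DERIV_imp_deriv)
      show "((w0 \<circ> z) \<circ> inv_into U z has_field_derivative g (z p')) (at (z p'))"
        by (rule has_field_derivative_transform_within_open[OF w0'[OF zp'e] open_ball zp'e])
          (use U(3) in \<open>auto simp: f_inv_into_f\<close>)
    qed
    then have "Q (z p') = g (z p') ^ 4 * local_quartic V' (w0 \<circ> z) ((w0 \<circ> z) p')"
      using quartic_transition(1)[OF U(1) V'(3), of p'] p'U p' by (simp add: Q_def comp_assoc)
    then show ?thesis using g4[OF zp'e] Q(2)[OF zp'e] by simp
  qed
  then have "normalised V' (w0 \<circ> z)" using V' unfolding normalised_def by (metis convex_ball)
  then show ?thesis using that V'(2) by blast
qed

lemma normalised_rotate:
  assumes n: "normalised U z" and d: "d ^ 4 = (1::complex)"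
  shows "normalised U (\<lambda>p. d * z p)"
proof -
  have c: "coord U z" and q: "\<And>p. p \<in> U \<Longrightarrow> local_quartic U z (z p) = 1" using n by (auto simp: normalised_def)
  have d0: "d \<noteq> 0" using d by auto
  have "coord U ((\<lambda>x. d * x) \<circ> z)"
    by (rule coordinate_compose[OF surface c order_refl coordD(1)[OF c]]) (use d0 in \<open>auto intro!: holomorphic_intros simp: inj_on_def\<close>)
  then have c': "coord U (\<lambda>p. d * z p)" by (simp add: comp_def)
  have "convex ((\<lambda>x. d * x) ` z ` U)"
    using n by (intro convex_linear_image bounded_linear.linear[OF bounded_linear_mult_right]) (simp add: normalised_def)
  then have "convex ((\<lambda>p. d * z p) ` U)" by (simp add: image_image)
  moreover have "local_quartic U (\<lambda>p. d * z p) (d * z p) = 1" if p: "p \<in> U" for p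
  proof -
    have zp: "z p \<in> z ` U" using p by auto
    have "deriv ((\<lambda>p. d * z p) \<circ> inv_into U z) (z p) = d"
    proof (rule DERIV_imp_deriv)
      have "((\<lambda>x. d * x) has_field_derivative d) (at (z p))" by (auto intro!: derivative_eq_intros)
      then show "((\<lambda>p. d * z p) \<circ> inv_into U z has_field_derivative d) (at (z p))"
        by (rule has_field_derivative_transform_within_open[OF _ coordD(2)[OF c] zp]) (auto simp: f_inv_into_f)
    qed
    then show ?thesis using quartic_transition(1)[OF c c', of p] p q[OF p] d by simp
  qed
  ultimately show ?thesis using c' unfolding normalised_def by blast
qed

text \<open>
  The transition function between two normalised coordinates has a derivative whose fourth
  power is 1, so this derivative is locally constant. Rotating one of the coordinates makes it
  1, and then the two lifts differ by a translation of the coordinate.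
\<close>

lemma normalised_match:
  assumes U: "normalised U z" and V: "normalised V w" and p: "p \<in> U" "p \<in> V"
  obtains w' where "normalised V w'"
    "\<And>h. lift_rotation (local_lift V w') h (w' p) = lift_rotation (local_lift U z) h (z p)"
proof -
  have cU: "coord U z" and cV: "coord V w" using U V by (auto simp: normalised_def)
  define d where "d = deriv (change V w z) (w p)"
  have d4: "d ^ 4 = 1"
    using quartic_transition(1)[OF cV cU, of p] p U V by (simp add: d_def normalised_def)
  then have d0: "d \<noteq> 0" by auto
  define w' where "w' q = d * w q" for q
  have nV': "normalised V w'" unfolding w'_def by (rule normalised_rotate[OF V d4])
  then have cV': "coord V w'" by (simp add: normalised_def)
  define \<phi> where "\<phi> = change V w' z"
  have oS: "open (w' ` (V \<inter> U))" and hol: "\<phi> holomorphic_on w' ` (V \<inter> U)"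
    unfolding \<phi>_def by (rule trans_open[OF cV' cU] trans_holomorphic[OF cV' cU])+
  have pS: "w' p \<in> w' ` (V \<inter> U)" using p by auto
  obtain r where r: "r > 0" "ball (w' p) r \<subseteq> w' ` (V \<inter> U)" using oS pS open_contains_ball by blast
  have \<phi>q: "\<phi> (w' q) = z q" if "q \<in> V" for q using trans_apply[OF cV' cU that] by (simp add: \<phi>_def)
  have d\<phi>4: "deriv \<phi> x ^ 4 = 1" if x: "x \<in> ball (w' p) r" for x
  proof -
    obtain q where q: "q \<in> V \<inter> U" "x = w' q" using r(2) x by blast
    show ?thesis using quartic_transition(1)[OF cV' cU q(1)] q nV' U by (simp add: \<phi>_def normalised_def)
  qed
  have d\<phi>p: "deriv \<phi> (w' p) = 1"
  proof -
    have 1: "((\<lambda>x. d * x) has_field_derivative d) (at (w p))" by (auto intro!: derivative_eq_intros)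
    have "(\<phi> has_field_derivative deriv \<phi> (w' p)) (at (d * w p))"
      using holomorphic_derivI[OF hol oS pS] by (simp add: w'_def)
    from DERIV_chain[OF this 1] have "(\<phi> \<circ> (\<lambda>x. d * x) has_field_derivative deriv \<phi> (w' p) * d) (at (w p))" .
    moreover have "(\<phi> \<circ> (\<lambda>x. d * x)) x = change V w z x" if x: "x \<in> w ` V" for x
      using x \<phi>q coordD(3)[OF cV] by (auto simp: w'_def)
    ultimately have "(change V w z has_field_derivative deriv \<phi> (w' p) * d) (at (w p))"
      using has_field_derivative_transform_within_open[OF _ coordD(2)[OF cV], of "\<phi> \<circ> (\<lambda>x. d * x)" _ "w p" "change V w z"] p by blast
    then have "d = deriv \<phi> (w' p) * d" unfolding d_def using DERIV_imp_deriv by blast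
    then show ?thesis using d0 by simp
  qed
  have d\<phi>1: "deriv \<phi> x = 1" if x: "x \<in> ball (w' p) r" for x
  proof -
    have h: "deriv \<phi> holomorphic_on ball (w' p) r" using holomorphic_deriv[OF hol oS] r(2) holomorphic_on_subset by blast
    have "finite (deriv \<phi> ` ball (w' p) r)"
      by (rule finite_subset[OF _ finite_nth_roots[of 4 1]]) (use d\<phi>4 in auto)
    then have "deriv \<phi> constant_on ball (w' p) r"
      by (intro continuous_finite_range_constant connected_ball holomorphic_on_imp_continuous_on[OF h])
    then show ?thesis using x d\<phi>p r(1) unfolding constant_on_def by (metis centre_in_ball)
  qed
  have D\<phi>: "(\<phi> has_field_derivative 1) (at x)" if x: "x \<in> ball (w' p) r" for x
    using holomorphic_derivI[OF hol oS, of x] r(2) x d\<phi>1[OF x] by auto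
  obtain c where LU: "normalised_lift (z ` U) (local_map U z) (local_lift U z) c" by (rule normalisedD[OF U])
  obtain c' where LV: "normalised_lift (w' ` V) (local_map V w') (local_lift V w') c'" by (rule normalisedD[OF nV'])
  interpret LU: normalised_lift "z ` U" "local_map U z" "local_lift U z" c by (rule LU)
  interpret LV: normalised_lift "w' ` V" "local_map V w'" "local_lift V w'" c' by (rule LV)
  have e: "local_lift V w' x = local_lift U z (\<phi> x)" if x: "x \<in> ball (w' p) r" for x
  proof -
    obtain q where q: "q \<in> V" "q \<in> U" "x = w' q" using r(2) x by blast
    have "fst (local_lift V w' (w' q)) = fst (local_lift U z (z q))"
      using quartic_transition(2)[OF cV' cU, of q] q d\<phi>1[OF x] by (simp add: \<phi>_def)
    then show ?thesis
      using LV.lift_eq[of "w' q"] LU.lift_eq[of "z q"] q local_map_eq[OF cV' q(1)] local_map_eq[OF cU q(2)] \<phi>q[OF q(1)] 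
      by (metis image_eqI)
  qed
  have "lift_rotation (local_lift V w') h (w' p) = lift_rotation (local_lift U z) h (\<phi> (w' p))" for h
  proof (rule lift_rotation_translation[OF open_ball _ LU.smooth_\<psi> e D\<phi>])
    show "\<phi> ` ball (w' p) r \<subseteq> z ` U" using r(2) \<phi>q by blast
  qed (use r(1) in auto)
  then show ?thesis using that[OF nV'] \<phi>q[OF p(2)] by simp
qed

text \<open>
  The group and the orbit are those of one point. The points of the orbit at which some
  normalised coordinate has the same generators form an open and closed set: on a normalised
  disc the generators are constant and the lift flows along the group.
\<close>

lemma nowhere_umbilic_imp_dupin:
  assumes nz: "\<And>U z p. coord U z \<Longrightarrow> p \<in> U \<Longrightarrow> local_quartic U z (z p) \<noteq> 0" and p0: "p0 \<in> topspace X"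
  shows "\<exists>S. dupin_orbit S \<and> f ` topspace X \<subseteq> S"
proof -
  obtain U0 z0 where U0: "normalised U0 z0" "p0 \<in> U0" by (rule normalised_coordinate[OF nz p0])
  obtain c0 where L0: "normalised_lift (z0 ` U0) (local_map U0 z0) (local_lift U0 z0) c0" by (rule normalisedD[OF U0(1)])
  interpret L0: normalised_lift "z0 ` U0" "local_map U0 z0" "local_lift U0 z0" c0 by (rule L0)
  define \<zeta>0 where "\<zeta>0 = z0 p0"
  have \<zeta>0: "\<zeta>0 \<in> z0 ` U0" using U0(2) by (simp add: \<zeta>0_def)
  define P where "P = L0.gen_x \<zeta>0"
  define R where "R = L0.gen_y \<zeta>0"
  interpret commuting_rotations "L0.X \<zeta>0" "L0.XX \<zeta>0" "L0.Y \<zeta>0" "L0.YY \<zeta>0" by (rule L0.commuting_generators[OF \<zeta>0])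
  obtain \<Phi> where sm: "smooth_on \<Phi> UNIV" and lor: "\<And>t. lorentz_transformation (\<Phi> t)"
    and hom: "\<And>t u. \<Phi> (t + u) = \<Phi> t o\<^sub>L \<Phi> u"
    and der: "\<And>t. (\<Phi> has_derivative (\<lambda>h. \<Phi> t o\<^sub>L (fst h *\<^sub>R P + snd h *\<^sub>R R))) (at t)"
    and one: "\<Phi> 0 = id_blinfun"
    by (rule two_parameter_group_exists[folded P_def R_def]) (rule that; assumption)
  define x0 where "x0 = f p0"
  have x0: "x0 \<in> sphere 0 1" using f_sphere[OF p0] by (simp add: x0_def)
  define S where "S = range (\<lambda>t. moebius (\<Phi> t) x0)"
  have dupin: "dupin_orbit S"
    unfolding S_def
  proof (rule dupin_orbitI[OF sm lor hom der x0])
    define l where "l = fst (local_lift U0 z0 \<zeta>0)"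
    have l: "l > 0" using L0.real_frame(2)[OF \<zeta>0] by (simp add: l_def)
    show "inverse (l * l) > 0" using l by simp
    have "local_lift U0 z0 \<zeta>0 = l *\<^sub>R (1, x0)"
      using L0.lift_eq[OF \<zeta>0] local_map_eq[of U0 z0 p0] U0 by (simp add: l_def x0_def \<zeta>0_def normalised_def)
    then have x: "(1, x0) = inverse l *\<^sub>R local_lift U0 z0 \<zeta>0" using l by simp
    have PR: "blinfun_apply P (1, x0) = inverse l *\<^sub>R L0.X \<zeta>0" "blinfun_apply R (1, x0) = inverse l *\<^sub>R L0.Y \<zeta>0"
      unfolding x blinfun.scaleR_right P_def R_def L0.generators_lift[OF \<zeta>0] by simp_all
    show "form (blinfun_apply (a *\<^sub>R P + b *\<^sub>R R) (1, x0)) (blinfun_apply (a *\<^sub>R P + b *\<^sub>R R) (1, x0)) = inverse (l * l) * (a\<^sup>2 + b\<^sup>2)" for a b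
      using L0.real_frame(3-5)[OF \<zeta>0] form_commute[of "L0.Y \<zeta>0" "L0.X \<zeta>0"]
      by (simp add: blinfun.add_left blinfun.scaleR_left PR form.add_left form.add_right form.scaleR_left form.scaleR_right
          power2_eq_square algebra_simps)
  qed
  define G where "G p \<longleftrightarrow> f p \<in> S \<and> (\<exists>U z. normalised U z \<and> p \<in> U \<and>
     lift_rotation (local_lift U z) 1 (z p) = P \<and> lift_rotation (local_lift U z) \<i> (z p) = R)" for p
  have "G p" if "p \<in> topspace X" for p
  proof (rule clopen_induct[where P = G, OF _ p0 _ _ that])
    show "connected_space X" using surface by (simp add: riemann_surface_def)
    have "moebius (\<Phi> 0) x0 = x0" by (simp add: one moebius_def)
    then have "f p0 \<in> S" unfolding S_def x0_def by (metis rangeI)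
    then show "G p0"
      unfolding G_def using U0 L0.lift_rotation_eq[of \<zeta>0] by (auto simp: P_def R_def \<zeta>0_def)
    fix q assume q: "q \<in> topspace X"
    obtain V w where V: "normalised V w" "q \<in> V" by (rule normalised_coordinate[OF nz q])
    have "G p2" if p1: "p1 \<in> V" "G p1" and p2: "p2 \<in> V" for p1 p2
    proof -
      obtain U z where U: "normalised U z" "p1 \<in> U" "lift_rotation (local_lift U z) 1 (z p1) = P"
         "lift_rotation (local_lift U z) \<i> (z p1) = R" and f1: "f p1 \<in> S"
        using p1(2) unfolding G_def by blast
      obtain w' where w': "normalised V w'"
        "\<And>h. lift_rotation (local_lift V w') h (w' p1) = lift_rotation (local_lift U z) h (z p1)"
        by (rule normalised_match[OF U(1) V(1) U(2) p1(1)]) blast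
      obtain c where L: "normalised_lift (w' ` V) (local_map V w') (local_lift V w') c" by (rule normalisedD[OF w'(1)])
      interpret L: normalised_lift "w' ` V" "local_map V w'" "local_lift V w'" c by (rule L)
      have cV: "coord V w'" and cvx: "convex (w' ` V)" using w'(1) by (auto simp: normalised_def)
      have d1: "w' p1 \<in> w' ` V" and d2: "w' p2 \<in> w' ` V" using p1 p2 by auto
      have g1: "L.gen_x (w' p1) = P" "L.gen_y (w' p1) = R"
        using w'(2)[of 1] w'(2)[of \<i>] U(3,4) L.lift_rotation_eq by simp_all
      have g: "L.gen_x x = P" "L.gen_y x = R" if "x \<in> w' ` V" for x
        using L.generators_constant[OF cvx that d1] g1 by simp_all
      obtain t where t: "local_lift V w' (w' p2) = \<Phi> t (local_lift V w' (w' p1))"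
        by (rule L.lift_flow[OF hom one der g cvx d1 d2])
      define l1 l2 where "l1 = fst (local_lift V w' (w' p1))" and "l2 = fst (local_lift V w' (w' p2))"
      have l: "l1 > 0" "l2 > 0" using L.real_frame(2) d1 d2 by (auto simp: l1_def l2_def)
      have e1: "local_lift V w' (w' p1) = l1 *\<^sub>R (1, f p1)" and e2: "local_lift V w' (w' p2) = l2 *\<^sub>R (1, f p2)"
        using L.lift_eq[OF d1] L.lift_eq[OF d2] local_map_eq[OF cV p1(1)] local_map_eq[OF cV p2] by (simp_all add: l1_def l2_def)
      have "moebius (\<Phi> t) (f p1) = snd (l2 *\<^sub>R (1::real, f p2)) /\<^sub>R fst (l2 *\<^sub>R (1::real, f p2))"
        unfolding t[unfolded e1 e2] by (rule moebius_scale[symmetric]) (use l(1) in simp)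
      also have "\<dots> = f p2" using l by simp
      finally have f2: "f p2 = moebius (\<Phi> t) (f p1)" by simp
      obtain u where u: "f p1 = moebius (\<Phi> u) x0" using f1 unfolding S_def by blast
      have "f p2 = moebius (\<Phi> (t + u)) x0" unfolding hom moebius_compose[OF lor x0] f2 u ..
      then have "f p2 \<in> S" unfolding S_def by blast
      then show ?thesis unfolding G_def using w'(1) p2 g[OF d2] L.lift_rotation_eq by blast
    qed
    then show "\<exists>V. openin X V \<and> q \<in> V \<and> ((\<exists>p\<in>V. G p) \<longrightarrow> (\<forall>p\<in>V. G p))"
      using V coordD(1) unfolding normalised_def by blast
  qed
  then show ?thesis using dupin unfolding G_def by blast
qed

end

theorem theorem3p2:
  fixes X :: "'m topology" and A :: "('m set \<times> ('m \<Rightarrow> complex)) set"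
    and f :: "'m \<Rightarrow> real^4"
  assumes "riemann_surface X A"
    and "conformal_immersion X A f"
    and "\<not> (\<exists>S. round_2_sphere S \<and> f ` topspace X \<subseteq> S)"
    and "holomorphic_schwarzian X A f"
  shows "cyclide_of_Dupin X f"
proof -
  interpret holomorphic_schwarzian_surface X A f by unfold_locales (rule assms)+
  have "topspace X \<noteq> {}"
  proof
    assume "topspace X = {}"
    moreover have "form (0, axis 1 1) (0, axis 1 1 :: real^4) = (axis 1 1 :: real^4) \<bullet> axis 1 1"
      by (simp add: lorentz_form_def inner_vec_def)
    then have "\<exists>S. round_2_sphere S \<and> {} \<subseteq> S"
      by (intro round_2_sphere_of_normal[of "(0, axis 1 1)"]) (simp_all add: inner_axis_axis)
    ultimately show False using assms(3) by simp
  qed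
  then obtain p0 where p0: "p0 \<in> topspace X" by blast
  show ?thesis
  proof (cases "\<exists>U z p. coord U z \<and> p \<in> U \<and> local_quartic U z (z p) = 0")
    case True
    then obtain U z p where U: "coord U z" "p \<in> U" "local_quartic U z (z p) = 0" by blast
    then have "\<exists>S. round_2_sphere S \<and> f ` topspace X \<subseteq> S"
      by (intro umbilic_in_round_sphere[OF U(1,2)] quartic_dichotomy[OF U])
    then show ?thesis using assms(3) by blast
  next
    case False
    then show ?thesis unfolding cyclide_of_Dupin_def by (intro nowhere_umbilic_imp_dupin[OF _ p0]) blast
  qed
qed

end
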